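(* Let $N$ be a marked Poisson cluster process (as described in the context) with cluster totals $D_i$ and residue $\varepsilon_t$. Assume that the $D_i$ are regularly varying with index $\alpha\in(0,1)$, let $D$ be a random variable with the law of $D_1$, and let $(a_n)$ be a sequence with $a_n\to\infty$ and $n\,\mathbb{P}(D>a_n)\to1$; put $a_t=a_{\lfloor t\rfloor}$ for real $t\ge1$. If $\varepsilon_t=o_P(a_t)$ as $t\to\infty$, then there exists an $\alpha$-stable random variable $G_\alpha$ such that, as $t\to\infty$, $$\frac{S(t)}{a_{\nu t}}\ \stackrel{d}{\longrightarrow}\ G_\alpha .$$
   Context: Marked Poisson cluster model. Let $\mathbb{S}$ be a completely metrizable separable space with Borel $\sigma$-algebra $\mathcal S$, $Q$ a probability measure on $\mathbb{S}$, and $\nu>0$ a constant. Let $N^0=\sum_{i\ge1}\delta_{\Gamma_i,A_i}$ be a Poisson point process on $[0,\infty)\times\mathbb{S}$ with intensity $(\nu\,\mathrm{Leb})\times Q$, where $\Gamma_1\le\Gamma_2\le\cdots$. Let $M_p$ be the space of locally finite point measures on $[0,\infty)\times\mathbb{S}$. There is a probability kernel from $\mathbb{S}$ to $M_p$, denoted $\mathcal K$, such that, conditionally on $N^0$, point processes $G^{A_i}$, $i\ge1$, are independent, a.s. finite, with $G^{A_i}$ having law $\mathcal K(A_i,\cdot)$. Write $G^{A_i}=\sum_{j=1}^{K_i}\delta_{T_{ij},A_{ij}}$, where $K_i$ is $\mathbb{N}_0$-valued and $T_{ij}\ge0$; $K_i$ may depend on $A_i$, and it is assumed that $\mathbb{E}K_i<\infty$.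 Set $T_{i0}=0$, $A_{i0}=A_i$. The cluster process is $N=\sum_{i\ge1}\sum_{j=0}^{K_i}\delta_{\Gamma_i+T_{ij},A_{ij}}$. Let $f:\mathbb{S}\to[0,\infty)$ be measurable and $X_{ij}=f(A_{ij})$. Total claim amount: $S(t)=\int_{[0,t]\times\mathbb{S}}f(a)\,N(ds,da)$. Cluster totals: $D_i=\sum_{j=0}^{K_i}X_{ij}$ (i.i.d. in $i$). Residue at time $t\ge 0$: $\varepsilon_t=\sum_{i,j:\ 0\le\Gamma_i\le t<\Gamma_i+T_{ij}}X_{ij}$ (with $1\le j\le K_i$). A nonnegative random variable $Z$ is regularly varying with index $\alpha>0$ if $\mathbb{P}(Z>x)=x^{-\alpha}\ell(x)$ with $\ell$ slowly varying at infinity. $\varepsilon_t=o_P(a_t)$ means $\varepsilon_t/a_t\to0$ in probability. Stable random variables are understood to be non-degenerate. *)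

theory Defs
  imports "HOL-Probability.Probability"
begin

section \<open>Point measures and Poisson point processes\<close>

text \<open>The space \<open>[0,\<infinity>) \<times> S\<close> with its Borel sets, \<open>S\<close> being the whole type \<^typ>\<open>'a\<close>.\<close>

definition time_mark_space :: "(real \<times> 'a::topological_space) measure" where
  "time_mark_space = restrict_space borel {0..} \<Otimes>\<^sub>M borel"

text \<open>The sum over \<open>i \<in> I\<close> of the Dirac masses at \<open>x i\<close>: the mass of \<open>B\<close> is the number of
  \<open>i \<in> I\<close> with \<open>x i \<in> B\<close>.\<close>

definition dirac_sum :: "'i set \<Rightarrow> ('i \<Rightarrow> real \<times> 'a) \<Rightarrow> (real \<times> 'a::topological_space) measure" where
  "dirac_sum I x = distr (count_space I) time_mark_space x"

definition locally_finite_measure :: "(real \<times> 'a::topological_space) measure \<Rightarrow> bool" where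
  "locally_finite_measure m \<longleftrightarrow>
     (\<forall>p\<in>space m. \<exists>U. open U \<and> p \<in> U \<and> emeasure m (U \<inter> space m) < \<infinity>)"

definition locally_finite_point_measures :: "(real \<times> 'a::topological_space) measure set" where
  "locally_finite_point_measures =
     {m. (\<exists>(I::nat set) x. x \<in> I \<rightarrow> space time_mark_space \<and> m = dirac_sum I x) \<and>
         locally_finite_measure m}"

text \<open>The space \<open>M\<^sub>p\<close>, with the \<open>\<sigma>\<close>-algebra generated by the evaluations \<open>m \<mapsto> m(B)\<close>.\<close>

definition point_measure_space :: "(real \<times> 'a::topological_space) measure measure" where
  "point_measure_space =
     (SUP B \<in> sets (time_mark_space :: (real \<times> 'a) measure).
        vimage_algebra locally_finite_point_measures (\<lambda>m. emeasure m B) borel)"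

text \<open>Here \<open>N\<close> is a random measure and \<open>\<mu>\<close> its intensity.\<close>

definition (in prob_space) poisson_point_process ::
    "('a \<Rightarrow> 'b measure) \<Rightarrow> 'b measure \<Rightarrow> bool" where
  "poisson_point_process N \<mu> \<longleftrightarrow>
     (\<forall>\<omega>\<in>space M. sets (N \<omega>) = sets \<mu>) \<and>
     (\<forall>B\<in>sets \<mu>. random_variable borel (\<lambda>\<omega>. emeasure (N \<omega>) B)) \<and>
     (\<forall>B\<in>sets \<mu>. emeasure \<mu> B < \<infinity> \<longrightarrow>
        (\<forall>k::nat. prob {\<omega>\<in>space M. emeasure (N \<omega>) B = of_nat k} =
           measure \<mu> B ^ k / fact k * exp (- measure \<mu> B))) \<and>
     (\<forall>(J::nat set) B. finite J \<longrightarrow> B \<in> J \<rightarrow> sets \<mu> \<longrightarrow> disjoint_family_on B J \<longrightarrow>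
        indep_vars (\<lambda>_. borel) (\<lambda>j \<omega>. emeasure (N \<omega>) (B j)) J)"

section \<open>The marked Poisson cluster process\<close>

text \<open>
  The points of \<open>N\<^sup>0\<close> are enumerated by \<open>i = 0, 1, 2, \<dots>\<close> instead of \<open>i = 1, 2, \<dots>\<close>.
  The immigrants are included in the families \<open>T\<close> and \<open>A\<close> as the points with \<open>j = 0\<close>, so that
  \<open>A i 0\<close> is the mark \<open>A\<^sub>i\<close>, while the offspring of immigrant \<open>i\<close> are the points with
  \<open>1 \<le> j \<le> K i\<close>. The values of \<open>T i j\<close> and \<open>A i j\<close> for \<open>j > K i\<close> are irrelevant.
\<close>

definition immigrant_process ::
    "(nat \<Rightarrow> 'w \<Rightarrow> real) \<Rightarrow> (nat \<Rightarrow> nat \<Rightarrow> 'w \<Rightarrow> 'a) \<Rightarrow> 'w \<Rightarrow> (real \<times> 'a::topological_space) measure"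
  where "immigrant_process \<Gamma> A \<omega> = dirac_sum UNIV (\<lambda>i. (\<Gamma> i \<omega>, A i 0 \<omega>))"

definition offspring_process ::
    "(nat \<Rightarrow> 'w \<Rightarrow> nat) \<Rightarrow> (nat \<Rightarrow> nat \<Rightarrow> 'w \<Rightarrow> real) \<Rightarrow> (nat \<Rightarrow> nat \<Rightarrow> 'w \<Rightarrow> 'a) \<Rightarrow>
      nat \<Rightarrow> 'w \<Rightarrow> (real \<times> 'a::topological_space) measure"
  where "offspring_process K T A i \<omega> = dirac_sum {1..K i \<omega>} (\<lambda>j. (T i j \<omega>, A i j \<omega>))"

definition cluster_process ::
    "(nat \<Rightarrow> 'w \<Rightarrow> real) \<Rightarrow> (nat \<Rightarrow> 'w \<Rightarrow> nat) \<Rightarrow> (nat \<Rightarrow> nat \<Rightarrow> 'w \<Rightarrow> real) \<Rightarrow>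
      (nat \<Rightarrow> nat \<Rightarrow> 'w \<Rightarrow> 'a) \<Rightarrow> 'w \<Rightarrow> (real \<times> 'a::topological_space) measure"
  where "cluster_process \<Gamma> K T A \<omega> =
    dirac_sum {(i, j). j \<le> K i \<omega>} (\<lambda>(i, j). (\<Gamma> i \<omega> + T i j \<omega>, A i j \<omega>))"

text \<open>
  The \<open>\<sigma>\<close>-algebra generated by \<open>N\<^sup>0\<close>, through its sequence of points \<open>(\<Gamma>\<^sub>i, A\<^sub>i)\<close>. As the
  \<open>\<Gamma>\<^sub>i\<close> are almost surely strictly increasing, these points are almost surely determined by
  the measure \<open>N\<^sup>0\<close>.
\<close>

definition immigrant_algebra ::
    "'w measure \<Rightarrow> (nat \<Rightarrow> 'w \<Rightarrow> real) \<Rightarrow> (nat \<Rightarrow> nat \<Rightarrow> 'w \<Rightarrow> 'a::topological_space) \<Rightarrow> 'w measure"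
  where "immigrant_algebra M \<Gamma> A =
    vimage_algebra (space M) (\<lambda>\<omega> i. (\<Gamma> i \<omega>, A i 0 \<omega>)) (\<Pi>\<^sub>M i\<in>UNIV. time_mark_space)"

locale marked_poisson_cluster = prob_space M
  for M :: "'w measure" +
  fixes Q :: "'a::polish_space measure"
    and \<nu> :: real
    and \<K> :: "'a \<Rightarrow> (real \<times> 'a) measure measure"
    and \<Gamma> :: "nat \<Rightarrow> 'w \<Rightarrow> real"
    and K :: "nat \<Rightarrow> 'w \<Rightarrow> nat"
    and T :: "nat \<Rightarrow> nat \<Rightarrow> 'w \<Rightarrow> real"
    and A :: "nat \<Rightarrow> nat \<Rightarrow> 'w \<Rightarrow> 'a"
  assumes prob_Q: "prob_space Q"
    and sets_Q: "sets Q = sets borel"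
    and rate_pos: "0 < \<nu>"
    and kernel: "\<K> \<in> borel \<rightarrow>\<^sub>M prob_algebra point_measure_space"
    and rv_Gamma: "\<And>i. random_variable borel (\<Gamma> i)"
    and rv_K: "\<And>i. random_variable (count_space UNIV) (K i)"
    and rv_T: "\<And>i j. random_variable borel (T i j)"
    and rv_A: "\<And>i j. random_variable borel (A i j)"
    and Gamma_nonneg: "\<And>i \<omega>. \<omega> \<in> space M \<Longrightarrow> 0 \<le> \<Gamma> i \<omega>"
    and Gamma_mono: "\<And>\<omega>. \<omega> \<in> space M \<Longrightarrow> incseq (\<lambda>i. \<Gamma> i \<omega>)"
    and T_0: "\<And>i \<omega>. \<omega> \<in> space M \<Longrightarrow> T i 0 \<omega> = 0"
    and T_nonneg: "\<And>i j \<omega>. \<omega> \<in> space M \<Longrightarrow> j \<le> K i \<omega> \<Longrightarrow> 0 \<le> T i j \<omega>"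
    and K_integrable: "\<And>i. integrable M (\<lambda>\<omega>. real (K i \<omega>))"
    and immigrants_poisson:
      "poisson_point_process (immigrant_process \<Gamma> A)
         (scale_measure (ennreal \<nu>) (restrict_space lborel {0..}) \<Otimes>\<^sub>M Q)"
    and offspring_cond_indep:
      "\<And>J B. finite J \<Longrightarrow> B \<in> J \<rightarrow> sets point_measure_space \<Longrightarrow>
         AE \<omega> in M.
           real_cond_exp M (immigrant_algebra M \<Gamma> A)
             (indicator {\<omega>' \<in> space M. \<forall>i\<in>J. offspring_process K T A i \<omega>' \<in> B i}) \<omega> =
           (\<Prod>i\<in>J. measure (\<K> (A i 0 \<omega>)) (B i))"

definition total_claim ::
    "('a \<Rightarrow> real) \<Rightarrow> (nat \<Rightarrow> 'w \<Rightarrow> real) \<Rightarrow> (nat \<Rightarrow> 'w \<Rightarrow> nat) \<Rightarrow> (nat \<Rightarrow> nat \<Rightarrow> 'w \<Rightarrow> real) \<Rightarrow>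
      (nat \<Rightarrow> nat \<Rightarrow> 'w \<Rightarrow> 'a::topological_space) \<Rightarrow> real \<Rightarrow> 'w \<Rightarrow> real"
  where "total_claim f \<Gamma> K T A t \<omega> =
    (LINT (s, a):{0..t} \<times> UNIV|cluster_process \<Gamma> K T A \<omega>. f a)"

definition cluster_total ::
    "('a \<Rightarrow> real) \<Rightarrow> (nat \<Rightarrow> 'w \<Rightarrow> nat) \<Rightarrow> (nat \<Rightarrow> nat \<Rightarrow> 'w \<Rightarrow> 'a) \<Rightarrow> nat \<Rightarrow> 'w \<Rightarrow> real"
  where "cluster_total f K A i \<omega> = (\<Sum>j = 0..K i \<omega>. f (A i j \<omega>))"

text \<open>The integral above and the sum below have almost surely finitely many nonzero terms.\<close>

definition residue_at ::
    "('a \<Rightarrow> real) \<Rightarrow> (nat \<Rightarrow> 'w \<Rightarrow> real) \<Rightarrow> (nat \<Rightarrow> 'w \<Rightarrow> nat) \<Rightarrow> (nat \<Rightarrow> nat \<Rightarrow> 'w \<Rightarrow> real) \<Rightarrow>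
      (nat \<Rightarrow> nat \<Rightarrow> 'w \<Rightarrow> 'a) \<Rightarrow> real \<Rightarrow> 'w \<Rightarrow> real"
  where "residue_at f \<Gamma> K T A t \<omega> =
    (\<Sum>\<^sub>\<infinity>(i, j)\<in>{(i, j). 1 \<le> j \<and> j \<le> K i \<omega> \<and> 0 \<le> \<Gamma> i \<omega> \<and> \<Gamma> i \<omega> \<le> t \<and> t < \<Gamma> i \<omega> + T i j \<omega>}.
       f (A i j \<omega>))"

section \<open>Regular variation, stable laws and modes of convergence\<close>

definition slowly_varying :: "(real \<Rightarrow> real) \<Rightarrow> bool" where
  "slowly_varying l \<longleftrightarrow> set_borel_measurable borel {0<..} l \<and> (\<forall>\<^sub>F x in at_top. 0 < l x) \<and>
     (\<forall>c>0. ((\<lambda>x. l (c * x) / l x) \<longlongrightarrow> 1) at_top)"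

definition (in prob_space) regularly_varying :: "('a \<Rightarrow> real) \<Rightarrow> real \<Rightarrow> bool" where
  "regularly_varying Z \<alpha> \<longleftrightarrow> random_variable borel Z \<and> (\<forall>\<omega>\<in>space M. 0 \<le> Z \<omega>) \<and> 0 < \<alpha> \<and>
     (\<exists>l. slowly_varying l \<and> (\<forall>x>0. \<P>(\<omega> in M. Z \<omega> > x) = x powr (- \<alpha>) * l x))"

text \<open>The sequence \<open>a\<close> extended to real indices by \<open>a\<^sub>t = a\<^bsub>\<lfloor>t\<rfloor>\<^esub>\<close> (meant for \<open>t \<ge> 1\<close>).\<close>

definition at_floor :: "(nat \<Rightarrow> real) \<Rightarrow> real \<Rightarrow> real" where
  "at_floor a t = a (nat \<lfloor>t\<rfloor>)"

text \<open>\<open>X\<^sub>t = o\<^sub>P(b\<^sub>t)\<close> as \<open>t \<rightarrow> \<infinity>\<close>.\<close>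

definition (in prob_space) small_o_prob :: "(real \<Rightarrow> 'a \<Rightarrow> real) \<Rightarrow> (real \<Rightarrow> real) \<Rightarrow> bool" where
  "small_o_prob X b \<longleftrightarrow>
     (\<forall>\<delta>>0. ((\<lambda>t. \<P>(\<omega> in M. \<bar>X t \<omega> / b t\<bar> > \<delta>)) \<longlongrightarrow> 0) at_top)"

text \<open>The analogue of \<^const>\<open>weak_conv_m\<close> for families indexed by a real \<open>t \<rightarrow> \<infinity>\<close>.\<close>

definition weak_conv_at_top :: "(real \<Rightarrow> real measure) \<Rightarrow> real measure \<Rightarrow> bool" where
  "weak_conv_at_top \<mu> \<mu>' \<longleftrightarrow>
     (\<forall>x. isCont (cdf \<mu>') x \<longrightarrow> ((\<lambda>t. cdf (\<mu> t) x) \<longlongrightarrow> cdf \<mu>' x) at_top)"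

text \<open>
  Non-degenerate stable laws of index \<open>\<alpha>\<close>: if \<open>X, X\<^sub>1, X\<^sub>2\<close> are independent with law \<open>\<mu>\<close> and
  \<open>b, c > 0\<close>, then \<open>b X\<^sub>1 + c X\<^sub>2\<close> has the law of \<open>d X + e\<close> for some \<open>d > 0\<close> and \<open>e\<close>, where
  \<open>d\<^sup>\<alpha> = b\<^sup>\<alpha> + c\<^sup>\<alpha>\<close>.
\<close>

definition stable_law :: "real \<Rightarrow> real measure \<Rightarrow> bool" where
  "stable_law \<alpha> \<mu> \<longleftrightarrow> real_distribution \<mu> \<and> (\<nexists>c. \<mu> = return borel c) \<and>
     (\<forall>b>0. \<forall>c>0. \<exists>d>0. \<exists>e. d powr \<alpha> = b powr \<alpha> + c powr \<alpha> \<and>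
        distr (\<mu> \<Otimes>\<^sub>M \<mu>) borel (\<lambda>(x, y). b * x + c * y) = distr \<mu> borel (\<lambda>x. d * x + e))"

definition (in prob_space) stable_rv :: "('a \<Rightarrow> real) \<Rightarrow> real \<Rightarrow> bool" where
  "stable_rv G \<alpha> \<longleftrightarrow> random_variable borel G \<and> stable_law \<alpha> (distr M borel G)"

end

theory Submission
  imports Defs "HOL-Real_Asymp.Real_Asymp"
begin

text \<open>
  The proof works with Laplace transforms throughout. Let \<open>N\<^sub>t\<close> be the number of immigrants up to
  time \<open>t\<close> and \<open>Y\<^sub>t = D\<^sub>0 + \<dots> + D\<^bsub>N\<^sub>t - 1\<^esub>\<close> the total of the clusters that they start. Every claim
  counted by \<open>Y\<^sub>t\<close> is either settled by time \<open>t\<close> or belongs to the residue, so that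
  \<open>S(t) + \<epsilon>\<^sub>t = Y\<^sub>t\<close> almost surely (\<open>total_claim_plus_residue\<close>).

  The variable \<open>Y\<^sub>t\<close> is a compound Poisson sum: with \<open>\<phi>(u) = E exp (- u D\<^sub>0)\<close> it satisfies
  \<open>E exp (- u Y\<^sub>t) = exp (- \<nu> t (1 - \<phi>(u)))\<close> (\<open>Laplace_aggregate\<close>). To see this,
  condition on the immigrants. The clusters are then independent, so the conditional expectation of \<open>exp (- u Y\<^sub>t)\<close> is a product over the immigrants of
  a function \<open>g\<close> of their marks (\<open>cond_Laplace_clusters\<close>); the expectation of that product is given by
  the Poisson process (\<open>poisson_product\<close>) and involves only \<open>\<integral> g dQ\<close>. This integral is \<open>\<phi>(u)\<close>
  because the first immigrant has a mark with law \<open>Q\<close> (\<open>distr_first_mark\<close>).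

  Integrating the tail of \<open>D\<^sub>0\<close> against an exponential density and using regular variation gives
  \<open>n (1 - \<phi>(s / a\<^sub>n)) \<longlonglongrightarrow> \<Gamma>(1 - \<alpha>) s\<^sup>\<alpha>\<close> (\<open>Laplace_scaling_limit\<close>); the
  limiting integral converges at \<open>0\<close> because \<open>\<alpha> < 1\<close>. With \<open>n = \<lfloor>\<nu> t\<rfloor>\<close> the Laplace transform of \<open>Y\<^sub>t\<close>, scaled by
  \<open>a\<^bsub>\<nu> t\<^esub>\<close>, converges to \<open>exp (- \<Gamma>(1 - \<alpha>) s\<^sup>\<alpha>)\<close>. The hypothesis on the residue is normalised by
  \<open>a\<^sub>t\<close>, but \<open>a\<^sub>t / a\<^bsub>\<nu> t\<^esub>\<close> stays bounded (\<open>normalizing_ratio_bounded\<close>), so \<open>S(t)\<close> has the same limit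
  (\<open>Laplace_perturbation\<close>).

  It remains to pass from Laplace transforms to laws. Continuity of the limit at \<open>0\<close> yields tightness,
  Helly's theorem a limit law, and Weierstrass approximation in the variable \<open>exp (- x)\<close> uniqueness
  and weak convergence (\<open>weak_conv_at_top_of_Laplace\<close>). That the limit law is stable is read off from
  the identity \<open>b\<^sup>\<alpha> s\<^sup>\<alpha> + c\<^sup>\<alpha> s\<^sup>\<alpha> = (d s)\<^sup>\<alpha>\<close> between exponents (\<open>stable_law_of_Laplace\<close>).
\<close>

section \<open>Laplace transforms of laws on the half-line\<close>

lemma integrable_exp_neg:
  assumes "real_distribution \<mu>" "AE x in \<mu>. 0 \<le> x" "0 \<le> s"
  shows "integrable \<mu> (\<lambda>x. exp (- s * x))"
proof -
  interpret real_distribution \<mu> by fact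
  show ?thesis
    by (rule integrable_const_bound[of _ 1]) (use assms in \<open>auto intro: mult_nonneg_nonneg\<close>)
qed

text \<open>
  The Laplace transforms at the natural numbers are the moments of the variable \<open>z = exp (- x)\<close>, which
  lies in \<open>[0,1]\<close>. By Weierstrass they control the integrals of all continuous functions of \<open>z\<close>, that
  is, of all continuous functions of \<open>x \<ge> 0\<close> with a limit at infinity. The test function \<open>h\<close> is kept
  apart from \<open>g\<close> because it has to be measurable on the negative half-line, where \<open>exp (- x)\<close> leaves
  the domain of \<open>g\<close>.
\<close>

lemma tendsto_integral_of_Laplace:
  fixes \<mu> :: "nat \<Rightarrow> real measure" and g h :: "real \<Rightarrow> real"
  assumes \<mu>: "\<And>n. real_distribution (\<mu> n)" "\<And>n. AE x in \<mu> n. 0 \<le> x"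
    and \<mu>': "real_distribution \<mu>'" "AE x in \<mu>'. 0 \<le> x"
    and L: "\<And>s. 0 < s \<Longrightarrow> (\<lambda>n. \<integral>x. exp (- s * x) \<partial>\<mu> n) \<longlonglongrightarrow> (\<integral>x. exp (- s * x) \<partial>\<mu>')"
    and g: "continuous_on {0..1} g"
    and h: "h \<in> borel_measurable borel" "\<And>x. 0 \<le> x \<Longrightarrow> h x = g (exp (- x))"
  shows "(\<lambda>n. \<integral>x. h x \<partial>\<mu> n) \<longlonglongrightarrow> (\<integral>x. h x \<partial>\<mu>')"
proof (rule LIMSEQ_I)
  fix e :: real assume "0 < e"
  then have "0 < e / 3" by simp
  with g obtain p where p: "real_polynomial_function p"
      "\<And>x. x \<in> {0..1} \<Longrightarrow> \<bar>g x - p x\<bar> < e / 3"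
    using Stone_Weierstrass_real_polynomial_function[of "{0..1::real}" g "e/3"] by auto
  from p(1) obtain c N where pc: "p = (\<lambda>x. \<Sum>i\<le>N. c i * x ^ i)"
    by (auto simp: real_polynomial_function_iff_sum)
  have pe: "p (exp (- x)) = (\<Sum>i\<le>N. c i * exp (- real i * x))" for x
    unfolding pc by (simp add: exp_of_nat_mult [symmetric] mult.commute)
  have int: "integrable M (\<lambda>x. exp (- real i * x))" if "real_distribution M" "AE x in M. 0 \<le> x" for M i
    by (rule integrable_exp_neg) (use that in auto)
  have conv: "(\<lambda>n. \<integral>x. p (exp (- x)) \<partial>\<mu> n) \<longlonglongrightarrow> (\<integral>x. p (exp (- x)) \<partial>\<mu>')"
  proof -
    have "(\<lambda>n. \<integral>x. exp (- real i * x) \<partial>\<mu> n) \<longlonglongrightarrow> (\<integral>x. exp (- real i * x) \<partial>\<mu>')" for i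
    proof (cases i)
      case 0
      have "prob_space (\<mu> n)" for n using \<mu>(1)[of n] by (simp add: real_distribution_def)
      moreover have "prob_space \<mu>'" using \<mu>' by (simp add: real_distribution_def)
      ultimately show ?thesis using 0 by (simp add: prob_space.prob_space)
    next
      case (Suc m)
      then show ?thesis by (intro L) simp
    qed
    then show ?thesis
      unfolding pe
      by (subst (1 2) Bochner_Integration.integral_sum)
         (auto intro!: tendsto_intros integrable_mult_right int[unfolded mult_minus_left] \<mu> \<mu>')
  qed
  have close: "\<bar>(\<integral>x. h x \<partial>M) - (\<integral>x. p (exp (- x)) \<partial>M)\<bar> \<le> e / 3"
    if M: "real_distribution M" "AE x in M. 0 \<le> x" for M
  proof -
    interpret real_distribution M by fact
    have ip: "integrable M (\<lambda>x. p (exp (- x)))"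
      unfolding pe by (intro Bochner_Integration.integrable_sum integrable_mult_right int M)
    have le: "AE x in M. \<bar>h x - p (exp (- x))\<bar> \<le> e / 3"
      using M(2) by eventually_elim (use p(2) h(2) in \<open>auto intro: less_imp_le\<close>)
    have mh [measurable]: "h \<in> borel_measurable M" using h(1) by simp
    have mp: "(\<lambda>x. p (exp (- x))) \<in> borel_measurable M" using ip by auto
    have id: "integrable M (\<lambda>x. h x - p (exp (- x)))"
      by (rule integrable_const_bound[of _ "e / 3"]) (use le mp in auto)
    have ih: "integrable M h"
      using Bochner_Integration.integrable_add[OF id ip] by simp
    have "\<bar>(\<integral>x. h x \<partial>M) - (\<integral>x. p (exp (- x)) \<partial>M)\<bar> = \<bar>\<integral>x. h x - p (exp (- x)) \<partial>M\<bar>"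
      using ih ip by simp
    also have "\<dots> \<le> (\<integral>x. \<bar>h x - p (exp (- x))\<bar> \<partial>M)" by (rule integral_abs_bound)
    also have "\<dots> \<le> (\<integral>x. e / 3 \<partial>M)"
      by (rule integral_mono_AE) (use id le in auto)
    also have "\<dots> = e / 3" using prob_space by simp
    finally show ?thesis .
  qed
  from conv \<open>0 < e / 3\<close> obtain n0 where n0: "\<And>n. n \<ge> n0 \<Longrightarrow>
      \<bar>(\<integral>x. p (exp (- x)) \<partial>\<mu> n) - (\<integral>x. p (exp (- x)) \<partial>\<mu>')\<bar> < e / 3"
    by (metis LIMSEQ_D real_norm_def)
  show "\<exists>no. \<forall>n\<ge>no. norm ((\<integral>x. h x \<partial>\<mu> n) - (\<integral>x. h x \<partial>\<mu>')) < e"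
  proof (intro exI allI impI)
    fix n assume "n0 \<le> n"
    from n0[OF this] close[OF \<mu>, of n] close[OF \<mu>']
    show "norm ((\<integral>x. h x \<partial>\<mu> n) - (\<integral>x. h x \<partial>\<mu>')) < e" by (simp only: real_norm_def)
  qed
qed

text \<open>
  The ramps \<^const>\<open>cts_step\<close> that determine weak convergence vanish near infinity. In the variable
  \<open>z = exp (- x)\<close> they are therefore continuous on \<open>[0,1]\<close>, with value \<open>0\<close> at \<open>z = 0\<close>.
\<close>

lemma weak_conv_of_Laplace:
  fixes \<mu> :: "nat \<Rightarrow> real measure"
  assumes \<mu>: "\<And>n. real_distribution (\<mu> n)" "\<And>n. AE x in \<mu> n. 0 \<le> x"
    and \<mu>': "real_distribution \<mu>'" "AE x in \<mu>'. 0 \<le> x"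
    and L: "\<And>s. 0 < s \<Longrightarrow> (\<lambda>n. \<integral>x. exp (- s * x) \<partial>\<mu> n) \<longlonglongrightarrow> (\<integral>x. exp (- s * x) \<partial>\<mu>')"
  shows "weak_conv_m \<mu> \<mu>'"
proof (rule integral_cts_step_conv_imp_weak_conv)
  fix x y :: real assume xy: "x < y"
  have cs: "continuous_on A (cts_step x y)" for A
    using cts_step_uniformly_continuous[OF xy] uniformly_continuous_imp_continuous
      continuous_on_subset by blast
  \<comment> \<open>The ramp in the variable \<open>z\<close>; it vanishes for \<open>z \<le> r\<close>, which gives continuity at \<open>0\<close>.\<close>
  define g where "g z = (if z \<le> 0 then 0 else cts_step x y (- ln z))" for z :: real
  define r where "r = exp (- y)"
  have "continuous_on ({..r} \<union> {r / 2..}) g"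
  proof (rule continuous_on_closed_Un)
    have "g z = 0" if "z \<le> r" for z
    proof (cases "z \<le> 0")
      case False
      then have "ln z \<le> ln r" using that by (subst ln_le_cancel_iff) (auto simp: r_def)
      then show ?thesis using xy by (auto simp: g_def cts_step_def r_def)
    qed (simp add: g_def)
    then have "continuous_on {..r} g \<longleftrightarrow> continuous_on {..r} (\<lambda>z. 0::real)"
      by (intro continuous_on_cong) auto
    then show "continuous_on {..r} g" by simp
    have "r > 0" by (simp add: r_def)
    then have pos: "z > 0" if "z \<ge> r / 2" for z using that by (metis half_gt_zero less_le_trans)
    have "continuous_on {r/2..} g \<longleftrightarrow> continuous_on {r/2..} (\<lambda>z. cts_step x y (- ln z))"
      using pos by (intro continuous_on_cong) (auto simp: g_def dest: leD)
    moreover have "continuous_on {r/2..} (\<lambda>z. cts_step x y (- ln z))"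
      by (rule continuous_on_compose2[OF cs[of UNIV]])
         (auto intro!: continuous_intros dest: pos)
    ultimately show "continuous_on {r/2..} g" by simp
  qed auto
  moreover have "{..r} \<union> {r/2..} = UNIV" by (auto simp: r_def) (smt (verit) exp_gt_zero field_sum_of_halves)
  ultimately have cg: "continuous_on {0..1} g" using continuous_on_subset by blast
  show "(\<lambda>n. integral\<^sup>L (\<mu> n) (cts_step x y)) \<longlonglongrightarrow> integral\<^sup>L \<mu>' (cts_step x y)"
  proof (rule tendsto_integral_of_Laplace[OF \<mu> \<mu>' _ cg])
    show "cts_step x y \<in> borel_measurable borel"
      by (intro borel_measurable_continuous_onI cs)
    show "cts_step x y t = g (exp (- t))" for t by (simp add: g_def)
  qed (rule L)
qed (use assms in auto)

text \<open>
  The constant sequence \<open>\<mu>\<close> converges weakly to \<open>\<mu>'\<close>, hence the characteristic functions agree.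
\<close>

lemma Laplace_uniqueness:
  assumes "real_distribution \<mu>" "AE x in \<mu>. 0 \<le> x"
    and "real_distribution \<mu>'" "AE x in \<mu>'. 0 \<le> x"
    and "\<And>s. 0 < s \<Longrightarrow> (\<integral>x. exp (- s * x) \<partial>\<mu>) = (\<integral>x. exp (- s * x) \<partial>\<mu>')"
  shows "\<mu> = \<mu>'"
proof (rule Levy_uniqueness)
  have w: "weak_conv_m (\<lambda>_::nat. \<mu>) \<mu>'"
    by (rule weak_conv_of_Laplace) (use assms in auto)
  show "char \<mu> = char \<mu>'"
  proof
    fix t
    have "(\<lambda>n::nat. char \<mu> t) \<longlonglongrightarrow> char \<mu>' t"
      by (rule levy_continuity1[OF assms(1,3) w])
    then show "char \<mu> t = char \<mu>' t" by (simp add: LIMSEQ_const_iff)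
  qed
qed (use assms in auto)

text \<open>
  Tested by a bounded continuous function that is positive exactly on the negative half-line.
\<close>

lemma nonneg_weak_limit:
  fixes \<mu> :: "nat \<Rightarrow> real measure"
  assumes \<mu>: "\<And>n. real_distribution (\<mu> n)" "\<And>n. AE x in \<mu> n. 0 \<le> x"
    and \<mu>': "real_distribution \<mu>'" and w: "weak_conv_m \<mu> \<mu>'"
  shows "AE x in \<mu>'. 0 \<le> x"
proof -
  interpret \<mu>': real_distribution \<mu>' by fact
  \<comment> \<open>Vanishes exactly on the nonnegative half-line.\<close>
  let ?h = "\<lambda>x::real. min 1 (max 0 (- x))"
  have "(\<lambda>n. integral\<^sup>L (\<mu> n) ?h) \<longlonglongrightarrow> integral\<^sup>L \<mu>' ?h"
    by (rule weak_conv_imp_integral_bdd_continuous_conv[OF \<mu>(1) \<mu>' w, of _ 1])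
       (auto intro!: continuous_intros)
  moreover have "integral\<^sup>L (\<mu> n) ?h = 0" for n
    by (rule integral_eq_zero_AE) (use \<mu>(2)[of n] in auto)
  ultimately have "integral\<^sup>L \<mu>' ?h = 0" by (simp add: LIMSEQ_const_iff)
  moreover have "integrable \<mu>' ?h"
    by (rule \<mu>'.integrable_const_bound[of _ 1]) auto
  ultimately have "AE x in \<mu>'. ?h x = 0"
    by (subst (asm) integral_nonneg_eq_0_iff_AE) auto
  then show ?thesis by eventually_elim (auto simp: min_def max_def split: if_splits)
qed

text \<open>
  The function \<open>exp (- s x)\<close> is bounded and continuous after replacing \<open>x\<close> by \<open>max 0 x\<close>, which changes
  nothing almost surely.
\<close>

lemma Laplace_of_weak_limit:
  fixes \<mu> :: "nat \<Rightarrow> real measure"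
  assumes \<mu>: "\<And>n. real_distribution (\<mu> n)" "\<And>n. AE x in \<mu> n. 0 \<le> x"
    and \<mu>': "real_distribution \<mu>'" and w: "weak_conv_m \<mu> \<mu>'" and s: "0 < s"
  shows "(\<lambda>n. \<integral>x. exp (- s * x) \<partial>\<mu> n) \<longlonglongrightarrow> (\<integral>x. exp (- s * x) \<partial>\<mu>')"
proof -
  let ?h = "\<lambda>x::real. exp (- s * max 0 x)"
  have eq: "integral\<^sup>L M ?h = (\<integral>x. exp (- s * x) \<partial>M)"
    if "real_distribution M" "AE x in M. 0 \<le> x" for M
  proof -
    interpret real_distribution M by fact
    have "AE x in M. ?h x = exp (- s * x)"
      using that(2) by eventually_elim (simp add: max_absorb2)
    then show ?thesis by (intro integral_cong_AE) auto
  qed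
  have "(\<lambda>n. integral\<^sup>L (\<mu> n) ?h) \<longlonglongrightarrow> integral\<^sup>L \<mu>' ?h"
    by (rule weak_conv_imp_integral_bdd_continuous_conv[OF \<mu>(1) \<mu>' w, of _ 1])
       (use s in \<open>auto intro!: continuous_intros mult_nonneg_nonneg\<close>)
  then show ?thesis
    using eq[OF \<mu>] eq[OF \<mu>' nonneg_weak_limit[OF \<mu> \<mu>' w]] by simp
qed

text \<open>
  With \<open>R = ln 2 / s\<close> the function \<open>exp (- s x)\<close> is at most \<open>1\<close> on \<open>[0, R]\<close> and at most \<open>1/2\<close> beyond, so
  a Laplace transform close to \<open>1\<close> at \<open>s\<close> forces the mass of \<open>[0, R]\<close> to be close to \<open>1\<close>. Continuity of
  \<open>L\<close> at \<open>0\<close> provides such an \<open>s\<close> for all large \<open>n\<close>; the finitely many remaining laws are tight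
  individually.
\<close>

lemma tight_of_Laplace:
  fixes \<mu> :: "nat \<Rightarrow> real measure"
  assumes \<mu>: "\<And>n. real_distribution (\<mu> n)" "\<And>n. AE x in \<mu> n. 0 \<le> x"
    and L: "\<And>s. 0 < s \<Longrightarrow> (\<lambda>n. \<integral>x. exp (- s * x) \<partial>\<mu> n) \<longlonglongrightarrow> L s"
    and L0: "(L \<longlongrightarrow> 1) (at_right 0)"
  shows "tight \<mu>"
  unfolding tight_def
proof (intro conjI allI impI \<mu>(1))
  fix e :: real assume e: "0 < e"
  define d where "d = min e 1 / 4"
  have d: "0 < d" "d < e" "d * 4 \<le> e" using e by (auto simp: d_def)
  have "\<forall>\<^sub>F s in at_right 0. L s > 1 - d"
    by (rule order_tendstoD[OF L0]) (use d in simp)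
  then obtain s where s: "0 < s" "L s > 1 - d"
    by (auto simp: eventually_at_right_field) (use dense in blast)
  have "\<forall>\<^sub>F n in sequentially. (\<integral>x. exp (- s * x) \<partial>\<mu> n) > 1 - d"
    by (rule order_tendstoD(1)[OF L[OF s(1)] s(2)])
  then obtain n0 where n0: "\<And>n. n \<ge> n0 \<Longrightarrow> (\<integral>x. exp (- s * x) \<partial>\<mu> n) > 1 - d"
    by (auto simp: eventually_sequentially)
  define R where "R = ln 2 / s"
  have R: "0 < R" using s by (simp add: R_def)
  have large: "measure (\<mu> n) {-1<..R} > 1 - e" if "n \<ge> n0" for n
  proof -
    interpret real_distribution "\<mu> n" by (rule \<mu>)
    have hi: "integrable (\<mu> n) (\<lambda>x. (indicator {-1<..R} x :: real) / 2)"
      by (intro integrable_divide integrable_real_indicator) (auto simp: emeasure_eq_measure)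
    have "(\<integral>x. exp (- s * x) \<partial>\<mu> n) \<le> (\<integral>x. 1 / 2 + indicator {-1<..R} x / 2 \<partial>\<mu> n)"
    proof (rule integral_mono_AE)
      show "AE x in \<mu> n. exp (- s * x) \<le> 1 / 2 + indicator {-1<..R} x / 2"
        using \<mu>(2)[of n]
      proof eventually_elim
        case (elim x)
        show ?case
        proof (cases "x \<le> R")
          case True
          then have ind: "indicator {-1<..R} x = (1 :: real)" using elim by simp
          have "exp (- s * x) \<le> 1" using elim s by simp
          then show ?thesis unfolding ind by linarith
        next
          case False
          then have "- s * x \<le> - ln 2" using s by (simp add: R_def field_simps)
          then have "exp (- s * x) \<le> exp (- ln 2)" by (subst exp_le_cancel_iff)
          also have "\<dots> = 1 / 2" by (simp add: exp_minus)
          also have "\<dots> \<le> 1 / 2 + indicator {-1<..R} x / 2" by simp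
          finally show ?thesis .
        qed
      qed
      show "integrable (\<mu> n) (\<lambda>x. exp (- s * x))"
        by (rule integrable_exp_neg) (use \<mu> s in auto)
      show ind: "integrable (\<mu> n) (\<lambda>x. 1 / 2 + (indicator {-1<..R} x :: real) / 2)"
        by (intro Bochner_Integration.integrable_add hi) simp
    qed
    also have "\<dots> = 1 / 2 + measure (\<mu> n) {-1<..R} / 2"
      using prob_space hi by (subst Bochner_Integration.integral_add) auto
    finally show ?thesis using n0[OF that] d by linarith
  qed
  have "\<exists>B>0. \<forall>b\<ge>B. measure (\<mu> n) {-1<..b} > 1 - e" for n
  proof -
    interpret real_distribution "\<mu> n" by (rule \<mu>)
    have "\<forall>\<^sub>F b in at_top. cdf (\<mu> n) b > 1 - e"
      by (rule order_tendstoD[OF cdf_lim_at_top_prob]) (use e in simp)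
    then obtain B where B: "\<And>b. b \<ge> B \<Longrightarrow> cdf (\<mu> n) b > 1 - e" by (auto simp: eventually_at_top_linorder)
    have "cdf (\<mu> n) b \<le> measure (\<mu> n) {-1<..b}" for b
      unfolding cdf_def by (rule finite_measure_mono_AE) (use \<mu>(2)[of n] in auto)
    with B show ?thesis by (intro exI[of _ "max 1 B"]) (auto intro: less_le_trans)
  qed
  then obtain B where B: "\<And>n b. b \<ge> B n \<Longrightarrow> measure (\<mu> n) {-1<..b} > 1 - e" by metis
  define b where "b = Max (insert R (B ` {..<n0}))"
  have b: "R \<le> b" "\<And>n. n < n0 \<Longrightarrow> B n \<le> b" by (auto simp: b_def)
  show "\<exists>a b. a < b \<and> (\<forall>n. 1 - e < measure (\<mu> n) {a<..b})"
  proof (intro exI conjI allI)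
    show "-1 < b" using b R by linarith
    fix n
    show "1 - e < measure (\<mu> n) {-1<..b}"
    proof (cases "n < n0")
      case False
      interpret real_distribution "\<mu> n" by (rule \<mu>)
      have "measure (\<mu> n) {-1<..R} \<le> measure (\<mu> n) {-1<..b}"
        by (rule finite_measure_mono) (use b in auto)
      with large[of n] False show ?thesis by simp
    qed (use B b in auto)
  qed
qed

text \<open>
  Tightness and Helly's selection theorem give a weakly convergent subsequence, whose limit must have
  the Laplace transform \<open>L\<close>.
\<close>

theorem Laplace_continuity:
  fixes \<mu> :: "nat \<Rightarrow> real measure"
  assumes \<mu>: "\<And>n. real_distribution (\<mu> n)" "\<And>n. AE x in \<mu> n. 0 \<le> x"
    and L: "\<And>s. 0 < s \<Longrightarrow> (\<lambda>n. \<integral>x. exp (- s * x) \<partial>\<mu> n) \<longlonglongrightarrow> L s"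
    and L0: "(L \<longlongrightarrow> 1) (at_right 0)"
  obtains \<mu>' where "real_distribution \<mu>'" "AE x in \<mu>'. 0 \<le> x"
    "\<And>s. 0 < s \<Longrightarrow> (\<integral>x. exp (- s * x) \<partial>\<mu>') = L s"
proof -
  from tight_imp_convergent_subsubsequence[OF tight_of_Laplace[OF assms], of "\<lambda>n. n"]
  obtain r \<mu>' where r: "strict_mono r" and \<mu>': "real_distribution \<mu>'" "weak_conv_m (\<mu> \<circ> (\<lambda>n. n) \<circ> r) \<mu>'"
    by (auto simp: strict_mono_def)
  have w: "weak_conv_m (\<lambda>n. \<mu> (r n)) \<mu>'" using \<mu>'(2) by (simp add: o_def)
  show thesis
  proof (rule that)
    show "real_distribution \<mu>'" by fact
    show "AE x in \<mu>'. 0 \<le> x" by (rule nonneg_weak_limit[OF _ _ \<mu>'(1) w]) (use \<mu> in auto)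
    fix s :: real assume s: "0 < s"
    have "(\<lambda>n. \<integral>x. exp (- s * x) \<partial>\<mu> (r n)) \<longlonglongrightarrow> (\<integral>x. exp (- s * x) \<partial>\<mu>')"
      by (rule Laplace_of_weak_limit[OF _ _ \<mu>'(1) w s]) (use \<mu> in auto)
    moreover have "(\<lambda>n. \<integral>x. exp (- s * x) \<partial>\<mu> (r n)) \<longlonglongrightarrow> L s"
      using LIMSEQ_subseq_LIMSEQ[OF L[OF s] r] by (simp add: o_def)
    ultimately show "(\<integral>x. exp (- s * x) \<partial>\<mu>') = L s" by (rule LIMSEQ_unique)
  qed
qed

text \<open>
  Laplace transforms of independent sums multiply, and
  \<open>(b s)\<^sup>\<alpha> + (c s)\<^sup>\<alpha> = (d s)\<^sup>\<alpha>\<close> for \<open>d\<^sup>\<alpha> = b\<^sup>\<alpha> + c\<^sup>\<alpha>\<close>. So the shift \<open>e\<close> is zero.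
  A point mass would have an exponent linear in \<open>s\<close>, unlike \<open>C s\<^sup>\<alpha>\<close>.
\<close>

lemma stable_law_of_Laplace:
  assumes \<mu>: "real_distribution \<mu>" "AE x in \<mu>. 0 \<le> x"
    and L: "\<And>s. 0 < s \<Longrightarrow> (\<integral>x. exp (- s * x) \<partial>\<mu>) = exp (- (C * s powr \<alpha>))"
    and C: "0 < C" and \<alpha>: "0 < \<alpha>" "\<alpha> < 1"
  shows "stable_law \<alpha> \<mu>"
  unfolding stable_law_def
proof (intro conjI allI impI)
  interpret real_distribution \<mu> by fact
  show "real_distribution \<mu>" by fact
  show "\<nexists>c. \<mu> = return borel c"
  proof
    assume "\<exists>c. \<mu> = return borel c"
    then obtain c where "\<mu> = return borel c" ..
    then have "exp (- s * c) = exp (- (C * s powr \<alpha>))" if "0 < s" for s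
      using L[OF that] by (simp add: integral_return)
    \<comment> \<open>At \<open>s = 1\<close> the exponents give \<open>c = C\<close>, and at \<open>s = 2\<close> they give \<open>2 c = 2\<^sup>\<alpha> C\<close>.\<close>
    from this[of 1] this[of 2] have "2 = 2 powr \<alpha>" using C by simp
    then have "2 powr 1 = 2 powr \<alpha>" by simp
    then show False using \<alpha> by (subst (asm) powr_inj) auto
  qed
  fix b c :: real assume b: "0 < b" and c: "0 < c"
  define d where "d = (b powr \<alpha> + c powr \<alpha>) powr (1 / \<alpha>)"
  have pos: "0 < b powr \<alpha> + c powr \<alpha>" using b c by (simp add: add_pos_pos)
  have d: "0 < d" "d powr \<alpha> = b powr \<alpha> + c powr \<alpha>"
    using pos \<alpha> by (auto simp: d_def powr_powr)
  interpret P: pair_prob_space \<mu> \<mu> ..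
  let ?f = "\<lambda>(x, y). b * x + c * y"
  have [measurable]: "?f \<in> borel_measurable (\<mu> \<Otimes>\<^sub>M \<mu>)" by measurable
  have AE2: "AE z in \<mu> \<Otimes>\<^sub>M \<mu>. 0 \<le> fst z \<and> 0 \<le> snd z"
  proof (rule P.AE_pair_measure)
    show "AE x in \<mu>. AE y in \<mu>. 0 \<le> fst (x, y) \<and> 0 \<le> snd (x, y)"
      using \<mu>(2) by eventually_elim (use \<mu>(2) in simp)
  qed measurable
  have "distr (\<mu> \<Otimes>\<^sub>M \<mu>) borel ?f = distr \<mu> borel (\<lambda>x. d * x)"
  proof (rule Laplace_uniqueness)
    show "real_distribution (distr (\<mu> \<Otimes>\<^sub>M \<mu>) borel ?f)"
      by (intro P.real_distribution_distr) simp
    show "real_distribution (distr \<mu> borel (\<lambda>x. d * x))"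
      by (intro real_distribution_distr) simp
    show "AE x in distr (\<mu> \<Otimes>\<^sub>M \<mu>) borel ?f. 0 \<le> x"
      by (subst AE_distr_iff) (use AE2 b c in \<open>auto simp: case_prod_beta\<close>)
    show "AE x in distr \<mu> borel (\<lambda>x. d * x). 0 \<le> x"
      by (subst AE_distr_iff) (use \<mu>(2) d in \<open>auto\<close>)
    fix s :: real assume s: "0 < s"
    have "(\<integral>x. exp (- s * x) \<partial>distr (\<mu> \<Otimes>\<^sub>M \<mu>) borel ?f) = (\<integral>z. exp (- s * ?f z) \<partial>(\<mu> \<Otimes>\<^sub>M \<mu>))"
      by (subst integral_distr) auto
    also have "\<dots> = (\<integral>(x, y). exp (- (s * b) * x) * exp (- (s * c) * y) \<partial>(\<mu> \<Otimes>\<^sub>M \<mu>))"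
      by (intro Bochner_Integration.integral_cong) (auto simp: exp_add[symmetric] algebra_simps)
    also have "\<dots> = (\<integral>x. (\<integral>y. exp (- (s * b) * x) * exp (- (s * c) * y) \<partial>\<mu>) \<partial>\<mu>)"
    proof -
      have "integrable (\<mu> \<Otimes>\<^sub>M \<mu>) (\<lambda>(x, y). exp (- (s * b) * x) * exp (- (s * c) * y))"
      proof (rule P.integrable_const_bound[of _ 1])
        show "AE z in \<mu> \<Otimes>\<^sub>M \<mu>. norm (case z of (x, y) \<Rightarrow> exp (- (s * b) * x) * exp (- (s * c) * y)) \<le> 1"
          using AE2 by eventually_elim (use s b c in \<open>auto intro!: mult_le_one\<close>)
      qed measurable
      from P.integral_fst'[OF this] show ?thesis by simp
    qed
    also have "\<dots> = (\<integral>x. exp (- (s * b) * x) \<partial>\<mu>) * (\<integral>x. exp (- (s * c) * x) \<partial>\<mu>)"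
      by simp
    also have "\<dots> = exp (- (C * (s * b) powr \<alpha>)) * exp (- (C * (s * c) powr \<alpha>))"
      using s b c by (simp only: L mult_pos_pos)
    also have "\<dots> = exp (- (C * (s * d) powr \<alpha>))"
      using s b c d by (simp add: powr_mult exp_add[symmetric] algebra_simps)
    also have "\<dots> = (\<integral>x. exp (- (s * d) * x) \<partial>\<mu>)"
      using s d by (simp only: L mult_pos_pos)
    also have "\<dots> = (\<integral>x. exp (- s * x) \<partial>distr \<mu> borel (\<lambda>x. d * x))"
      by (subst integral_distr) (auto simp: mult.assoc)
    finally show "(\<integral>x. exp (- s * x) \<partial>distr (\<mu> \<Otimes>\<^sub>M \<mu>) borel ?f)
        = (\<integral>x. exp (- s * x) \<partial>distr \<mu> borel (\<lambda>x. d * x))" .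
  qed
  then show "\<exists>d>0. \<exists>e. d powr \<alpha> = b powr \<alpha> + c powr \<alpha> \<and>
      distr (\<mu> \<Otimes>\<^sub>M \<mu>) borel ?f = distr \<mu> borel (\<lambda>x. d * x + e)"
    using d by (intro exI[of _ d] conjI exI[of _ 0]) auto
qed

text \<open>
  The limit law is found along the integers. Since it is identified by its Laplace transform, every
  other sequence of times leads to the same law, so the convergence holds along the reals.
\<close>

lemma weak_conv_at_top_of_Laplace:
  fixes \<mu> :: "real \<Rightarrow> real measure"
  assumes \<mu>: "\<And>t. real_distribution (\<mu> t)" "\<forall>\<^sub>F t in at_top. AE x in \<mu> t. 0 \<le> x"
    and L: "\<And>s. 0 < s \<Longrightarrow> ((\<lambda>t. \<integral>x. exp (- s * x) \<partial>\<mu> t) \<longlongrightarrow> L s) at_top"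
    and L0: "(L \<longlongrightarrow> 1) (at_right 0)"
  obtains \<mu>' where "real_distribution \<mu>'" "AE x in \<mu>'. 0 \<le> x"
    "\<And>s. 0 < s \<Longrightarrow> (\<integral>x. exp (- s * x) \<partial>\<mu>') = L s" "weak_conv_at_top \<mu> \<mu>'"
proof -
  from \<mu>(2) obtain t0 where t0: "\<And>t. t0 \<le> t \<Longrightarrow> AE x in \<mu> t. 0 \<le> x"
    by (auto simp: eventually_at_top_linorder)
  \<comment> \<open>Modified before \<open>t0\<close> so that all laws live on the half-line.\<close>
  define \<kappa> where "\<kappa> t = \<mu> (max t t0)" for t
  have \<kappa>: "real_distribution (\<kappa> t)" "AE x in \<kappa> t. 0 \<le> x" for t
    unfolding \<kappa>_def by (rule \<mu>(1), rule t0) simp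
  have ev: "\<forall>\<^sub>F t in at_top. \<kappa> t = \<mu> t"
    using eventually_ge_at_top[of t0] by eventually_elim (simp add: \<kappa>_def max_absorb1)
  have L\<kappa>: "((\<lambda>t. \<integral>x. exp (- s * x) \<partial>\<kappa> t) \<longlongrightarrow> L s) at_top" if "0 < s" for s
    using L[OF that] by (rule Lim_transform_eventually) (use ev in eventually_elim, simp)
  have Lseq: "(\<lambda>n. \<integral>x. exp (- s * x) \<partial>\<kappa> (X n)) \<longlonglongrightarrow> L s" if "0 < s" "filterlim X at_top sequentially" for s X
    by (rule filterlim_compose[OF L\<kappa>[OF that(1)] that(2)])
  obtain \<mu>' where \<mu>': "real_distribution \<mu>'" "AE x in \<mu>'. 0 \<le> x"
    "\<And>s. 0 < s \<Longrightarrow> (\<integral>x. exp (- s * x) \<partial>\<mu>') = L s"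
    by (rule Laplace_continuity[OF \<kappa>, of real, OF Lseq L0]) (auto simp: filterlim_real_sequentially)
  have "weak_conv_at_top \<mu> \<mu>'"
    unfolding weak_conv_at_top_def
  proof (intro allI impI)
    fix x assume x: "isCont (cdf \<mu>') x"
    have "((\<lambda>t. cdf (\<kappa> t) x) \<longlongrightarrow> cdf \<mu>' x) at_top"
    proof (rule tendsto_at_topI_sequentially)
      fix X :: "nat \<Rightarrow> real" assume X: "filterlim X at_top sequentially"
      have "weak_conv_m (\<lambda>n. \<kappa> (X n)) \<mu>'"
      proof (rule weak_conv_of_Laplace[OF \<kappa> \<mu>'(1,2)])
        fix s :: real assume s: "0 < s"
        show "(\<lambda>n. \<integral>x. exp (- s * x) \<partial>\<kappa> (X n)) \<longlonglongrightarrow> (\<integral>x. exp (- s * x) \<partial>\<mu>')"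
          unfolding \<mu>'(3)[OF s] by (rule Lseq[OF s X])
      qed
      then show "(\<lambda>n. cdf (\<kappa> (X n)) x) \<longlonglongrightarrow> cdf \<mu>' x"
        using x by (simp add: weak_conv_m_def weak_conv_def)
    qed
    then show "((\<lambda>t. cdf (\<mu> t) x) \<longlongrightarrow> cdf \<mu>' x) at_top"
      by (rule Lim_transform_eventually) (use ev in eventually_elim, simp)
  qed
  with \<mu>' show thesis by (rule that)
qed

text \<open>
  A quantitative form of Slutsky's theorem: for nonnegative \<open>X\<close> and \<open>Z\<close>, pointwise
  \<open>0 \<le> exp (- s X) - exp (- s (X + Z)) \<le> min 1 (s Z)\<close>.
\<close>

lemma (in prob_space) Laplace_perturbation:
  assumes X: "random_variable borel X" "\<And>\<omega>. \<omega> \<in> space M \<Longrightarrow> 0 \<le> X \<omega>"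
    and Z: "random_variable borel Z" "\<And>\<omega>. \<omega> \<in> space M \<Longrightarrow> 0 \<le> Z \<omega>"
    and Y: "AE \<omega> in M. X \<omega> + Z \<omega> = Y \<omega>" "random_variable borel Y"
    and s: "0 < s" and \<delta>: "0 < \<delta>"
  shows "\<bar>expectation (\<lambda>\<omega>. exp (- s * X \<omega>)) - expectation (\<lambda>\<omega>. exp (- s * Y \<omega>))\<bar> \<le>
    s * \<delta> + prob {\<omega>\<in>space M. \<delta> < \<bar>Z \<omega>\<bar>}"
proof -
  note [measurable] = X(1) Z(1) Y(2)
  let ?E = "{\<omega>\<in>space M. \<delta> < \<bar>Z \<omega>\<bar>}"
  have Y0: "AE \<omega> in M. 0 \<le> Y \<omega>"
    using Y(1) AE_space by eventually_elim (use X(2) Z(2) in fastforce)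
  have iX: "integrable M (\<lambda>\<omega>. exp (- s * X \<omega>))"
    by (rule integrable_const_bound[of _ 1]) (use s X in auto)
  have iY: "integrable M (\<lambda>\<omega>. exp (- s * Y \<omega>))"
    by (rule integrable_const_bound[of _ 1]) (use s Y0 in auto)
  have iE: "integrable M (\<lambda>\<omega>. s * \<delta> + indicator ?E \<omega>)"
    by (intro Bochner_Integration.integrable_add integrable_real_indicator) (auto simp: emeasure_eq_measure)
  have bound: "AE \<omega> in M. \<bar>exp (- s * X \<omega>) - exp (- s * Y \<omega>)\<bar> \<le> s * \<delta> + indicator ?E \<omega>"
    using Y(1) AE_space
  proof eventually_elim
    case (elim \<omega>)
    have X0: "0 \<le> X \<omega>" and Z0: "0 \<le> Z \<omega>" using X(2) Z(2) elim by auto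
    have "exp (- s * Y \<omega>) = exp (- s * X \<omega>) * exp (- (s * Z \<omega>))"
      unfolding elim(1)[symmetric] by (simp add: exp_add[symmetric] algebra_simps)
    then have eq: "exp (- s * X \<omega>) - exp (- s * Y \<omega>) = exp (- s * X \<omega>) * (1 - exp (- (s * Z \<omega>)))"
      by (simp add: algebra_simps)
    have b: "0 \<le> 1 - exp (- (s * Z \<omega>))" "1 - exp (- (s * Z \<omega>)) \<le> 1" "1 - exp (- (s * Z \<omega>)) \<le> s * Z \<omega>"
      using s Z0 exp_ge_add_one_self[of "- (s * Z \<omega>)"] by auto
    have e: "exp (- s * X \<omega>) \<le> 1" "0 \<le> exp (- s * X \<omega>)" using s X0 by auto
    have "\<bar>exp (- s * X \<omega>) - exp (- s * Y \<omega>)\<bar> = exp (- s * X \<omega>) * (1 - exp (- (s * Z \<omega>)))"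
      unfolding eq abs_mult using b(1) e(2) by simp
    also have "\<dots> \<le> 1 * (1 - exp (- (s * Z \<omega>)))" by (rule mult_right_mono[OF e(1) b(1)])
    finally have d: "\<bar>exp (- s * X \<omega>) - exp (- s * Y \<omega>)\<bar> \<le> 1 - exp (- (s * Z \<omega>))" by simp
    show ?case
    proof (cases "Z \<omega> \<le> \<delta>")
      case True
      then have "s * Z \<omega> \<le> s * \<delta>" using s by simp
      then have "\<bar>exp (- s * X \<omega>) - exp (- s * Y \<omega>)\<bar> \<le> s * \<delta>" using d b(3) by linarith
      then show ?thesis by (rule order_trans) simp
    next
      case False
      then have "indicator ?E \<omega> = (1 :: real)" using elim(2) by simp
      moreover have "0 \<le> s * \<delta>" using s \<delta> by simp
      ultimately show ?thesis using d b(2) by linarith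
    qed
  qed
  have "\<bar>expectation (\<lambda>\<omega>. exp (- s * X \<omega>)) - expectation (\<lambda>\<omega>. exp (- s * Y \<omega>))\<bar> =
      \<bar>expectation (\<lambda>\<omega>. exp (- s * X \<omega>) - exp (- s * Y \<omega>))\<bar>"
    by (subst Bochner_Integration.integral_diff[OF iX iY]) simp
  also have "\<dots> \<le> expectation (\<lambda>\<omega>. \<bar>exp (- s * X \<omega>) - exp (- s * Y \<omega>)\<bar>)"
    by (rule integral_abs_bound)
  also have "\<dots> \<le> expectation (\<lambda>\<omega>. s * \<delta> + indicator ?E \<omega>)"
    by (rule integral_mono_AE[OF _ iE bound]) (use iX iY in auto)
  also have "\<dots> = s * \<delta> + prob ?E"
    using iE by (subst Bochner_Integration.integral_add) (auto simp: prob_space emeasure_eq_measure)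
  finally show ?thesis .
qed

section \<open>Regularly varying tails\<close>

text \<open>
  Regular variation controls one halving of the argument by the factor \<open>2\<^sup>\<beta>\<close>, since
  \<open>2\<^sup>\<alpha> < 2\<^sup>\<beta>\<close>; iterating it compares \<open>F y\<close> with \<open>F x\<close> for \<open>x0 \<le> y \<le> x\<close>. Below \<open>x0\<close> the trivial bound
  \<open>F y \<le> 1\<close> is enough, after enlarging the constant by \<open>1 / F x0\<close>.
\<close>

lemma Potter_bound:
  fixes F :: "real \<Rightarrow> real"
  assumes F: "antimono F" "\<And>x. F x \<le> 1" "\<forall>\<^sub>F x in at_top. 0 < F x"
    and rv: "((\<lambda>x. F (1 / 2 * x) / F x) \<longlongrightarrow> (1 / 2) powr (- \<alpha>)) at_top"
    and \<beta>: "0 < \<beta>" "\<alpha> < \<beta>"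
  obtains C x0 where "0 < C" "0 < x0" "\<And>x y. x0 \<le> x \<Longrightarrow> 0 < y \<Longrightarrow> y \<le> x \<Longrightarrow> F y \<le> C * (x / y) powr \<beta> * F x"
proof -
  have "(1 / 2 :: real) powr (- \<alpha>) < 2 powr \<beta>"
    using \<beta> by (simp add: powr_minus powr_divide)
  with rv have "\<forall>\<^sub>F x in at_top. F (1 / 2 * x) / F x < 2 powr \<beta>"
    by (rule order_tendstoD)
  with F(3) have "\<forall>\<^sub>F x in at_top. 0 < F x \<and> F (x / 2) \<le> 2 powr \<beta> * F x \<and> 0 < x"
    using eventually_gt_at_top[of 0]
    by eventually_elim (auto simp: field_simps)
  then obtain x0 where x0: "\<And>x. x0 \<le> x \<Longrightarrow> 0 < F x" "\<And>x. x0 \<le> x \<Longrightarrow> F (x / 2) \<le> 2 powr \<beta> * F x"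
      "0 < x0"
    by (auto simp: eventually_at_top_linorder)
  have F_mono: "F y \<le> F x" if "x \<le> y" for x y using F(1) that by (auto dest: antimonoD)
  have dyadic: "F y \<le> 2 powr \<beta> * (x / y) powr \<beta> * F x"
    if "x0 \<le> y" "y \<le> x" "x \<le> 2 ^ k * y" for k x y
    using that
  proof (induction k arbitrary: x)
    case 0
    then have "x = y" "0 < y" using x0 by auto
    then show ?case using x0(1)[of y] 0 \<beta> ge_one_powr_ge_zero[of 2 \<beta>] by simp
  next
    case (Suc k)
    have y: "0 < y" "0 < x" using Suc.prems x0 by auto
    show ?case
    proof (cases "x \<le> 2 * y")
      case True
      have "F y \<le> F (x / 2)" using True by (intro F_mono) simp
      also have "\<dots> \<le> 2 powr \<beta> * F x" using Suc.prems by (intro x0) simp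
      also have "\<dots> \<le> 2 powr \<beta> * (x / y) powr \<beta> * F x"
        using ge_one_powr_ge_zero[of "x / y" \<beta>] Suc.prems y \<beta> x0(1)[of x] by simp
      finally show ?thesis .
    next
      case False
      have "F y \<le> 2 powr \<beta> * (x / 2 / y) powr \<beta> * F (x / 2)"
        using False Suc.prems by (intro Suc.IH) auto
      also have "\<dots> \<le> 2 powr \<beta> * (x / 2 / y) powr \<beta> * (2 powr \<beta> * F x)"
        using Suc.prems by (intro mult_left_mono x0) auto
      also have "\<dots> = 2 powr \<beta> * (x / y) powr \<beta> * F x"
        using y by (simp add: powr_divide powr_mult)
      finally show ?thesis .
    qed
  qed
  have large: "F y \<le> 2 powr \<beta> * (x / y) powr \<beta> * F x" if "x0 \<le> y" "y \<le> x" for x y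
  proof -
    obtain k where "x / y < 2 ^ k" using real_arch_pow[of 2 "x / y"] by auto
    then have "x \<le> 2 ^ k * y" using that x0(3) by (simp add: divide_less_eq)
    then show ?thesis using dyadic that by blast
  qed
  show thesis
  proof (rule that)
    show "0 < 2 powr \<beta> / F x0" using x0 by simp
    show "0 < x0" by fact
    fix x y :: real assume x: "x0 \<le> x" and y: "0 < y" "y \<le> x"
    have Fx: "0 < F x" "0 < F x0" using x0 x by auto
    show "F y \<le> 2 powr \<beta> / F x0 * (x / y) powr \<beta> * F x"
    proof (cases "x0 \<le> y")
      case True
      have "F y \<le> 2 powr \<beta> * (x / y) powr \<beta> * F x" using large True y by blast
      also have "\<dots> = 1 * (2 powr \<beta> * (x / y) powr \<beta> * F x)" by simp
      also have "\<dots> \<le> 1 / F x0 * (2 powr \<beta> * (x / y) powr \<beta> * F x)"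
        using Fx F(2)[of x0] by (intro mult_right_mono) auto
      finally show ?thesis by simp
    next
      case False
      have "F x0 \<le> 2 powr \<beta> * (x / x0) powr \<beta> * F x" using large x by blast
      also have "\<dots> \<le> 2 powr \<beta> * (x / y) powr \<beta> * F x"
        using False y x0 x Fx \<beta> by (intro mult_left_mono mult_right_mono powr_mono2 divide_left_mono less_imp_le[OF Fx(1)]) auto
      finally have "1 \<le> 2 powr \<beta> * (x / y) powr \<beta> * F x / F x0"
        using Fx by simp
      with F(2)[of y] show ?thesis by simp
    qed
  qed
qed

text \<open>
  Fubini applied to \<open>1 - exp (- s x)\<close>, which is the integral of \<open>exp (- y)\<close> over \<open>0 < y < s x\<close>.
\<close>

lemma one_minus_Laplace_eq_tail_integral:
  assumes \<mu>: "real_distribution \<mu>" "AE x in \<mu>. 0 \<le> x" and s: "0 < s"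
  shows "1 - (\<integral>x. exp (- s * x) \<partial>\<mu>) =
    (\<integral>y. indicator {0<..} y * (exp (- y) * measure \<mu> {y / s<..}) \<partial>lborel)"
proof -
  interpret real_distribution \<mu> by fact
  interpret P: pair_sigma_finite \<mu> lborel ..
  have i: "integrable \<mu> (\<lambda>x. exp (- s * x))"
    by (rule integrable_exp_neg) (use assms in auto)
  have inner: "(\<integral>\<^sup>+ y. ennreal (indicator {0<..<s * x} y * exp (- y)) \<partial>lborel) = ennreal (1 - exp (- s * x))"
    if "0 \<le> x" for x
  proof -
    have "0 \<le> s * x" using s that by simp
    then have "((\<lambda>y. exp (- y)) has_integral (- exp (- (s * x)) - (- exp (- 0)))) {0..s * x}"
      by (intro fundamental_theorem_of_calculus)
         (auto intro!: derivative_eq_intros simp: has_real_derivative_iff_has_vector_derivative[symmetric])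
    then have "((\<lambda>y. exp (- y)) has_integral (1 - exp (- s * x))) {0<..<s * x}"
      by (simp add: has_integral_Icc_iff_Ioo)
    then show ?thesis
      by (subst nn_integral_has_integral_lebesgue) auto
  qed
  have meas: "(\<lambda>y. measure \<mu> {y / s<..}) \<in> borel_measurable borel"
  proof -
    have "mono (\<lambda>y. cdf \<mu> (y / s))"
      using s by (intro monoI cdf_nondecreasing) (auto simp: divide_right_mono)
    then have "(\<lambda>y. cdf \<mu> (y / s)) \<in> borel_measurable borel" by (rule borel_measurable_mono)
    then have "(\<lambda>y. 1 - cdf \<mu> (y / s)) \<in> borel_measurable borel" by simp
    moreover have "measure \<mu> {y / s<..} = 1 - cdf \<mu> (y / s)" for y
      using prob_compl[of "{..y / s}"] by (simp add: cdf_def Compl_eq_Diff_UNIV[symmetric])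
    ultimately show ?thesis by simp
  qed
  have "ennreal (1 - (\<integral>x. exp (- s * x) \<partial>\<mu>)) = ennreal (\<integral>x. 1 - exp (- s * x) \<partial>\<mu>)"
    using i prob_space by simp
  also have "\<dots> = (\<integral>\<^sup>+ x. ennreal (1 - exp (- s * x)) \<partial>\<mu>)"
  proof (rule nn_integral_eq_integral[symmetric])
    show "AE x in \<mu>. 0 \<le> 1 - exp (- s * x)"
      using \<mu>(2) by eventually_elim (use s in simp)
  qed (use i in auto)
  also have "\<dots> = (\<integral>\<^sup>+ x. (\<integral>\<^sup>+ y. ennreal (indicator {0<..<s * x} y * exp (- y)) \<partial>lborel) \<partial>\<mu>)"
  proof (rule nn_integral_cong_AE)
    show "AE x in \<mu>. ennreal (1 - exp (- s * x)) =
        (\<integral>\<^sup>+ y. ennreal (indicator {0<..<s * x} y * exp (- y)) \<partial>lborel)"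
      using \<mu>(2) by eventually_elim (rule inner[symmetric])
  qed
  also have "\<dots> = (\<integral>\<^sup>+ x. (\<integral>\<^sup>+ y. (ennreal (indicator {0<..} y * exp (- y)) *
      indicator {z\<in>space (borel \<Otimes>\<^sub>M borel). snd z < s * fst z} (x, y)) \<partial>lborel) \<partial>\<mu>)"
    by (intro nn_integral_cong) (auto simp: indicator_def space_pair_measure)
  also have "\<dots> = (\<integral>\<^sup>+ y. (\<integral>\<^sup>+ x. (ennreal (indicator {0<..} y * exp (- y)) *
      indicator {z\<in>space (borel \<Otimes>\<^sub>M borel). snd z < s * fst z} (x, y)) \<partial>\<mu>) \<partial>lborel)"
    by (rule P.Fubini'[symmetric]) (simp add: case_prod_beta)
  also have "\<dots> = (\<integral>\<^sup>+ y. ennreal (indicator {0<..} y * exp (- y)) * emeasure \<mu> {y / s<..} \<partial>lborel)"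
  proof (rule nn_integral_cong)
    fix y
    have "indicator {z\<in>space (borel \<Otimes>\<^sub>M borel). snd z < s * fst z} (x, y) = (indicator {y / s<..} x :: ennreal)" for x
      using s by (auto simp: indicator_def space_pair_measure field_simps)
    then show "(\<integral>\<^sup>+ x. (ennreal (indicator {0<..} y * exp (- y)) *
      indicator {z\<in>space (borel \<Otimes>\<^sub>M borel). snd z < s * fst z} (x, y)) \<partial>\<mu>) =
      ennreal (indicator {0<..} y * exp (- y)) * emeasure \<mu> {y / s<..}"
      by (simp add: nn_integral_cmult_indicator)
  qed
  also have "\<dots> = (\<integral>\<^sup>+ y. ennreal (indicator {0<..} y * (exp (- y) * measure \<mu> {y / s<..})) \<partial>lborel)"
    by (intro nn_integral_cong) (simp add: emeasure_eq_measure ennreal_mult'[symmetric] mult.assoc)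
  finally have eq: "(\<integral>\<^sup>+ y. ennreal (indicator {0<..} y * (exp (- y) * measure \<mu> {y / s<..})) \<partial>lborel) =
     ennreal (1 - (\<integral>x. exp (- s * x) \<partial>\<mu>))" ..
  have "(\<integral>x. exp (- s * x) \<partial>\<mu>) \<le> (\<integral>x. 1 \<partial>\<mu>)"
    by (rule integral_mono_AE) (use i \<mu>(2) s in \<open>auto elim!: eventually_mono\<close>)
  then have "0 \<le> 1 - (\<integral>x. exp (- s * x) \<partial>\<mu>)" using prob_space by simp
  then show ?thesis
    using eq meas by (subst integral_eq_nn_integral) auto
qed

lemma Gamma_has_bochner_integral:
  fixes x :: real assumes "0 < x"
  shows "has_bochner_integral lborel (\<lambda>y. indicator {0<..} y * (exp (- y) * y powr (x - 1))) (Gamma x)"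
proof (rule has_bochner_integral_nn_integral)
  have "((\<lambda>t. t powr (x - 1) / exp t) has_integral Gamma x) {0..}"
    by (rule Gamma_integral_real) fact
  from nn_integral_has_integral_lebesgue[OF _ this]
  have "(\<integral>\<^sup>+ y. ennreal (indicator {0..} y * (y powr (x - 1) / exp y)) \<partial>lborel) = Gamma x" by simp
  moreover have "indicator {0..} y * (y powr (x - 1) / exp y) = indicator {0<..} y * (exp (- y) * y powr (x - 1))" for y :: real
    by (cases "y = 0") (auto simp: indicator_def exp_minus field_simps)
  ultimately show "(\<integral>\<^sup>+ y. ennreal (indicator {0<..} y * (exp (- y) * y powr (x - 1))) \<partial>lborel) = Gamma x" by simp
qed (use assms in \<open>auto simp: Gamma_real_pos less_imp_le\<close>)

text \<open>
  In the tail integral the integrand \<open>exp (- y) n F(a\<^sub>n y / s)\<close> tends to \<open>exp (- y) (y / s)\<^sup>-\<^sup>\<alpha>\<close>, whose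
  integral is \<open>\<Gamma>(1 - \<alpha>) s\<^sup>\<alpha>\<close>. The domination needs care only for small \<open>y\<close>, where the Potter bound
  with an exponent \<open>\<beta>\<close> between \<open>\<alpha>\<close> and \<open>1\<close> gives the integrable singularity \<open>y\<^sup>-\<^sup>\<beta>\<close>.
\<close>

lemma Laplace_scaling_limit:
  fixes a :: "nat \<Rightarrow> real"
  assumes \<mu>: "real_distribution \<mu>" "AE x in \<mu>. 0 \<le> x"
    and \<alpha>: "0 < \<alpha>" "\<alpha> < 1" and s: "0 < s"
    and pos: "\<forall>\<^sub>F x in at_top. 0 < measure \<mu> {x<..}"
    and rv: "\<And>c. 0 < c \<Longrightarrow> ((\<lambda>x. measure \<mu> {c * x<..} / measure \<mu> {x<..}) \<longlongrightarrow> c powr (- \<alpha>)) at_top"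
    and a: "filterlim a at_top sequentially"
    and na: "(\<lambda>n. real n * measure \<mu> {a n<..}) \<longlonglongrightarrow> 1"
  shows "(\<lambda>n. real n * (1 - (\<integral>x. exp (- (s / a n) * x) \<partial>\<mu>))) \<longlonglongrightarrow> Gamma (1 - \<alpha>) * s powr \<alpha>"
proof -
  interpret real_distribution \<mu> by fact
  define F where "F x = measure \<mu> {x<..}" for x
  define \<beta> where "\<beta> = (\<alpha> + 1) / 2"
  have \<beta>: "0 < \<beta>" "\<alpha> < \<beta>" "\<beta> < 1" using \<alpha> by (auto simp: \<beta>_def)
  have anti: "antimono F" unfolding F_def by (intro antimonoI finite_measure_mono) auto
  have F_meas: "F \<in> borel_measurable borel"
  proof -
    have "F = (\<lambda>y. 1 - cdf \<mu> y)"
      using prob_compl[of "{..y}" for y] by (auto simp: F_def cdf_def Compl_eq_Diff_UNIV[symmetric])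
    moreover have "cdf \<mu> \<in> borel_measurable borel"
      by (intro borel_measurable_mono monoI cdf_nondecreasing)
    ultimately show ?thesis by simp
  qed
  have F1: "F x \<le> 1" "0 \<le> F x" for x by (auto simp: F_def)
  obtain C x0 where C: "0 < C" "0 < x0"
      and potter: "\<And>x y. x0 \<le> x \<Longrightarrow> 0 < y \<Longrightarrow> y \<le> x \<Longrightarrow> F y \<le> C * (x / y) powr \<beta> * F x"
    by (rule Potter_bound[OF anti F1(1) pos[folded F_def] rv[of "1/2", folded F_def] \<beta>(1,2)]) auto
  have na': "(\<lambda>n. real n * F (a n)) \<longlonglongrightarrow> 1" using na by (simp add: F_def)
  have "\<forall>\<^sub>F n in sequentially. real n * F (a n) < 2" by (rule order_tendstoD(2)[OF na']) simp
  moreover have "\<forall>\<^sub>F n in sequentially. x0 \<le> a n" using a by (simp add: filterlim_at_top)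
  ultimately have "\<forall>\<^sub>F n in sequentially. real n * F (a n) < 2 \<and> x0 \<le> a n" by eventually_elim auto
  then obtain n0 where n0: "\<And>n. n \<ge> n0 \<Longrightarrow> real n * F (a n) < 2" "\<And>n. n \<ge> n0 \<Longrightarrow> x0 \<le> a n"
    by (auto simp: eventually_sequentially)
  define f where "f n y = indicator {0<..} y * (exp (- y) * (real n * F (a n * (y / s))))" for n y
  define l where "l y = indicator {0<..} y * (exp (- y) * (y / s) powr (- \<alpha>))" for y :: real
  \<comment> \<open>The two terms dominate the cases \<open>y \<le> s\<close> and \<open>y > s\<close> below.\<close>
  define w where "w y = 2 * C * s powr \<beta> * (indicator {0<..} y * (exp (- y) * y powr ((1 - \<beta>) - 1))) +
      2 * (indicator {0<..} y * (exp (- y) * y powr (1 - 1)))" for y :: real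
  have "(\<lambda>n. \<integral>y. f (n + n0) y \<partial>lborel) \<longlonglongrightarrow> (\<integral>y. l y \<partial>lborel)"
  proof (rule integral_dominated_convergence)
    show "integrable lborel w"
      unfolding w_def using \<beta>
      by (intro Bochner_Integration.integrable_add integrable_mult_right
          integrable.intros[OF Gamma_has_bochner_integral]) auto
    show "l \<in> borel_measurable lborel" unfolding l_def by measurable
    show "f (n + n0) \<in> borel_measurable lborel" for n
    proof -
      have "(\<lambda>y. F (a (n + n0) * (y / s))) \<in> borel_measurable borel"
        by (rule measurable_compose[OF _ F_meas]) measurable
      then show ?thesis unfolding f_def by measurable
    qed
    show "AE y in lborel. (\<lambda>n. f (n + n0) y) \<longlonglongrightarrow> l y"
    proof (rule AE_I2)
      fix y :: real
      show "(\<lambda>n. f (n + n0) y) \<longlonglongrightarrow> l y"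
      proof (cases "0 < y")
        case True
        then have c: "0 < y / s" using s by simp
        have "(\<lambda>n. F (y / s * a n) / F (a n)) \<longlonglongrightarrow> (y / s) powr (- \<alpha>)"
          using filterlim_compose[OF rv[OF c] a] by (simp add: F_def)
        from tendsto_mult[OF na' this]
        have "(\<lambda>n. real n * F (a n) * (F (y / s * a n) / F (a n))) \<longlonglongrightarrow> (y / s) powr (- \<alpha>)" by simp
        moreover have "\<forall>\<^sub>F n in sequentially. 0 < F (a n)"
          using pos a unfolding F_def by (rule eventually_compose_filterlim)
        then have "\<forall>\<^sub>F n in sequentially. real n * F (a n) * (F (y / s * a n) / F (a n)) = real n * F (a n * (y / s))"
          by eventually_elim (simp add: mult.commute)
        ultimately have "(\<lambda>n. real n * F (a n * (y / s))) \<longlonglongrightarrow> (y / s) powr (- \<alpha>)"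
          by (rule Lim_transform_eventually)
        then have "f' \<longlonglongrightarrow> l y" if "f' = (\<lambda>n. f n y)" for f'
          unfolding that f_def l_def by (intro tendsto_intros)
        then show ?thesis by (intro LIMSEQ_ignore_initial_segment) auto
      qed (simp add: f_def l_def)
    qed
    fix n
    show "AE y in lborel. norm (f (n + n0) y) \<le> w y"
    proof (rule AE_I2)
      fix y :: real
      show "norm (f (n + n0) y) \<le> w y"
      proof (cases "0 < y")
        case y: True
        define m where "m = n + n0"
        have m: "real m * F (a m) \<le> 2" "x0 \<le> a m" "0 < a m"
          using n0[of m] C by (auto simp: m_def less_imp_le intro: less_le_trans)
        have "real m * F (a m * (y / s)) \<le> 2 * C * s powr \<beta> * y powr (- \<beta>) + 2"
        proof (cases "y \<le> s")
          case True
          have "F (a m * (y / s)) \<le> C * (a m / (a m * (y / s))) powr \<beta> * F (a m)"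
            using True y s m by (intro potter) (auto simp: field_simps)
          also have "(a m / (a m * (y / s))) powr \<beta> = s powr \<beta> * y powr (- \<beta>)"
            using m y s by (simp add: powr_divide powr_minus field_simps)
          finally have "real m * F (a m * (y / s)) \<le> real m * (C * (s powr \<beta> * y powr (- \<beta>)) * F (a m))"
            by (rule mult_left_mono) simp
          also have "\<dots> = (real m * F (a m)) * (C * s powr \<beta> * y powr (- \<beta>))" by (simp add: mult_ac)
          also have "\<dots> \<le> 2 * (C * s powr \<beta> * y powr (- \<beta>))"
            using m C by (intro mult_right_mono) auto
          finally show ?thesis by simp
        next
          case False
          then have "F (a m * (y / s)) \<le> F (a m)"
            using m s by (intro antimonoD[OF anti]) (simp add: field_simps)
          then have "real m * F (a m * (y / s)) \<le> real m * F (a m)" by (rule mult_left_mono) simp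
          also have "\<dots> \<le> 2" by fact
          also have "2 \<le> 2 * C * s powr \<beta> * y powr (- \<beta>) + 2" using C by simp
          finally show ?thesis .
        qed
        then have "exp (- y) * (real m * F (a m * (y / s))) \<le> exp (- y) * (2 * C * s powr \<beta> * y powr (- \<beta>) + 2)"
          by (rule mult_left_mono) simp
        then have "norm (f m y) \<le> w y"
          using y F1 by (simp add: f_def w_def algebra_simps)
        then show ?thesis by (simp add: m_def)
      qed (simp add: f_def w_def)
    qed
  qed
  then have lim: "(\<lambda>n. \<integral>y. f n y \<partial>lborel) \<longlonglongrightarrow> (\<integral>y. l y \<partial>lborel)"
    by (rule LIMSEQ_offset)
  have "l = (\<lambda>y. s powr \<alpha> * (indicator {0<..} y * (exp (- y) * y powr ((1 - \<alpha>) - 1))))"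
    using s by (auto simp: l_def indicator_def powr_divide powr_minus field_simps)
  then have il: "(\<integral>y. l y \<partial>lborel) = Gamma (1 - \<alpha>) * s powr \<alpha>"
    using has_bochner_integral_integral_eq[OF Gamma_has_bochner_integral[of "1 - \<alpha>"]] \<alpha> by simp
  have "\<forall>\<^sub>F n in sequentially. 0 < a n" using a by (simp add: filterlim_at_top_dense)
  then have "\<forall>\<^sub>F n in sequentially. (\<integral>y. f n y \<partial>lborel) = real n * (1 - (\<integral>x. exp (- (s / a n) * x) \<partial>\<mu>))"
  proof eventually_elim
    case (elim n)
    then have "0 < s / a n" using s by simp
    from one_minus_Laplace_eq_tail_integral[OF \<mu> this]
    have "real n * (1 - (\<integral>x. exp (- (s / a n) * x) \<partial>\<mu>)) =
       real n * (\<integral>y. indicator {0<..} y * (exp (- y) * F (y / (s / a n))) \<partial>lborel)"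
      by (simp only: F_def)
    also have "\<dots> = (\<integral>y. real n * (indicator {0<..} y * (exp (- y) * F (y / (s / a n)))) \<partial>lborel)"
      by simp
    also have "\<dots> = (\<integral>y. f n y \<partial>lborel)"
      by (intro Bochner_Integration.integral_cong) (auto simp: f_def mult_ac)
    finally show ?case ..
  qed
  with lim show ?thesis unfolding il by (rule Lim_transform_eventually)
qed

text \<open>
  Write \<open>m = \<lfloor>t\<rfloor>\<close> and \<open>n = \<lfloor>\<nu> t\<rfloor>\<close>. If \<open>a\<^sub>m\<close> exceeded \<open>R a\<^sub>n\<close>, then \<open>m F(a\<^sub>m)\<close>, which tends to
  \<open>1\<close>, would be at most \<open>m F(R a\<^sub>n)\<close>, which tends to \<open>R\<^sup>-\<^sup>\<alpha> / \<nu>\<close>. The constant \<open>R\<close> is chosen to make the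
  latter limit \<open>1/4\<close>.
\<close>

lemma normalizing_ratio_bounded:
  fixes F :: "real \<Rightarrow> real" and a :: "nat \<Rightarrow> real"
  assumes anti: "antimono F" and pos: "\<forall>\<^sub>F x in at_top. 0 < F x"
    and rv: "\<And>c. 0 < c \<Longrightarrow> ((\<lambda>x. F (c * x) / F x) \<longlongrightarrow> c powr (- \<alpha>)) at_top"
    and \<alpha>: "0 < \<alpha>" and \<nu>: "0 < \<nu>"
    and a: "filterlim a at_top sequentially" and na: "(\<lambda>n. real n * F (a n)) \<longlonglongrightarrow> 1"
  obtains R where "0 < R" "\<forall>\<^sub>F t in at_top. at_floor a t \<le> R * at_floor a (\<nu> * t)"
proof -
  define R where "R = (4 / \<nu>) powr (1 / \<alpha>)"
  have R: "0 < R" "inverse \<nu> * R powr (- \<alpha>) = 1 / 4"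
    using \<nu> \<alpha> by (auto simp: R_def powr_powr powr_minus powr_divide)
  let ?m = "\<lambda>t::real. nat \<lfloor>t\<rfloor>" and ?n = "\<lambda>t. nat \<lfloor>\<nu> * t\<rfloor>"
  have m: "filterlim ?m sequentially at_top" by real_asymp
  have n: "filterlim ?n sequentially at_top" using \<nu> by real_asymp
  have mn: "((\<lambda>t. real (?m t) / real (?n t)) \<longlongrightarrow> inverse \<nu>) at_top" using \<nu> by real_asymp
  have "(\<lambda>n. F (R * a n) / F (a n)) \<longlonglongrightarrow> R powr (- \<alpha>)"
    using filterlim_compose[OF rv[OF R(1)] a] by simp
  from tendsto_mult[OF na this] have l1: "(\<lambda>n. real n * F (a n) * (F (R * a n) / F (a n))) \<longlonglongrightarrow> R powr (- \<alpha>)"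
    by simp
  have "\<forall>\<^sub>F n in sequentially. 0 < F (a n)"
    using pos a by (rule eventually_compose_filterlim)
  then have "\<forall>\<^sub>F n in sequentially. real n * F (a n) * (F (R * a n) / F (a n)) = real n * F (R * a n)"
    by eventually_elim simp
  with l1 have "(\<lambda>n. real n * F (R * a n)) \<longlonglongrightarrow> R powr (- \<alpha>)" by (rule Lim_transform_eventually)
  from tendsto_mult[OF mn filterlim_compose[OF this n]]
  have l2: "((\<lambda>t. real (?m t) / real (?n t) * (real (?n t) * F (R * a (?n t)))) \<longlongrightarrow> 1 / 4) at_top"
    unfolding R(2) .
  have "\<forall>\<^sub>F t in at_top. real (?m t) / real (?n t) * (real (?n t) * F (R * a (?n t))) < 1 / 2"
    by (rule order_tendstoD[OF l2]) simp
  moreover have "\<forall>\<^sub>F t in at_top. 1 / 2 < real (?m t) * F (a (?m t))"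
    by (rule order_tendstoD[OF filterlim_compose[OF na m]]) simp
  moreover have "\<forall>\<^sub>F t in at_top. 0 < ?n t"
    by (rule eventually_compose_filterlim[OF eventually_gt_at_top n])
  ultimately have "\<forall>\<^sub>F t in at_top. at_floor a t \<le> R * at_floor a (\<nu> * t)"
  proof eventually_elim
    case (elim t)
    then have "real (?m t) * F (R * a (?n t)) < real (?m t) * F (a (?m t))" by (simp split: if_splits)
    then have "F (R * a (?n t)) < F (a (?m t))" by (simp add: mult_less_cancel_left split: if_splits)
    then have "\<not> R * a (?n t) \<le> a (?m t)" using antimonoD[OF anti] by (meson not_less)
    then show ?case by (simp add: at_floor_def)
  qed
  with R(1) show thesis by (rule that)
qed

lemma (in prob_space) regularly_varying_tail:
  assumes "regularly_varying Z \<alpha>"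
  defines "F \<equiv> \<lambda>x. prob {\<omega>\<in>space M. x < Z \<omega>}"
  shows "\<forall>\<^sub>F x in at_top. 0 < F x"
    and "0 < c \<Longrightarrow> ((\<lambda>x. F (c * x) / F x) \<longlongrightarrow> c powr (- \<alpha>)) at_top"
proof -
  from assms obtain l where l: "slowly_varying l" and F: "\<And>x. 0 < x \<Longrightarrow> F x = x powr (- \<alpha>) * l x"
    unfolding regularly_varying_def by auto
  have lpos: "\<forall>\<^sub>F x in at_top. 0 < l x" using l by (simp add: slowly_varying_def)
  then show "\<forall>\<^sub>F x in at_top. 0 < F x"
    using eventually_gt_at_top[of 0] by eventually_elim (simp add: F)
  assume c: "0 < c"
  have "((\<lambda>x. l (c * x) / l x) \<longlongrightarrow> 1) at_top" using l c by (simp add: slowly_varying_def)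
  from tendsto_mult[OF tendsto_const this]
  have "((\<lambda>x. c powr (- \<alpha>) * (l (c * x) / l x)) \<longlongrightarrow> c powr (- \<alpha>)) at_top" by simp
  moreover have "\<forall>\<^sub>F x in at_top. c powr (- \<alpha>) * (l (c * x) / l x) = F (c * x) / F x"
    using eventually_gt_at_top[of 0] lpos
  proof eventually_elim
    case (elim x)
    then show ?case using c by (simp add: F powr_mult field_simps)
  qed
  ultimately show "((\<lambda>x. F (c * x) / F x) \<longlongrightarrow> c powr (- \<alpha>)) at_top"
    by (rule Lim_transform_eventually)
qed

section \<open>Counts and marks of the Poisson immigrants\<close>

lemma space_time_mark_space: "space time_mark_space = {0..} \<times> UNIV"
  by (simp add: time_mark_space_def space_pair_measure space_restrict_space)

lemma Times_in_time_mark_space: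
  assumes "I \<in> sets borel" "I \<subseteq> {0..}" "B \<in> sets borel"
  shows "I \<times> B \<in> sets time_mark_space"
  unfolding time_mark_space_def
  by (rule pair_measureI) (use assms in \<open>auto simp: sets_restrict_space_iff\<close>)

text \<open>
  The function \<open>k \<mapsto> r\<^sup>k\<close>, extended by \<open>0\<close> to the values that are not natural numbers. It is
  written as a series so that the expectation of its composition with a random count is a series over the
  probabilities of the counts.
\<close>

definition poisson_pgf_kernel :: "real \<Rightarrow> ennreal \<Rightarrow> ennreal" where
  "poisson_pgf_kernel r x = (\<Sum>k. indicator {of_nat k} x * ennreal (r ^ k))"

lemma poisson_pgf_kernel_of_nat: "poisson_pgf_kernel r (of_nat n) = ennreal (r ^ n)"
proof -
  have "poisson_pgf_kernel r (of_nat n) = (\<Sum>k\<in>{n}. indicator {of_nat k} (of_nat n :: ennreal) * ennreal (r ^ k))"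
    unfolding poisson_pgf_kernel_def by (rule suminf_finite) auto
  then show ?thesis by simp
qed

lemma measurable_poisson_pgf_kernel [measurable]: "poisson_pgf_kernel r \<in> borel_measurable borel"
  unfolding poisson_pgf_kernel_def by measurable

context marked_poisson_cluster
begin

definition intensity :: "(real \<times> 'a) measure" where
  "intensity = scale_measure (ennreal \<nu>) (restrict_space lborel {0..}) \<Otimes>\<^sub>M Q"

definition immigrant_count :: "(real \<times> 'a) set \<Rightarrow> 'w \<Rightarrow> ennreal" where
  "immigrant_count B \<omega> = emeasure (immigrant_process \<Gamma> A \<omega>) B"

text \<open>
  The number of immigrants up to time \<open>t\<close>, in a form that is visibly measurable. If
  all immigrants arrive by time \<open>t\<close>, which has probability zero, the value is arbitrary.
\<close>

definition arrivals :: "real \<Rightarrow> 'w \<Rightarrow> nat" where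
  "arrivals t \<omega> = (LEAST n. t < \<Gamma> n \<omega>)"

lemmas [measurable] = rv_Gamma rv_K rv_T rv_A

sublocale Q: prob_space Q by (rule prob_Q)

lemma space_Q [simp]: "space Q = UNIV"
  using sets_eq_imp_space_eq[OF sets_Q] by simp

lemma prob_Q_UNIV [simp]: "measure Q UNIV = 1"
  using Q.prob_space by simp

lemma measurable_arrivals [measurable]: "arrivals t \<in> M \<rightarrow>\<^sub>M count_space UNIV"
  unfolding arrivals_def by measurable

lemma sets_intensity: "sets intensity = sets time_mark_space"
  unfolding intensity_def time_mark_space_def
  by (rule sets_pair_measure_cong) (auto simp: sets_Q sets_restrict_space)

lemma intensity_Times:
  assumes "I \<in> sets borel" "I \<subseteq> {0..}" "B \<in> sets borel"
  shows "emeasure intensity (I \<times> B) = ennreal \<nu> * emeasure lborel I * ennreal (measure Q B)"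
proof -
  have "emeasure intensity (I \<times> B) =
      emeasure (scale_measure (ennreal \<nu>) (restrict_space lborel {0..})) I * emeasure Q B"
    unfolding intensity_def
    by (rule Q.emeasure_pair_measure_Times)
       (use assms in \<open>auto simp: sets_restrict_space_iff sets_Q\<close>)
  moreover have "emeasure (restrict_space lborel {0..}) I = emeasure lborel I"
    by (rule emeasure_restrict_space) (use assms in auto)
  ultimately show ?thesis by (simp add: Q.emeasure_eq_measure)
qed

lemma intensity_interval:
  assumes "0 \<le> l" "l \<le> u" "B \<in> sets borel"
  shows "emeasure intensity ({l..<u} \<times> B) = ennreal (\<nu> * (u - l) * measure Q B)"
    and "emeasure intensity ({l..u} \<times> B) = ennreal (\<nu> * (u - l) * measure Q B)"
  using assms rate_pos
  by (subst intensity_Times; force simp: ennreal_mult'[symmetric] ennreal_mult''[symmetric])+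

lemma immigrant_count_eq:
  assumes "\<omega> \<in> space M" "B \<in> sets time_mark_space"
  shows "immigrant_count B \<omega> = emeasure (count_space UNIV) {i. (\<Gamma> i \<omega>, A i 0 \<omega>) \<in> B}"
proof -
  have "(\<lambda>i. (\<Gamma> i \<omega>, A i 0 \<omega>)) \<in> count_space UNIV \<rightarrow>\<^sub>M time_mark_space"
    using Gamma_nonneg[OF assms(1)] by (auto simp: space_time_mark_space)
  then show ?thesis
    using assms unfolding immigrant_count_def immigrant_process_def dirac_sum_def
    by (subst emeasure_distr) (auto simp: vimage_def)
qed

lemma immigrant_count_eq_0_iff:
  assumes "\<omega> \<in> space M" "B \<in> sets time_mark_space"
  shows "immigrant_count B \<omega> = 0 \<longleftrightarrow> (\<forall>i. (\<Gamma> i \<omega>, A i 0 \<omega>) \<notin> B)"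
  using assms by (subst immigrant_count_eq) (auto simp: emeasure_count_space_eq_0)

lemma poisson: "poisson_point_process (immigrant_process \<Gamma> A) intensity"
  using immigrants_poisson unfolding intensity_def .

lemma measurable_immigrant_count [measurable]:
  "B \<in> sets time_mark_space \<Longrightarrow> immigrant_count B \<in> borel_measurable M"
  using poisson unfolding poisson_point_process_def immigrant_count_def[abs_def] sets_intensity by auto

lemma prob_immigrant_count:
  assumes "B \<in> sets time_mark_space" "emeasure intensity B = ennreal m" "0 \<le> m"
  shows "prob {\<omega>\<in>space M. immigrant_count B \<omega> = of_nat k} = m ^ k / fact k * exp (- m)"
proof -
  have "measure intensity B = m" using assms by (simp add: measure_def)
  then show ?thesis
    using poisson assms unfolding poisson_point_process_def immigrant_count_def[abs_def] sets_intensity by auto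
qed

lemma indep_immigrant_count:
  assumes "finite J" "\<And>j. j \<in> J \<Longrightarrow> B j \<in> sets time_mark_space" "disjoint_family_on B J"
  shows "indep_vars (\<lambda>_. borel) (\<lambda>j. immigrant_count (B j)) (J :: nat set)"
  using poisson assms unfolding poisson_point_process_def immigrant_count_def[abs_def] sets_intensity by auto

text \<open>
  The Poisson weights already sum to \<open>1\<close> over the finite values.
\<close>

lemma immigrant_count_finite:
  assumes B: "B \<in> sets time_mark_space" "emeasure intensity B = ennreal m" "0 \<le> m"
  shows "AE \<omega> in M. \<exists>k. immigrant_count B \<omega> = of_nat k"
proof -
  note [measurable] = B(1)
  let ?E = "\<lambda>k. {\<omega>\<in>space M. immigrant_count B \<omega> = of_nat k}"
  have "(\<lambda>k. prob (?E k)) sums prob (\<Union>k. ?E k)"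
    by (rule finite_measure_UNION) (auto simp: disjoint_family_on_def)
  moreover have "(\<lambda>k. prob (?E k)) sums (exp m * exp (- m))"
    unfolding prob_immigrant_count[OF B]
    using sums_mult2[OF exp_converges[of m], of "exp (- m)"] by (simp add: divide_inverse mult_ac)
  ultimately have "prob (\<Union>k. ?E k) = 1"
    using sums_unique2 by (fastforce simp: exp_minus)
  then have "AE \<omega> in M. \<omega> \<in> (\<Union>k. ?E k)"
    by (subst AE_in_set_eq_1) auto
  then show ?thesis by eventually_elim auto
qed

lemma poisson_generating_function:
  assumes B: "B \<in> sets time_mark_space" "emeasure intensity B = ennreal m" "0 \<le> m" and r: "0 \<le> r"
  shows "(\<integral>\<^sup>+ \<omega>. poisson_pgf_kernel r (immigrant_count B \<omega>) \<partial>M) = ennreal (exp (- (m * (1 - r))))"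
proof -
  note [measurable] = B(1)
  have "(\<integral>\<^sup>+ \<omega>. poisson_pgf_kernel r (immigrant_count B \<omega>) \<partial>M) =
    (\<Sum>k. \<integral>\<^sup>+ \<omega>. ennreal (r ^ k) * indicator {\<omega>\<in>space M. immigrant_count B \<omega> = of_nat k} \<omega> \<partial>M)"
    unfolding poisson_pgf_kernel_def
    by (subst nn_integral_suminf)
       (auto intro!: suminf_cong nn_integral_cong simp: mult.commute split: split_indicator)
  also have "\<dots> = (\<Sum>k. ennreal (r ^ k * (m ^ k / fact k * exp (- m))))"
    using r B(3)
    by (intro suminf_cong, subst nn_integral_cmult_indicator)
       (auto simp: emeasure_eq_measure prob_immigrant_count[OF B] ennreal_mult[symmetric])
  also have "\<dots> = ennreal (exp (r * m) * exp (- m))"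
  proof (rule suminf_ennreal_eq)
    show "(\<lambda>k. r ^ k * (m ^ k / fact k * exp (- m))) sums (exp (r * m) * exp (- m))"
      using sums_mult2[OF exp_converges[of "r * m"], of "exp (- m)"]
      by (simp add: divide_inverse power_mult_distrib mult_ac)
  qed (use r B(3) in simp)
  also have "exp (r * m) * exp (- m) = exp (- (m * (1 - r)))"
    by (simp add: exp_add[symmetric] algebra_simps)
  finally show ?thesis .
qed

text \<open>
  The count of immigrants up to time \<open>t\<close> is almost surely finite, and the arrival times increase.
\<close>

lemma arrivals_eq:
  assumes "0 \<le> t"
  shows "AE \<omega> in M. {i. \<Gamma> i \<omega> \<le> t} = {..<arrivals t \<omega>}"
proof -
  have B: "{0..t} \<times> UNIV \<in> sets time_mark_space" by (rule Times_in_time_mark_space) auto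
  have "AE \<omega> in M. \<exists>k. immigrant_count ({0..t} \<times> UNIV) \<omega> = of_nat k"
    by (rule immigrant_count_finite[OF B, of "\<nu> * t"])
       (use intensity_interval(2)[of 0 t UNIV] assms rate_pos in auto)
  with AE_space show ?thesis
  proof eventually_elim
    case (elim \<omega>)
    have "{i. (\<Gamma> i \<omega>, A i 0 \<omega>) \<in> {0..t} \<times> UNIV} = {i. \<Gamma> i \<omega> \<le> t}"
      using Gamma_nonneg[of \<omega>] elim by auto
    then have "immigrant_count ({0..t} \<times> UNIV) \<omega> = emeasure (count_space UNIV) {i. \<Gamma> i \<omega> \<le> t}"
      using immigrant_count_eq[OF elim(1) B] by simp
    moreover obtain k where "immigrant_count ({0..t} \<times> UNIV) \<omega> = of_nat k" using elim by blast
    ultimately have "emeasure (count_space UNIV) {i. \<Gamma> i \<omega> \<le> t} \<noteq> \<infinity>"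
      by (metis ennreal_of_nat_neq_top infinity_ennreal_def)
    then have "finite {i. \<Gamma> i \<omega> \<le> t}"
      by (metis emeasure_count_space_infinite subset_UNIV infinity_ennreal_def)
    then have "{i. \<Gamma> i \<omega> \<le> t} \<noteq> UNIV" using infinite_UNIV_nat by metis
    then obtain n where "\<not> \<Gamma> n \<omega> \<le> t" by blast
    then have "t < \<Gamma> n \<omega>" by simp
    then have l: "t < \<Gamma> (arrivals t \<omega>) \<omega>" unfolding arrivals_def by (rule LeastI)
    have "\<Gamma> i \<omega> \<le> t \<longleftrightarrow> i < arrivals t \<omega>" for i
    proof
      assume "i < arrivals t \<omega>"
      then show "\<Gamma> i \<omega> \<le> t" unfolding arrivals_def using not_less_Least not_less by blast
    next
      assume "\<Gamma> i \<omega> \<le> t"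
      with l have "\<Gamma> i \<omega> < \<Gamma> (arrivals t \<omega>) \<omega>" by simp
      then show "i < arrivals t \<omega>"
        using Gamma_mono[of \<omega>] elim by (metis incseqD not_less)
    qed
    then show ?case by auto
  qed
qed

text \<open>
  Group the immigrants up to time \<open>t\<close> by the value of \<open>g\<close> at their marks. The numbers of immigrants in
  the groups are independent Poisson variables, because they count points in disjoint sets; the
  product of their generating functions is the claim, as the means add up to \<open>\<nu> t\<close>.
\<close>

lemma poisson_product_simple:
  fixes g :: "'a \<Rightarrow> real"
  assumes g: "simple_function Q g" "\<And>x. 0 \<le> g x" and t: "0 \<le> t"
  shows "(\<integral>\<^sup>+ \<omega>. ennreal (\<Prod>i<arrivals t \<omega>. g (A i 0 \<omega>)) \<partial>M) = ennreal (exp (- (\<nu> * t * (1 - (\<integral>x. g x \<partial>Q)))))"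
proof -
  define V where "V = g ` UNIV"
  have fV: "finite V" using g(1) by (simp add: simple_function_def V_def)
  from ex_bij_betw_nat_finite[OF this] obtain h where h: "bij_betw h {0..<card V} V" by auto
  define J where "J = {0..<card V}"
  define B where "B j = g -` {h j}" for j
  have B [measurable]: "B j \<in> sets borel" for j
    using simple_functionD(2)[OF g(1), of "{h j}"] by (simp add: B_def sets_Q)
  have hinj: "h i = h j \<longleftrightarrow> i = j" if "i \<in> J" "j \<in> J" for i j
    using bij_betw_imp_inj_on[OF h] that by (auto simp: J_def inj_on_def)
  have g_h: "\<exists>j\<in>J. g x = h j" for x
    using bij_betw_imp_surj_on[OF h] by (force simp: V_def J_def image_def)
  have h0: "0 \<le> h j" if "j \<in> J" for j
  proof -
    have "h j \<in> V" using bij_betwE[OF h] that unfolding J_def by blast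
    then show ?thesis using g(2) by (auto simp: V_def)
  qed
  have fJ: "finite J" by (simp add: J_def)
  have sumJ: "(\<Sum>j\<in>J. c j * indicator (B j) x) = c k" if "k \<in> J" "g x = h k" for x k and c :: "nat \<Rightarrow> real"
  proof -
    have "(\<Sum>j\<in>J. c j * indicator (B j) x) = (\<Sum>j\<in>J. if j = k then c k else 0)"
      using that hinj by (intro sum.cong) (auto simp: B_def indicator_def)
    then show ?thesis using that fJ by simp
  qed
  have BQ: "B j \<in> sets Q" for j by (simp add: sets_Q)
  have int: "(\<integral>x. (\<Sum>j\<in>J. c j * indicator (B j) x) \<partial>Q) = (\<Sum>j\<in>J. c j * measure Q (B j))" for c :: "nat \<Rightarrow> real"
    using BQ by (subst Bochner_Integration.integral_sum) (auto simp: Q.emeasure_eq_measure)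
  have g_sum: "g x = (\<Sum>j\<in>J. h j * indicator (B j) x)" for x
    using g_h[of x] sumJ[of _ x h] by auto
  have one_sum: "1 = (\<Sum>j\<in>J. 1 * indicator (B j) x :: real)" for x
    using g_h[of x] sumJ[of _ x "\<lambda>_. 1"] by auto
  have Q1: "(\<Sum>j\<in>J. measure Q (B j)) = 1"
    using int[of "\<lambda>_. 1"] unfolding one_sum[symmetric] by simp
  have Qg: "(\<Sum>j\<in>J. h j * measure Q (B j)) = (\<integral>x. g x \<partial>Q)"
    using int[of h] unfolding g_sum[symmetric] by simp
  define C where "C j = {0..t} \<times> B j" for j
  have C: "C j \<in> sets time_mark_space" for j
    unfolding C_def by (rule Times_in_time_mark_space) auto
  have Cm: "emeasure intensity (C j) = ennreal (\<nu> * t * measure Q (B j))" for j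
    using intensity_interval(2)[of 0 t "B j"] t by (simp add: C_def)
  have m0: "0 \<le> \<nu> * t * measure Q (B j)" for j using t rate_pos by simp
  have disj: "disjoint_family_on C J"
    using hinj by (auto simp: disjoint_family_on_def C_def B_def)
  have ind: "indep_vars (\<lambda>_. borel) (\<lambda>j \<omega>. poisson_pgf_kernel (h j) (immigrant_count (C j) \<omega>)) J"
    by (rule indep_vars_compose2[OF indep_immigrant_count[OF fJ C disj]]) simp
  have "AE \<omega> in M. \<forall>j\<in>J. \<exists>k. immigrant_count (C j) \<omega> = of_nat k"
    using fJ by (subst AE_finite_all) (auto intro!: immigrant_count_finite[OF C Cm m0])
  with AE_space arrivals_eq[OF t]
  have "AE \<omega> in M. ennreal (\<Prod>i<arrivals t \<omega>. g (A i 0 \<omega>)) =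
      (\<Prod>j\<in>J. poisson_pgf_kernel (h j) (immigrant_count (C j) \<omega>))"
  proof eventually_elim
    case (elim \<omega>)
    let ?I = "{..<arrivals t \<omega>}"
    have kernel: "poisson_pgf_kernel (h j) (immigrant_count (C j) \<omega>) = ennreal (h j ^ card {i\<in>?I. g (A i 0 \<omega>) = h j})" for j
    proof -
      have eq: "{i. (\<Gamma> i \<omega>, A i 0 \<omega>) \<in> C j} = {i\<in>?I. g (A i 0 \<omega>) = h j}"
        using Gamma_nonneg[of \<omega>] elim by (auto simp: C_def B_def)
      have "immigrant_count (C j) \<omega> = of_nat (card {i\<in>?I. g (A i 0 \<omega>) = h j})"
        using elim C by (simp add: immigrant_count_eq eq)
      then show ?thesis by (simp add: poisson_pgf_kernel_of_nat)
    qed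
    have "(\<Prod>i\<in>?I. g (A i 0 \<omega>)) = (\<Prod>v\<in>V. \<Prod>i\<in>{i\<in>?I. g (A i 0 \<omega>) = v}. g (A i 0 \<omega>))"
      by (rule prod.group[symmetric]) (use fV in \<open>auto simp: V_def\<close>)
    also have "\<dots> = (\<Prod>v\<in>V. v ^ card {i\<in>?I. g (A i 0 \<omega>) = v})"
      by (intro prod.cong) auto
    also have "\<dots> = (\<Prod>j\<in>J. h j ^ card {i\<in>?I. g (A i 0 \<omega>) = h j})"
      unfolding J_def by (rule prod.reindex_bij_betw[OF h, symmetric])
    also have "ennreal \<dots> = (\<Prod>j\<in>J. ennreal (h j ^ card {i\<in>?I. g (A i 0 \<omega>) = h j}))"
      using h0 by (intro prod_ennreal[symmetric]) auto
    finally show ?case unfolding kernel .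
  qed
  then have "(\<integral>\<^sup>+ \<omega>. ennreal (\<Prod>i<arrivals t \<omega>. g (A i 0 \<omega>)) \<partial>M) =
      (\<integral>\<^sup>+ \<omega>. (\<Prod>j\<in>J. poisson_pgf_kernel (h j) (immigrant_count (C j) \<omega>)) \<partial>M)"
    by (rule nn_integral_cong_AE)
  also have "\<dots> = (\<Prod>j\<in>J. \<integral>\<^sup>+ \<omega>. poisson_pgf_kernel (h j) (immigrant_count (C j) \<omega>) \<partial>M)"
    by (rule indep_vars_nn_integral[OF fJ ind]) simp
  also have "\<dots> = (\<Prod>j\<in>J. ennreal (exp (- (\<nu> * t * measure Q (B j) * (1 - h j)))))"
    by (intro prod.cong poisson_generating_function C Cm m0 h0) auto
  also have "\<dots> = ennreal (exp (\<Sum>j\<in>J. - (\<nu> * t * measure Q (B j) * (1 - h j))))"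
    by (subst prod_ennreal) (auto simp: exp_sum fJ)
  also have "(\<Sum>j\<in>J. - (\<nu> * t * measure Q (B j) * (1 - h j))) =
      - (\<nu> * t * ((\<Sum>j\<in>J. measure Q (B j)) - (\<Sum>j\<in>J. h j * measure Q (B j))))"
    by (simp add: sum_negf[symmetric] sum_distrib_left sum_subtractf[symmetric] algebra_simps)
  finally show ?thesis unfolding Q1 Qg .
qed

lemma measurable_prod_arrivals:
  assumes "\<And>i. X i \<in> borel_measurable M"
  shows "(\<lambda>\<omega>. \<Prod>i<arrivals t \<omega>. X i \<omega> :: real) \<in> borel_measurable M"
  by (rule measurable_compose_countable[where f = "\<lambda>n \<omega>. \<Prod>i<n. X i \<omega>" and g = "arrivals t"])
     (use assms in measurable)

text \<open>
  Almost surely only finitely many factors occur, so \<open>g\<close> may be approximated pointwise by simple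
  functions; everything is bounded by \<open>1\<close>.
\<close>

theorem poisson_product:
  fixes g :: "'a \<Rightarrow> real"
  assumes g: "g \<in> borel_measurable borel" "\<And>x. 0 \<le> g x" "\<And>x. g x \<le> 1" and t: "0 \<le> t"
  shows "(\<integral>\<^sup>+ \<omega>. ennreal (\<Prod>i<arrivals t \<omega>. g (A i 0 \<omega>)) \<partial>M) = ennreal (exp (- (\<nu> * t * (1 - (\<integral>x. g x \<partial>Q)))))"
proof -
  have gQ: "g \<in> borel_measurable Q" using g(1) by (simp add: measurable_cong_sets[OF sets_Q refl])
  then have "(\<lambda>x. ennreal (g x)) \<in> borel_measurable Q" by simp
  from borel_measurable_implies_simple_function_sequence'[OF this] obtain F where
    F: "\<And>n. simple_function Q (F n)" "incseq F" "\<And>n x. F n x < top" "\<And>x. (SUP n. F n x) = ennreal (g x)"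
    by metis
  define U where "U n x = enn2real (F n x)" for n x
  have FU: "F n x = ennreal (U n x)" for n x using F(3)[of n x] by (simp add: U_def)
  have U0: "0 \<le> U n x" for n x by (simp add: U_def)
  have Ug: "U n x \<le> g x" for n x
  proof -
    have "ennreal (U n x) \<le> ennreal (g x)" unfolding FU[symmetric] F(4)[symmetric] by (rule SUP_upper) simp
    then show ?thesis using g(2) by simp
  qed
  have Ulim: "(\<lambda>n. U n x) \<longlonglongrightarrow> g x" for x
  proof -
    have "(\<lambda>n. F n x) \<longlonglongrightarrow> (SUP n. F n x)"
      by (rule LIMSEQ_SUP) (use F(2) in \<open>auto simp: mono_def le_fun_def\<close>)
    then have "(\<lambda>n. ennreal (U n x)) \<longlonglongrightarrow> ennreal (g x)" by (simp only: F(4)) (simp only: FU)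
    then show ?thesis using U0 g(2) by (subst (asm) tendsto_ennreal_iff) auto
  qed
  have Us: "simple_function Q (U n)" for n
    using simple_function_compose1[OF F(1)[of n], of enn2real] by (simp add: U_def[abs_def] comp_def)
  have UQ: "U n \<in> borel_measurable Q" for n using Us by (rule borel_measurable_simple_function)
  then have UB [measurable]: "U n \<in> borel_measurable borel" for n
    by (simp add: measurable_cong_sets[OF sets_Q refl])
  note [measurable] = g(1)
  have "(\<lambda>n. \<integral>\<^sup>+ \<omega>. ennreal (\<Prod>i<arrivals t \<omega>. U n (A i 0 \<omega>)) \<partial>M)
      \<longlonglongrightarrow> (\<integral>\<^sup>+ \<omega>. ennreal (\<Prod>i<arrivals t \<omega>. g (A i 0 \<omega>)) \<partial>M)"
  proof (rule nn_integral_dominated_convergence)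
    show "(\<lambda>\<omega>. ennreal (\<Prod>i<arrivals t \<omega>. U n (A i 0 \<omega>))) \<in> borel_measurable M" for n
      by (intro measurable_compose[OF measurable_prod_arrivals] measurable_compose[OF rv_A UB] measurable_ennreal)
    show "(\<lambda>\<omega>. ennreal (\<Prod>i<arrivals t \<omega>. g (A i 0 \<omega>))) \<in> borel_measurable M"
      by (intro measurable_compose[OF measurable_prod_arrivals] measurable_compose[OF rv_A g(1)] measurable_ennreal)
    show "(\<lambda>_. 1 :: ennreal) \<in> borel_measurable M" by simp
    show "AE \<omega> in M. ennreal (\<Prod>i<arrivals t \<omega>. U n (A i 0 \<omega>)) \<le> 1" for n
      by (rule AE_I2) (auto intro!: prod_le_1 U0 order_trans[OF Ug g(3)])
    show "(\<integral>\<^sup>+ \<omega>. 1 \<partial>M) < \<infinity>" by (simp add: emeasure_space_1)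
    show "AE \<omega> in M. (\<lambda>n. ennreal (\<Prod>i<arrivals t \<omega>. U n (A i 0 \<omega>))) \<longlonglongrightarrow> ennreal (\<Prod>i<arrivals t \<omega>. g (A i 0 \<omega>))"
      by (intro AE_I2 tendsto_ennrealI tendsto_prod Ulim)
  qed
  moreover have "(\<lambda>n. \<integral>\<^sup>+ \<omega>. ennreal (\<Prod>i<arrivals t \<omega>. U n (A i 0 \<omega>)) \<partial>M)
      \<longlonglongrightarrow> ennreal (exp (- (\<nu> * t * (1 - (\<integral>x. g x \<partial>Q)))))"
    unfolding poisson_product_simple[OF Us U0 t]
  proof (intro tendsto_intros tendsto_ennrealI)
    show "(\<lambda>n. \<integral>x. U n x \<partial>Q) \<longlonglongrightarrow> (\<integral>x. g x \<partial>Q)"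
      by (rule integral_dominated_convergence[where w = "\<lambda>_. 1"])
         (use gQ UQ Ulim U0 order_trans[OF Ug g(3)] in auto)
  qed
  ultimately show ?thesis by (rule LIMSEQ_unique)
qed

text \<open>
  Cut time into intervals of length \<open>h\<close>. The first immigrant certainly has its mark in \<open>B\<close> if the first
  non-empty interval contains a point with mark in \<open>B\<close> and no point with mark outside \<open>B\<close>. The
  probability \<open>p h\<close> of this event is a geometric series, and tends to \<open>Q B\<close> as \<open>h\<close> tends to \<open>0\<close>, when
  intervals with several points become negligible.
\<close>

lemma first_mark_ge:
  assumes B [measurable]: "B \<in> sets borel"
  shows "measure Q B \<le> prob {\<omega>\<in>space M. A 0 0 \<omega> \<in> B}"
proof -
  define q where "q = measure Q B"
  have q: "0 \<le> q" "q \<le> 1" by (auto simp: q_def)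
  have qc: "measure Q (- B) = 1 - q"
    using Q.prob_compl[of B] B by (simp add: sets_Q q_def Compl_eq_Diff_UNIV)
  define p where "p h = (1 - exp (- (\<nu> * h * q))) * exp (- (\<nu> * h * (1 - q))) / (1 - exp (- (\<nu> * h)))" for h
  have step: "p h \<le> prob {\<omega>\<in>space M. A 0 0 \<omega> \<in> B}" if h: "0 < h" for h
  proof -
    define C where "C k = (\<lambda>j::nat. if j = 0 then {0..<real k * h} \<times> (UNIV :: 'a set)
      else {real k * h..<real (Suc k) * h} \<times> (if j = 1 then B else - B))" for k
    have C [measurable]: "C k j \<in> sets time_mark_space" for k j
    proof -
      have "0 \<le> real k * h" using h by simp
      then have I: "{real k * h..<real (Suc k) * h} \<subseteq> {0..}" "{0..<real k * h} \<subseteq> {0..}"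
        by (auto simp del: of_nat_Suc)
      show ?thesis
        unfolding C_def using Times_in_time_mark_space[OF _ I(1) B]
          Times_in_time_mark_space[OF _ I(1) borel_comp[OF B]] Times_in_time_mark_space[OF _ I(2), of "UNIV :: 'a set"]
        by (simp del: of_nat_Suc)
    qed
    have m: "emeasure intensity (C k 0) = ennreal (\<nu> * (real k * h))"
       "emeasure intensity (C k 1) = ennreal (\<nu> * h * q)"
       "emeasure intensity (C k 2) = ennreal (\<nu> * h * (1 - q))" for k
      using h intensity_interval(1)[of 0 "real k * h" UNIV]
        intensity_interval(1)[of "real k * h" "real (Suc k) * h" B]
        intensity_interval(1)[of "real k * h" "real (Suc k) * h" "- B"]
      by (auto simp: C_def algebra_simps q_def[symmetric] qc)
    let ?X = "\<lambda>k j. immigrant_count (C k j)"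
    have p0: "prob {\<omega>\<in>space M. ?X k 0 \<omega> = 0} = exp (- (\<nu> * (real k * h)))"
       "prob {\<omega>\<in>space M. ?X k 1 \<omega> = 0} = exp (- (\<nu> * h * q))"
       "prob {\<omega>\<in>space M. ?X k 2 \<omega> = 0} = exp (- (\<nu> * h * (1 - q)))" for k
      using prob_immigrant_count[OF C m(1), of k 0] prob_immigrant_count[OF C m(2), of k 0]
        prob_immigrant_count[OF C m(3), of k 0] h q rate_pos by auto
    define E where "E k = {\<omega>\<in>space M. ?X k 0 \<omega> = 0 \<and> ?X k 1 \<omega> \<noteq> 0 \<and> ?X k 2 \<omega> = 0}" for k
    have E [measurable]: "E k \<in> events" for k unfolding E_def by measurable
    have pE: "prob (E k) = exp (- (\<nu> * h)) ^ k * ((1 - exp (- (\<nu> * h * q))) * exp (- (\<nu> * h * (1 - q))))" for k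
    proof -
      let ?J = "{0, 1, 2 :: nat}"
      \<comment> \<open>Index \<open>0\<close> stands for the points before the interval, \<open>1\<close> and \<open>2\<close> for those in the
        interval with mark in \<open>B\<close> and outside \<open>B\<close>.\<close>
      let ?S = "\<lambda>j::nat. if j = 1 then - {0 :: ennreal} else {0}"
      have "indep_vars (\<lambda>_. borel) (?X k) ?J"
      proof (rule indep_immigrant_count)
        show "disjoint_family_on (C k) ?J"
          by (auto simp: disjoint_family_on_def C_def split: if_splits)
      qed (use C in auto)
      then have "prob (\<Inter>j\<in>?J. ?X k j -` ?S j \<inter> space M) = (\<Prod>j\<in>?J. prob (?X k j -` ?S j \<inter> space M))"
        by (rule indep_varsD_finite) auto
      also have "(\<Inter>j\<in>?J. ?X k j -` ?S j \<inter> space M) = E k"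
        by (auto simp: E_def)
      also have "(\<Prod>j\<in>?J. prob (?X k j -` ?S j \<inter> space M)) =
         prob {\<omega>\<in>space M. ?X k 0 \<omega> = 0} * (prob {\<omega>\<in>space M. ?X k 1 \<omega> \<noteq> 0} * prob {\<omega>\<in>space M. ?X k 2 \<omega> = 0})"
      proof -
        have "?X k j -` {0} \<inter> space M = {\<omega>\<in>space M. ?X k j \<omega> = 0}"
             "?X k j -` (- {0}) \<inter> space M = {\<omega>\<in>space M. ?X k j \<omega> \<noteq> 0}" for j by auto
        then show ?thesis by simp
      qed
      also have "prob {\<omega>\<in>space M. ?X k 1 \<omega> \<noteq> 0} = 1 - prob {\<omega>\<in>space M. ?X k 1 \<omega> = 0}"
        by (rule prob_neg) measurable
      finally show ?thesis unfolding p0 by (simp add: exp_of_nat_mult[symmetric] algebra_simps)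
    qed
    have sub: "\<Gamma> 0 \<omega> \<in> {real k * h..<real (Suc k) * h} \<and> A 0 0 \<omega> \<in> B" if "\<omega> \<in> E k" for k \<omega>
    proof -
      have \<omega>: "\<omega> \<in> space M" and x0: "\<And>i. (\<Gamma> i \<omega>, A i 0 \<omega>) \<notin> C k 0" and x2: "\<And>i. (\<Gamma> i \<omega>, A i 0 \<omega>) \<notin> C k 2"
        and "\<exists>i. (\<Gamma> i \<omega>, A i 0 \<omega>) \<in> C k 1"
        using that immigrant_count_eq_0_iff[OF _ C, of \<omega> k] by (auto simp: E_def)
      then obtain i where i: "(\<Gamma> i \<omega>, A i 0 \<omega>) \<in> C k 1" by auto
      have "\<Gamma> 0 \<omega> \<le> \<Gamma> i \<omega>" using incseqD[OF Gamma_mono[OF \<omega>], of 0 i] by simp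
      then have "\<Gamma> 0 \<omega> < real (Suc k) * h" using i by (auto simp: C_def)
      moreover have "real k * h \<le> \<Gamma> 0 \<omega>" using x0[of 0] Gamma_nonneg[OF \<omega>] by (auto simp: C_def)
      moreover from calculation have "A 0 0 \<omega> \<in> B" using x2[of 0] by (auto simp: C_def)
      ultimately show ?thesis by simp
    qed
    have disj: "E k \<inter> E l = {}" if "k < l" for k l
    proof -
      have "real (Suc k) * h \<le> real l * h" using that h by (intro mult_right_mono) auto
      then show ?thesis using sub[of _ k] sub[of _ l] by fastforce
    qed
    have "disjoint_family E"
      unfolding disjoint_family_on_def using disj by (metis Int_commute linorder_neqE_nat)
    then have "(\<lambda>k. prob (E k)) sums prob (\<Union>k. E k)"
      by (intro finite_measure_UNION) auto
    moreover have "(\<lambda>k. prob (E k)) sums p h"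
    proof -
      have "norm (exp (- (\<nu> * h))) < 1" using rate_pos h by simp
      from sums_mult2[OF geometric_sums[OF this]]
      show ?thesis unfolding pE p_def by simp
    qed
    ultimately have "p h = prob (\<Union>k. E k)" by (metis sums_unique2)
    also have "\<dots> \<le> prob {\<omega>\<in>space M. A 0 0 \<omega> \<in> B}"
      using sub sets.sets_into_space[OF E] by (intro finite_measure_mono) auto
    finally show ?thesis .
  qed
  have "(p \<longlongrightarrow> q) (at_right 0)"
  proof (cases "q = 0")
    case True
    then have "p = (\<lambda>_. 0)" by (auto simp: p_def)
    then show ?thesis by (simp add: True)
  next
    case False
    then have "0 < q" using q by simp
    then show ?thesis unfolding p_def using rate_pos by (real_asymp simp: field_simps)
  qed
  then show ?thesis
    unfolding q_def[symmetric]
    by (rule tendsto_upperbound) (auto simp: eventually_at_right_field intro!: exI[of _ 1] step)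
qed

text \<open>
  The lower bounds for \<open>B\<close> and for its complement add up to \<open>1\<close>, so both are equalities.
\<close>

lemma distr_first_mark: "distr M borel (A 0 0) = Q"
proof (rule measure_eqI)
  fix B assume "B \<in> sets (distr M borel (A 0 0))"
  then have B: "B \<in> sets borel" by simp
  let ?P = "distr M borel (A 0 0)"
  interpret P: prob_space ?P by (rule prob_space_distr) simp
  have ge: "measure Q C \<le> measure ?P C" if "C \<in> sets borel" for C
    using first_mark_ge[OF that] that by (simp add: measure_distr vimage_def Int_def conj_commute)
  have "measure Q (- B) = 1 - measure Q B" "measure ?P (- B) = 1 - measure ?P B"
    using Q.prob_compl[of B] P.prob_compl[of B] B by (auto simp: sets_Q Compl_eq_Diff_UNIV)
  then have "measure Q B = measure ?P B" using ge[OF B] ge[of "- B"] B by simp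
  then show "emeasure ?P B = emeasure Q B"
    by (simp add: P.emeasure_eq_measure Q.emeasure_eq_measure)
qed (simp add: sets_Q)

end

section \<open>Conditional independence of the offspring\<close>

lemma space_point_measure_space: "space point_measure_space = locally_finite_point_measures"
  unfolding point_measure_space_def by (subst space_Sup_eq_UN) auto

lemma sets_of_point_measure:
  assumes "m \<in> space point_measure_space" shows "sets m = sets time_mark_space"
  using assms by (auto simp: space_point_measure_space locally_finite_point_measures_def dirac_sum_def)

lemma measurable_emeasure_point_measure [measurable]:
  assumes "B \<in> sets time_mark_space"
  shows "(\<lambda>m. emeasure m B) \<in> borel_measurable point_measure_space"
  unfolding point_measure_space_def
  by (rule measurable_SUP1[OF assms]) (auto intro: measurable_vimage_algebra1)

lemma measurable_point_measure_spaceI: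
  assumes "\<And>x. x \<in> space N \<Longrightarrow> f x \<in> locally_finite_point_measures"
    and "\<And>B. B \<in> sets time_mark_space \<Longrightarrow> (\<lambda>x. emeasure (f x) B) \<in> borel_measurable N"
  shows "f \<in> N \<rightarrow>\<^sub>M point_measure_space"
  unfolding point_measure_space_def
  by (rule measurable_SUP2) (use assms in \<open>auto intro!: measurable_vimage_algebra2\<close>)

text \<open>
  The \<open>\<sigma>\<close>-algebra of the space of point measures makes the evaluations at sets measurable; the general case
  follows by monotone approximation.
\<close>

lemma measurable_nn_integral_point_measure [measurable]:
  assumes "g \<in> borel_measurable time_mark_space"
  shows "(\<lambda>m. \<integral>\<^sup>+ p. g p \<partial>m) \<in> borel_measurable point_measure_space"
  using assms
proof induct
  case (cong g h)
  have "(\<lambda>m. \<integral>\<^sup>+ p. g p \<partial>m) \<in> borel_measurable point_measure_space \<longleftrightarrow>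
      (\<lambda>m. \<integral>\<^sup>+ p. h p \<partial>m) \<in> borel_measurable point_measure_space"
    by (intro measurable_cong nn_integral_cong cong)
       (auto dest!: sets_of_point_measure sets_eq_imp_space_eq)
  with cong show ?case by simp
next
  case (set B)
  then have "(\<lambda>m. \<integral>\<^sup>+ p. indicator B p \<partial>m) \<in> borel_measurable point_measure_space \<longleftrightarrow>
      (\<lambda>m. emeasure m B) \<in> borel_measurable point_measure_space"
    by (intro measurable_cong) (simp add: sets_of_point_measure)
  with set show ?case by simp
next
  case (mult u c)
  then have "(\<lambda>m. \<integral>\<^sup>+ p. c * u p \<partial>m) \<in> borel_measurable point_measure_space \<longleftrightarrow>
      (\<lambda>m. c * \<integral>\<^sup>+ p. u p \<partial>m) \<in> borel_measurable point_measure_space"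
    by (intro measurable_cong nn_integral_cmult)
       (simp add: measurable_cong_sets[OF sets_of_point_measure refl])
  with mult show ?case by simp
next
  case (add u v)
  then have "(\<lambda>m. \<integral>\<^sup>+ p. v p + u p \<partial>m) \<in> borel_measurable point_measure_space \<longleftrightarrow>
      (\<lambda>m. (\<integral>\<^sup>+ p. v p \<partial>m) + (\<integral>\<^sup>+ p. u p \<partial>m)) \<in> borel_measurable point_measure_space"
    by (intro measurable_cong nn_integral_add)
       (simp_all add: measurable_cong_sets[OF sets_of_point_measure refl])
  with add show ?case by simp
next
  case (seq U)
  then have "(\<lambda>m. \<integral>\<^sup>+ p. (SUP i. U i) p \<partial>m) \<in> borel_measurable point_measure_space \<longleftrightarrow>
      (\<lambda>m. SUP i. \<integral>\<^sup>+ p. U i p \<partial>m) \<in> borel_measurable point_measure_space"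
    unfolding SUP_apply
    by (intro measurable_cong nn_integral_monotone_convergence_SUP)
       (simp_all add: measurable_cong_sets[OF sets_of_point_measure refl])
  with seq show ?case by simp
qed

context marked_poisson_cluster
begin

abbreviation "offspring \<equiv> offspring_process K T A"
abbreviation "immigrants \<equiv> immigrant_algebra M \<Gamma> A"

lemma offspring_points_measurable:
  assumes "\<omega> \<in> space M"
  shows "(\<lambda>j. (T i j \<omega>, A i j \<omega>)) \<in> count_space {1..K i \<omega>} \<rightarrow>\<^sub>M time_mark_space"
  using T_nonneg[OF assms] by (auto simp: space_time_mark_space)

lemma emeasure_offspring:
  assumes "\<omega> \<in> space M" "B \<in> sets time_mark_space"
  shows "emeasure (offspring i \<omega>) B = (\<Sum>j = 1..K i \<omega>. indicator B (T i j \<omega>, A i j \<omega>))"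
proof -
  have "emeasure (offspring i \<omega>) B = emeasure (count_space {1..K i \<omega>}) {j\<in>{1..K i \<omega>}. (T i j \<omega>, A i j \<omega>) \<in> B}"
    using offspring_points_measurable[OF assms(1)] assms(2)
    unfolding offspring_process_def dirac_sum_def
    by (subst emeasure_distr) (auto simp: vimage_def Int_def conj_commute intro!: arg_cong[where f = card])
  also have "\<dots> = of_nat (card {j\<in>{1..K i \<omega>}. (T i j \<omega>, A i j \<omega>) \<in> B})"
    by (subst emeasure_count_space_finite) auto
  also have "\<dots> = (\<Sum>j = 1..K i \<omega>. indicator B (T i j \<omega>, A i j \<omega>))"
    by (simp add: indicator_def sum.If_cases Int_def)
  finally show ?thesis .
qed

lemma nn_integral_offspring:
  assumes "\<omega> \<in> space M" "g \<in> borel_measurable time_mark_space"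
  shows "(\<integral>\<^sup>+ p. g p \<partial>offspring i \<omega>) = (\<Sum>j = 1..K i \<omega>. g (T i j \<omega>, A i j \<omega>))"
  using offspring_points_measurable[OF assms(1)] assms(2)
  unfolding offspring_process_def dirac_sum_def
  by (subst nn_integral_distr) (auto simp: nn_integral_count_space_finite)

lemma measurable_offspring [measurable]: "offspring i \<in> M \<rightarrow>\<^sub>M point_measure_space"
proof (rule measurable_point_measure_spaceI)
  fix \<omega> assume \<omega>: "\<omega> \<in> space M"
  have "(\<lambda>j. (T i j \<omega>, A i j \<omega>)) \<in> {1..K i \<omega>} \<rightarrow> space time_mark_space"
    using T_nonneg[OF \<omega>] by (auto simp: space_time_mark_space)
  moreover have "locally_finite_measure (offspring i \<omega>)"
    unfolding locally_finite_measure_def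
  proof (intro ballI exI conjI)
    have "space (offspring i \<omega>) = space time_mark_space"
      by (simp add: offspring_process_def dirac_sum_def)
    then show "emeasure (offspring i \<omega>) (UNIV \<inter> space (offspring i \<omega>)) < \<infinity>"
      by (simp add: emeasure_offspring[OF \<omega>] less_top[symmetric] split: split_indicator)
  qed auto
  ultimately show "offspring i \<omega> \<in> locally_finite_point_measures"
    unfolding locally_finite_point_measures_def offspring_process_def by blast
next
  fix B :: "(real \<times> 'a) set" assume B [measurable]: "B \<in> sets time_mark_space"
  have [measurable]: "(\<lambda>\<omega>. (max 0 (T i j \<omega>), A i j \<omega>)) \<in> M \<rightarrow>\<^sub>M time_mark_space" for j
    unfolding time_mark_space_def
    by (intro measurable_Pair measurable_restrict_space2) auto
  have "(\<lambda>\<omega>. \<Sum>j = 1..n. indicator B (max 0 (T i j \<omega>), A i j \<omega>) :: ennreal) \<in> borel_measurable M" for n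
    by measurable
  then have "(\<lambda>\<omega>. \<Sum>j = 1..K i \<omega>. indicator B (max 0 (T i j \<omega>), A i j \<omega>) :: ennreal) \<in> borel_measurable M"
    by (rule measurable_compose_countable[OF _ rv_K])
  also have "?this \<longleftrightarrow> (\<lambda>\<omega>. emeasure (offspring i \<omega>) B) \<in> borel_measurable M"
    by (intro measurable_cong) (auto simp: emeasure_offspring[OF _ B] max_absorb2 T_nonneg intro!: sum.cong)
  finally show "(\<lambda>\<omega>. emeasure (offspring i \<omega>) B) \<in> borel_measurable M" .
qed

lemma immigrant_point_measurable [measurable]: "(\<lambda>\<omega>. (\<Gamma> i \<omega>, A i 0 \<omega>)) \<in> M \<rightarrow>\<^sub>M time_mark_space"
  unfolding time_mark_space_def
  by (intro measurable_Pair measurable_restrict_space2) (auto simp: Gamma_nonneg)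

lemma space_immigrants [simp]: "space immigrants = space M"
  by (simp add: immigrant_algebra_def)

lemma subalgebra_immigrants: "subalgebra M immigrants"
  unfolding subalgebra_def
proof
  show "sets immigrants \<subseteq> events"
    unfolding immigrant_algebra_def
    by (rule sets_image_in_sets) (auto intro!: measurable_abs_UNIV immigrant_point_measurable)
qed simp

lemma immigrant_measurable:
  "\<Gamma> i \<in> borel_measurable immigrants" "A i 0 \<in> borel_measurable immigrants"
proof -
  have "(\<lambda>\<omega> i. (\<Gamma> i \<omega>, A i 0 \<omega>)) \<in> immigrants \<rightarrow>\<^sub>M (\<Pi>\<^sub>M i\<in>UNIV. time_mark_space)"
    unfolding immigrant_algebra_def
    by (rule measurable_vimage_algebra1) (auto simp: space_PiM space_time_mark_space Gamma_nonneg)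
  from measurable_compose[OF this measurable_component_singleton, of i]
  have *: "(\<lambda>\<omega>. (\<Gamma> i \<omega>, A i 0 \<omega>)) \<in> immigrants \<rightarrow>\<^sub>M time_mark_space" by simp
  have "(\<lambda>p. fst p) \<in> borel_measurable (time_mark_space :: (real \<times> 'a) measure)"
    unfolding time_mark_space_def
    by (rule measurable_compose[OF measurable_fst]) (simp add: measurable_restrict_space1)
  from measurable_compose[OF * this] show "\<Gamma> i \<in> borel_measurable immigrants" by simp
  have "(\<lambda>p. snd p) \<in> borel_measurable (time_mark_space :: (real \<times> 'a) measure)"
    unfolding time_mark_space_def by measurable
  from measurable_compose[OF * this] show "A i 0 \<in> borel_measurable immigrants" by simp
qed

lemma kernel_prob: "prob_space (\<K> x)" and sets_kernel: "sets (\<K> x) = sets point_measure_space"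
proof -
  have "\<K> x \<in> space (prob_algebra point_measure_space)"
    using kernel by (rule measurable_space) simp
  then show "prob_space (\<K> x)" "sets (\<K> x) = sets point_measure_space"
    by (auto simp: space_prob_algebra)
qed

lemma measurable_kernel_integral [measurable]:
  assumes "h \<in> borel_measurable point_measure_space"
  shows "(\<lambda>x. \<integral>\<^sup>+ m. h m \<partial>\<K> x) \<in> borel_measurable borel"
  by (rule measurable_compose[OF measurable_prob_algebraD[OF kernel]
        nn_integral_measurable_subprob_algebra[OF assms]])

text \<open>
  The characterisation of the conditional expectation, with a bounded weight \<open>W\<close> that depends only on the
  immigrants.
\<close>

lemma cond_indep_indicator:
  assumes J: "finite J" and B: "\<And>i. i \<in> J \<Longrightarrow> B i \<in> sets point_measure_space"
    and W: "W \<in> borel_measurable immigrants" "\<And>\<omega>. 0 \<le> W \<omega>" "\<And>\<omega>. W \<omega> \<le> 1"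
  shows "(\<integral>\<^sup>+ \<omega>. ennreal (W \<omega>) * (\<Prod>i\<in>J. indicator (B i) (offspring i \<omega>)) \<partial>M) =
    (\<integral>\<^sup>+ \<omega>. ennreal (W \<omega>) * (\<Prod>i\<in>J. \<integral>\<^sup>+ m. indicator (B i) m \<partial>\<K> (A i 0 \<omega>)) \<partial>M)"
proof -
  interpret S: finite_measure_subalgebra M immigrants
    by unfold_locales (rule subalgebra_immigrants)
  note WM [measurable] = measurable_from_subalg[OF subalgebra_immigrants W(1)]
  let ?E = "{\<omega>\<in>space M. \<forall>i\<in>J. offspring i \<omega> \<in> B i}"
  let ?k = "\<lambda>\<omega>. \<Prod>i\<in>J. measure (\<K> (A i 0 \<omega>)) (B i)"
  have E [measurable]: "?E \<in> events"
    using J B by (intro sets.sets_Collect_finite_All) (auto intro!: measurable_sets_Collect[OF measurable_offspring])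
  have emk: "(\<integral>\<^sup>+ m. indicator (B i) m \<partial>\<K> x) = ennreal (measure (\<K> x) (B i))" if "i \<in> J" for i x
  proof -
    interpret k: prob_space "\<K> x" by (rule kernel_prob)
    show ?thesis using B[OF that] by (simp add: sets_kernel k.emeasure_eq_measure)
  qed
  have km: "(\<lambda>\<omega>. measure (\<K> (A i 0 \<omega>)) (B i)) \<in> borel_measurable M" if "i \<in> J" for i
  proof -
    have "(\<lambda>x. enn2real (\<integral>\<^sup>+ m. indicator (B i) m \<partial>\<K> x)) \<in> borel_measurable borel"
      using B[OF that] by measurable
    then show ?thesis unfolding emk[OF that] by (simp add: measurable_compose[OF rv_A])
  qed
  have kM [measurable]: "?k \<in> borel_measurable M" using km by (rule borel_measurable_prod)
  have k1: "?k \<omega> \<le> 1" for \<omega>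
    by (intro prod_le_1) (auto intro: prob_space.prob_le_1 kernel_prob)
  have k0: "0 \<le> ?k \<omega>" for \<omega> by (intro prod_nonneg) auto
  have int: "integrable M (\<lambda>\<omega>. W \<omega> * indicator ?E \<omega>)"
    by (rule integrable_const_bound[of _ 1]) (use W in \<open>auto simp: indicator_def\<close>)
  have int2: "integrable M (\<lambda>\<omega>. W \<omega> * ?k \<omega>)"
    by (rule integrable_const_bound[of _ 1]) (use W k0 k1 in \<open>auto simp: abs_mult intro!: mult_le_one\<close>)
  have "(\<integral>\<^sup>+ \<omega>. ennreal (W \<omega>) * (\<Prod>i\<in>J. indicator (B i) (offspring i \<omega>)) \<partial>M) =
      (\<integral>\<^sup>+ \<omega>. ennreal (W \<omega> * indicator ?E \<omega>) \<partial>M)"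
  proof (rule nn_integral_cong)
    fix \<omega> assume "\<omega> \<in> space M"
    then have "(\<Prod>i\<in>J. indicator (B i) (offspring i \<omega>)) = (indicator ?E \<omega> :: ennreal)"
      using J by (auto simp: indicator_def prod_zero_iff split: if_splits)
    then show "ennreal (W \<omega>) * (\<Prod>i\<in>J. indicator (B i) (offspring i \<omega>)) = ennreal (W \<omega> * indicator ?E \<omega>)"
      by (simp add: indicator_def)
  qed
  also have "\<dots> = ennreal (\<integral>\<omega>. W \<omega> * indicator ?E \<omega> \<partial>M)"
    by (rule nn_integral_eq_integral[OF int]) (use W in auto)
  also have "(\<integral>\<omega>. W \<omega> * indicator ?E \<omega> \<partial>M) = (\<integral>\<omega>. W \<omega> * real_cond_exp M immigrants (indicator ?E) \<omega> \<partial>M)"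
    by (rule S.real_cond_exp_intg(2)[OF int, symmetric]) (use W in auto)
  also have "\<dots> = (\<integral>\<omega>. W \<omega> * ?k \<omega> \<partial>M)"
  proof (rule integral_cong_AE)
    have "AE \<omega> in M. real_cond_exp M immigrants (indicator ?E) \<omega> = ?k \<omega>"
      by (rule offspring_cond_indep) (use J B in auto)
    then show "AE \<omega> in M. W \<omega> * real_cond_exp M immigrants (indicator ?E) \<omega> = W \<omega> * ?k \<omega>"
      by eventually_elim simp
  qed auto
  also have "ennreal \<dots> = (\<integral>\<^sup>+ \<omega>. ennreal (W \<omega> * ?k \<omega>) \<partial>M)"
    by (rule nn_integral_eq_integral[OF int2, symmetric]) (use W k0 in auto)
  also have "\<dots> = (\<integral>\<^sup>+ \<omega>. ennreal (W \<omega>) * (\<Prod>i\<in>J. \<integral>\<^sup>+ m. indicator (B i) m \<partial>\<K> (A i 0 \<omega>)) \<partial>M)"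
  proof (rule nn_integral_cong)
    fix \<omega>
    have "(\<Prod>i\<in>J. \<integral>\<^sup>+ m. indicator (B i) m \<partial>\<K> (A i 0 \<omega>)) = (\<Prod>i\<in>J. ennreal (measure (\<K> (A i 0 \<omega>)) (B i)))"
      by (intro prod.cong emk) auto
    also have "\<dots> = ennreal (?k \<omega>)" by (rule prod_ennreal) simp
    finally show "ennreal (W \<omega> * ?k \<omega>) =
        ennreal (W \<omega>) * (\<Prod>i\<in>J. \<integral>\<^sup>+ m. indicator (B i) m \<partial>\<K> (A i 0 \<omega>))"
      using W by (simp add: ennreal_mult k0)
  qed
  finally show ?thesis .
qed

text \<open>
  The indicators are replaced by general functions one index at a time: \<open>L\<close> is the set of indices
  already treated. For fixed other factors both sides are integrals of the function at the new
  index, so agreement on indicators extends to all nonnegative measurable functions.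
\<close>

lemma cond_indep_partial:
  assumes J: "finite J"
    and W: "W \<in> borel_measurable immigrants" "\<And>\<omega>. 0 \<le> W \<omega>" "\<And>\<omega>. W \<omega> \<le> 1"
    and L: "finite L" "L \<subseteq> J" "\<And>i. i \<in> L \<Longrightarrow> h i \<in> borel_measurable point_measure_space"
    and ind: "\<And>i. i \<in> J - L \<Longrightarrow> \<exists>B\<in>sets point_measure_space. h i = indicator B"
  shows "(\<integral>\<^sup>+ \<omega>. ennreal (W \<omega>) * (\<Prod>i\<in>J. h i (offspring i \<omega>)) \<partial>M) =
    (\<integral>\<^sup>+ \<omega>. ennreal (W \<omega>) * (\<Prod>i\<in>J. \<integral>\<^sup>+ m. h i m \<partial>\<K> (A i 0 \<omega>)) \<partial>M)"
  using L ind
proof (induction L arbitrary: h)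
  case empty
  then obtain B where B: "\<And>i. i \<in> J \<Longrightarrow> B i \<in> sets point_measure_space" "\<And>i. i \<in> J \<Longrightarrow> h i = indicator (B i)"
    by (metis Diff_empty)
  have "(\<Prod>i\<in>J. h i (offspring i \<omega>)) = (\<Prod>i\<in>J. indicator (B i) (offspring i \<omega>))"
    "(\<Prod>i\<in>J. \<integral>\<^sup>+ m. h i m \<partial>\<K> (A i 0 \<omega>)) = (\<Prod>i\<in>J. \<integral>\<^sup>+ m. indicator (B i) m \<partial>\<K> (A i 0 \<omega>))" for \<omega>
    by (intro prod.cong; simp add: B)+
  then show ?case using cond_indep_indicator[OF J B(1) W] by simp
next
  case (insert l L)
  have l: "l \<in> J" "l \<notin> L" using insert by auto
  have hm: "h i \<in> borel_measurable point_measure_space" if iJ: "i \<in> J" for i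
  proof (cases "i \<in> insert l L")
    case False
    then obtain B where "B \<in> sets point_measure_space" "h i = indicator B"
      using insert.prems(3)[of i] iJ by auto
    then show ?thesis by simp
  qed (use insert in auto)
  note WM [measurable] = measurable_from_subalg[OF subalgebra_immigrants W(1)]
  define R1 where "R1 \<omega> = ennreal (W \<omega>) * (\<Prod>i\<in>J - {l}. h i (offspring i \<omega>))" for \<omega>
  define R2 where "R2 \<omega> = ennreal (W \<omega>) * (\<Prod>i\<in>J - {l}. \<integral>\<^sup>+ m. h i m \<partial>\<K> (A i 0 \<omega>))" for \<omega>
  have R1 [measurable]: "R1 \<in> borel_measurable M"
    unfolding R1_def
    by (intro borel_measurable_times_ennreal borel_measurable_prod_ennreal measurable_compose[OF measurable_offspring hm])
       auto
  have R2 [measurable]: "R2 \<in> borel_measurable M"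
    unfolding R2_def
    by (intro borel_measurable_times_ennreal borel_measurable_prod_ennreal
        measurable_compose[OF rv_A measurable_kernel_integral[OF hm]])
       auto
  have key: "(\<integral>\<^sup>+ \<omega>. R1 \<omega> * u (offspring l \<omega>) \<partial>M) = (\<integral>\<^sup>+ \<omega>. R2 \<omega> * (\<integral>\<^sup>+ m. u m \<partial>\<K> (A l 0 \<omega>)) \<partial>M)"
    if "u \<in> borel_measurable point_measure_space" for u
    using that
  proof induct
    case (cong f g)
    have "(\<integral>\<^sup>+ \<omega>. R1 \<omega> * f (offspring l \<omega>) \<partial>M) = (\<integral>\<^sup>+ \<omega>. R1 \<omega> * g (offspring l \<omega>) \<partial>M)"
      by (intro nn_integral_cong) (simp add: cong(3) measurable_space[OF measurable_offspring])
    moreover have "(\<integral>\<^sup>+ m. f m \<partial>\<K> x) = (\<integral>\<^sup>+ m. g m \<partial>\<K> x)" for x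
      by (intro nn_integral_cong cong(3)) (simp add: sets_eq_imp_space_eq[OF sets_kernel])
    ultimately show ?case using cong by simp
  next
    case (set B)
    let ?h = "h(l := indicator B)"
    have IH: "(\<integral>\<^sup>+ \<omega>. ennreal (W \<omega>) * (\<Prod>i\<in>J. ?h i (offspring i \<omega>)) \<partial>M) =
      (\<integral>\<^sup>+ \<omega>. ennreal (W \<omega>) * (\<Prod>i\<in>J. \<integral>\<^sup>+ m. ?h i m \<partial>\<K> (A i 0 \<omega>)) \<partial>M)"
      by (rule insert.IH) (use insert.prems set l in auto)
    have p1: "(\<Prod>i\<in>J. ?h i (offspring i \<omega>)) = indicator B (offspring l \<omega>) * (\<Prod>i\<in>J - {l}. h i (offspring i \<omega>))" for \<omega>
      by (subst prod.remove[OF J l(1)]) (auto intro!: arg_cong2[where f = times] prod.cong)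
    have p2: "(\<Prod>i\<in>J. \<integral>\<^sup>+ m. ?h i m \<partial>\<K> (A i 0 \<omega>)) =
        (\<integral>\<^sup>+ m. indicator B m \<partial>\<K> (A l 0 \<omega>)) * (\<Prod>i\<in>J - {l}. \<integral>\<^sup>+ m. h i m \<partial>\<K> (A i 0 \<omega>))" for \<omega>
      by (subst prod.remove[OF J l(1)]) (auto intro!: arg_cong2[where f = times] prod.cong)
    show ?case using IH unfolding p1 p2 R1_def R2_def by (simp only: mult_ac)
  next
    case (mult u c)
    have "(\<integral>\<^sup>+ \<omega>. R1 \<omega> * (c * u (offspring l \<omega>)) \<partial>M) = c * (\<integral>\<^sup>+ \<omega>. R1 \<omega> * u (offspring l \<omega>) \<partial>M)"
      using mult(2) by (subst nn_integral_cmult[symmetric]) (auto simp: mult_ac)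
    also have "\<dots> = c * (\<integral>\<^sup>+ \<omega>. R2 \<omega> * (\<integral>\<^sup>+ m. u m \<partial>\<K> (A l 0 \<omega>)) \<partial>M)" by (simp only: mult)
    also have "\<dots> = (\<integral>\<^sup>+ \<omega>. R2 \<omega> * (c * (\<integral>\<^sup>+ m. u m \<partial>\<K> (A l 0 \<omega>))) \<partial>M)"
      using mult(2) by (subst nn_integral_cmult[symmetric]) (auto simp: mult_ac)
    also have "\<dots> = (\<integral>\<^sup>+ \<omega>. R2 \<omega> * (\<integral>\<^sup>+ m. c * u m \<partial>\<K> (A l 0 \<omega>)) \<partial>M)"
      using mult(2) by (subst nn_integral_cmult) (simp_all add: measurable_cong_sets[OF sets_kernel refl])
    finally show ?case .
  next
    case (add u v)
    have "(\<integral>\<^sup>+ m. v m + u m \<partial>\<K> x) = (\<integral>\<^sup>+ m. v m \<partial>\<K> x) + (\<integral>\<^sup>+ m. u m \<partial>\<K> x)" for x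
      using add by (intro nn_integral_add) (simp_all add: measurable_cong_sets[OF sets_kernel refl])
    then show ?case
      using add by (simp add: distrib_left nn_integral_add)
  next
    case (seq U)
    have "(\<integral>\<^sup>+ m. (SUP i. U i m) \<partial>\<K> x) = (SUP i. \<integral>\<^sup>+ m. U i m \<partial>\<K> x)" for x
      using seq by (intro nn_integral_monotone_convergence_SUP)
        (simp_all add: measurable_cong_sets[OF sets_kernel refl])
    moreover have "incseq (\<lambda>i \<omega>. R1 \<omega> * U i (offspring l \<omega>))"
      using seq(4) by (auto simp: mono_def le_fun_def intro!: mult_left_mono)
    moreover have "incseq (\<lambda>i \<omega>. R2 \<omega> * (\<integral>\<^sup>+ m. U i m \<partial>\<K> (A l 0 \<omega>)))"
      using seq(4) by (auto simp: mono_def le_fun_def intro!: mult_left_mono nn_integral_mono)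
    ultimately show ?case
      using seq(1,3) by (simp add: SUP_mult_left_ennreal nn_integral_monotone_convergence_SUP image_comp)
  qed
  have "(\<integral>\<^sup>+ \<omega>. ennreal (W \<omega>) * (\<Prod>i\<in>J. h i (offspring i \<omega>)) \<partial>M) = (\<integral>\<^sup>+ \<omega>. R1 \<omega> * h l (offspring l \<omega>) \<partial>M)"
    unfolding R1_def by (intro nn_integral_cong) (subst prod.remove[OF J l(1)], simp only: mult_ac)
  also have "\<dots> = (\<integral>\<^sup>+ \<omega>. R2 \<omega> * (\<integral>\<^sup>+ m. h l m \<partial>\<K> (A l 0 \<omega>)) \<partial>M)"
    by (rule key[OF hm[OF l(1)]])
  also have "\<dots> = (\<integral>\<^sup>+ \<omega>. ennreal (W \<omega>) * (\<Prod>i\<in>J. \<integral>\<^sup>+ m. h i m \<partial>\<K> (A i 0 \<omega>)) \<partial>M)"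
    unfolding R2_def by (intro nn_integral_cong) (subst prod.remove[OF J l(1)], simp only: mult_ac)
  finally show ?case .
qed

theorem cond_indep_product:
  assumes J: "finite J"
    and W: "W \<in> borel_measurable immigrants" "\<And>\<omega>. 0 \<le> W \<omega>" "\<And>\<omega>. W \<omega> \<le> 1"
    and h: "\<And>i. i \<in> J \<Longrightarrow> h i \<in> borel_measurable point_measure_space"
  shows "(\<integral>\<^sup>+ \<omega>. ennreal (W \<omega>) * (\<Prod>i\<in>J. h i (offspring i \<omega>)) \<partial>M) =
    (\<integral>\<^sup>+ \<omega>. ennreal (W \<omega>) * (\<Prod>i\<in>J. \<integral>\<^sup>+ m. h i m \<partial>\<K> (A i 0 \<omega>)) \<partial>M)"
  by (rule cond_indep_partial[OF J W J]) (use h in auto)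

end

section \<open>Laplace transform of the aggregated clusters\<close>

lemma infsum_eq_lebesgue_integral_count_space:
  fixes c :: "'b \<Rightarrow> real"
  shows "infsum c X = (\<integral>x. c x \<partial>count_space X)"
proof (cases "c summable_on X")
  case True
  then have "(\<lambda>x. norm (c x)) summable_on X" using summable_on_iff_abs_summable_on_real by blast
  then have "Infinite_Set_Sum.abs_summable_on c X" by (simp only: abs_summable_equivalent)
  then have "infsetsum c X = infsum c X" by (rule infsetsum_infsum)
  then show ?thesis by (simp only: infsetsum_def)
next
  case False
  then have "\<not> (\<lambda>x. norm (c x)) summable_on X" using summable_on_iff_abs_summable_on_real by blast
  then have "\<not> Infinite_Set_Sum.abs_summable_on c X"
    by (simp only: abs_summable_equivalent not_False_eq_True)
  then have "\<not> integrable (count_space X) c" by (simp add: Infinite_Set_Sum.abs_summable_on_def)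
  then have "(\<integral>x. c x \<partial>count_space X) = 0" by (rule not_integrable_integral_eq)
  with infsum_not_exists[OF False] show ?thesis by simp
qed

lemma measurable_nn_integral_count_space_prod:
  fixes c :: "nat \<times> nat \<Rightarrow> 'b \<Rightarrow> ennreal"
  assumes "\<And>p. c p \<in> borel_measurable N"
  shows "(\<lambda>\<omega>. \<integral>\<^sup>+ p. c p \<omega> \<partial>count_space UNIV) \<in> borel_measurable N"
proof -
  have "(\<integral>\<^sup>+ p. c p \<omega> \<partial>count_space UNIV) = (\<Sum>n. c (prod_decode n) \<omega>)" for \<omega>
    using nn_integral_bij_count_space[OF bij_prod_decode, of "\<lambda>p. c p \<omega>"]
    by (simp add: nn_integral_count_space_nat)
  with assms show ?thesis by simp
qed

context marked_poisson_cluster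
begin

text \<open>
  The conditional Laplace transform at \<open>u\<close> of the total of a cluster whose immigrant has mark \<open>x\<close>. The
  conversion \<^const>\<open>enn2real\<close> inside the exponential sends an infinite sum of claims to \<open>0\<close>; the
  clusters are finite point measures and are not affected.
\<close>

definition cluster_kernel :: "('a \<Rightarrow> real) \<Rightarrow> real \<Rightarrow> 'a \<Rightarrow> real" where
  "cluster_kernel f u x = exp (- u * f x) *
     enn2real (\<integral>\<^sup>+ m. ennreal (exp (- u * enn2real (\<integral>\<^sup>+ p. ennreal (f (snd p)) \<partial>m))) \<partial>\<K> x)"

context
  fixes f :: "'a \<Rightarrow> real"
  assumes f_meas [measurable]: "f \<in> borel_measurable borel" and f_nonneg: "\<And>x. 0 \<le> f x"
begin

lemma f_snd_measurable [measurable]: "(\<lambda>p. f (snd p)) \<in> borel_measurable (time_mark_space :: (real \<times> 'a) measure)"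
  unfolding time_mark_space_def by measurable

lemma cluster_total_eq:
  assumes "\<omega> \<in> space M"
  shows "cluster_total f K A i \<omega> = f (A i 0 \<omega>) + enn2real (\<integral>\<^sup>+ p. ennreal (f (snd p)) \<partial>offspring i \<omega>)"
proof -
  have "(\<integral>\<^sup>+ p. ennreal (f (snd p)) \<partial>offspring i \<omega>) = (\<Sum>j = 1..K i \<omega>. ennreal (f (A i j \<omega>)))"
    by (subst nn_integral_offspring[OF assms]) auto
  also have "\<dots> = ennreal (\<Sum>j = 1..K i \<omega>. f (A i j \<omega>))"
    by (rule sum_ennreal) (rule f_nonneg)
  finally have "enn2real (\<integral>\<^sup>+ p. ennreal (f (snd p)) \<partial>offspring i \<omega>) = (\<Sum>j = 1..K i \<omega>. f (A i j \<omega>))"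
    by (simp only: enn2real_ennreal sum_nonneg f_nonneg)
  moreover have "(\<Sum>j = 0..K i \<omega>. f (A i j \<omega>)) = f (A i 0 \<omega>) + (\<Sum>j = 1..K i \<omega>. f (A i j \<omega>))"
    by (subst sum.atLeast_Suc_atMost) auto
  ultimately show ?thesis by (simp only: cluster_total_def)
qed

lemma cluster_total_nonneg: "0 \<le> cluster_total f K A i \<omega>"
  by (simp add: cluster_total_def sum_nonneg f_nonneg)

lemma measurable_cluster_total [measurable]: "cluster_total f K A i \<in> borel_measurable M"
  unfolding cluster_total_def
  by (rule measurable_compose_countable[where f = "\<lambda>n \<omega>. \<Sum>j = 0..n. f (A i j \<omega>)", OF _ rv_K]) measurable

lemma offspring_functional_measurable [measurable]:
  "(\<lambda>m. ennreal (exp (- u * enn2real (\<integral>\<^sup>+ p. ennreal (f (snd p)) \<partial>m)))) \<in> borel_measurable point_measure_space"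
proof -
  have "(\<lambda>m. \<integral>\<^sup>+ p. ennreal (f (snd p)) \<partial>m) \<in> borel_measurable point_measure_space"
    by (rule measurable_nn_integral_point_measure) measurable
  then show ?thesis by measurable
qed

lemma measurable_cluster_kernel [measurable]: "cluster_kernel f u \<in> borel_measurable borel"
  unfolding cluster_kernel_def[abs_def]
proof (rule borel_measurable_times)
  show "(\<lambda>x. exp (- u * f x)) \<in> borel_measurable borel" by measurable
qed (rule borel_measurable_enn2real[OF measurable_kernel_integral[OF offspring_functional_measurable]])

lemma kernel_integral_le_1:
  assumes "0 \<le> u"
  shows "(\<integral>\<^sup>+ m. ennreal (exp (- u * enn2real (\<integral>\<^sup>+ p. ennreal (f (snd p)) \<partial>m))) \<partial>\<K> x) \<le> 1"
proof -
  interpret k: prob_space "\<K> x" by (rule kernel_prob)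
  have "(\<integral>\<^sup>+ m. ennreal (exp (- u * enn2real (\<integral>\<^sup>+ p. ennreal (f (snd p)) \<partial>m))) \<partial>\<K> x) \<le> (\<integral>\<^sup>+ m. 1 \<partial>\<K> x)"
    by (intro nn_integral_mono) (use assms in auto)
  then show ?thesis by (simp add: k.emeasure_space_1)
qed

lemma cluster_kernel_bounds: "0 \<le> cluster_kernel f u x" "0 \<le> u \<Longrightarrow> cluster_kernel f u x \<le> 1"
proof -
  show "0 \<le> cluster_kernel f u x" by (simp add: cluster_kernel_def)
  assume u: "0 \<le> u"
  have "enn2real (\<integral>\<^sup>+ m. ennreal (exp (- u * enn2real (\<integral>\<^sup>+ p. ennreal (f (snd p)) \<partial>m))) \<partial>\<K> x) \<le> 1"
    using enn2real_mono[OF kernel_integral_le_1[OF u]] by simp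
  then show "cluster_kernel f u x \<le> 1"
    unfolding cluster_kernel_def using u f_nonneg by (intro mult_le_one) auto
qed

lemma cond_Laplace_clusters:
  assumes J: "finite J" and u: "0 \<le> u"
    and W: "W \<in> borel_measurable immigrants" "\<And>\<omega>. 0 \<le> W \<omega>" "\<And>\<omega>. W \<omega> \<le> 1"
  shows "(\<integral>\<^sup>+ \<omega>. ennreal (W \<omega>) * ennreal (\<Prod>i\<in>J. exp (- u * cluster_total f K A i \<omega>)) \<partial>M) =
    (\<integral>\<^sup>+ \<omega>. ennreal (W \<omega>) * ennreal (\<Prod>i\<in>J. cluster_kernel f u (A i 0 \<omega>)) \<partial>M)"
proof -
  let ?h = "\<lambda>m. ennreal (exp (- u * enn2real (\<integral>\<^sup>+ p. ennreal (f (snd p)) \<partial>m)))"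
  let ?E = "\<lambda>\<omega>. \<Prod>i\<in>J. exp (- u * f (A i 0 \<omega>))"
  define V where "V \<omega> = W \<omega> * ?E \<omega>" for \<omega>
  have E: "0 \<le> ?E \<omega>" "?E \<omega> \<le> 1" for \<omega>
    using u f_nonneg by (auto intro!: prod_nonneg prod_le_1)
  have V: "V \<in> borel_measurable immigrants" "0 \<le> V \<omega>" "V \<omega> \<le> 1" for \<omega>
  proof -
    have "(\<lambda>\<omega>. exp (- u * f (A i 0 \<omega>))) \<in> borel_measurable immigrants" for i
      by (rule measurable_compose[OF immigrant_measurable(2)]) measurable
    with W(1) show "V \<in> borel_measurable immigrants" unfolding V_def by measurable
    show "0 \<le> V \<omega>" "V \<omega> \<le> 1"
      unfolding V_def using W E by (auto intro: mult_le_one)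
  qed
  have "(\<integral>\<^sup>+ \<omega>. ennreal (W \<omega>) * ennreal (\<Prod>i\<in>J. exp (- u * cluster_total f K A i \<omega>)) \<partial>M) =
      (\<integral>\<^sup>+ \<omega>. ennreal (V \<omega>) * (\<Prod>i\<in>J. ?h (offspring i \<omega>)) \<partial>M)"
  proof (rule nn_integral_cong)
    fix \<omega> assume \<omega>: "\<omega> \<in> space M"
    have "(\<Prod>i\<in>J. exp (- u * cluster_total f K A i \<omega>)) =
        ?E \<omega> * (\<Prod>i\<in>J. exp (- u * enn2real (\<integral>\<^sup>+ p. ennreal (f (snd p)) \<partial>offspring i \<omega>)))"
      unfolding cluster_total_eq[OF \<omega>] prod.distrib[symmetric]
      by (simp add: exp_add[symmetric] distrib_left)
    then show "ennreal (W \<omega>) * ennreal (\<Prod>i\<in>J. exp (- u * cluster_total f K A i \<omega>)) =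
        ennreal (V \<omega>) * (\<Prod>i\<in>J. ?h (offspring i \<omega>))"
      using W E by (simp add: V_def prod_ennreal ennreal_mult prod_nonneg mult.assoc)
  qed
  also have "\<dots> = (\<integral>\<^sup>+ \<omega>. ennreal (V \<omega>) * (\<Prod>i\<in>J. \<integral>\<^sup>+ m. ?h m \<partial>\<K> (A i 0 \<omega>)) \<partial>M)"
    by (rule cond_indep_product[OF J V]) measurable
  also have "\<dots> = (\<integral>\<^sup>+ \<omega>. ennreal (W \<omega>) * ennreal (\<Prod>i\<in>J. cluster_kernel f u (A i 0 \<omega>)) \<partial>M)"
  proof (rule nn_integral_cong)
    fix \<omega> assume \<omega>: "\<omega> \<in> space M"
    have fin: "(\<integral>\<^sup>+ m. ?h m \<partial>\<K> x) = ennreal (enn2real (\<integral>\<^sup>+ m. ?h m \<partial>\<K> x))" for x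
      using order_le_less_trans[OF kernel_integral_le_1[OF u, of x]] by simp
    have "(\<Prod>i\<in>J. \<integral>\<^sup>+ m. ?h m \<partial>\<K> (A i 0 \<omega>)) = ennreal (\<Prod>i\<in>J. enn2real (\<integral>\<^sup>+ m. ?h m \<partial>\<K> (A i 0 \<omega>)))"
      by (subst fin) (simp add: prod_ennreal)
    then show "ennreal (V \<omega>) * (\<Prod>i\<in>J. \<integral>\<^sup>+ m. ?h m \<partial>\<K> (A i 0 \<omega>)) =
        ennreal (W \<omega>) * ennreal (\<Prod>i\<in>J. cluster_kernel f u (A i 0 \<omega>))"
      using W E by (simp add: V_def cluster_kernel_def prod.distrib ennreal_mult prod_nonneg mult.assoc)
  qed
  finally show ?thesis .
qed

lemma Laplace_cluster_total:
  assumes u: "0 \<le> u"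
  shows "(\<integral>\<omega>. exp (- u * cluster_total f K A 0 \<omega>) \<partial>M) = (\<integral>x. cluster_kernel f u x \<partial>Q)"
proof -
  have "(\<integral>\<^sup>+ \<omega>. ennreal (exp (- u * cluster_total f K A 0 \<omega>)) \<partial>M) =
      (\<integral>\<^sup>+ \<omega>. ennreal (cluster_kernel f u (A 0 0 \<omega>)) \<partial>M)"
    using cond_Laplace_clusters[of "{0}" u "\<lambda>_. 1"] u by simp
  also have "\<dots> = (\<integral>\<^sup>+ x. ennreal (cluster_kernel f u x) \<partial>distr M borel (A 0 0))"
    by (subst nn_integral_distr) auto
  finally have "(\<integral>\<^sup>+ \<omega>. ennreal (exp (- u * cluster_total f K A 0 \<omega>)) \<partial>M) =
      (\<integral>\<^sup>+ x. ennreal (cluster_kernel f u x) \<partial>Q)" by (simp add: distr_first_mark)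
  moreover have "cluster_kernel f u \<in> borel_measurable Q"
    by (simp add: measurable_cong_sets[OF sets_Q refl])
  ultimately show ?thesis
    by (subst (1 2) integral_eq_nn_integral) (auto simp: cluster_kernel_bounds)
qed

lemma nn_integral_split_arrivals:
  assumes "\<And>n. Y n \<in> borel_measurable M"
  shows "(\<integral>\<^sup>+ \<omega>. Y (arrivals t \<omega>) \<omega> \<partial>M) =
    (\<Sum>n. \<integral>\<^sup>+ \<omega>. ennreal (indicator {\<omega>\<in>space M. arrivals t \<omega> = n} \<omega>) * Y n \<omega> \<partial>M)"
proof -
  have "(\<integral>\<^sup>+ \<omega>. Y (arrivals t \<omega>) \<omega> \<partial>M) =
      (\<integral>\<^sup>+ \<omega>. (\<Sum>n. ennreal (indicator {\<omega>\<in>space M. arrivals t \<omega> = n} \<omega>) * Y n \<omega>) \<partial>M)"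
  proof (rule nn_integral_cong)
    fix \<omega> assume "\<omega> \<in> space M"
    then have "(\<Sum>n. ennreal (indicator {\<omega>\<in>space M. arrivals t \<omega> = n} \<omega>) * Y n \<omega>) =
       (\<Sum>n\<in>{arrivals t \<omega>}. ennreal (indicator {\<omega>\<in>space M. arrivals t \<omega> = n} \<omega>) * Y n \<omega>)"
      by (intro suminf_finite) (auto simp: indicator_def)
    also have "\<dots> = Y (arrivals t \<omega>) \<omega>" using \<open>\<omega> \<in> space M\<close> by simp
    finally show "Y (arrivals t \<omega>) \<omega> =
        (\<Sum>n. ennreal (indicator {\<omega>\<in>space M. arrivals t \<omega> = n} \<omega>) * Y n \<omega>)" ..
  qed
  also have "\<dots> = (\<Sum>n. \<integral>\<^sup>+ \<omega>. ennreal (indicator {\<omega>\<in>space M. arrivals t \<omega> = n} \<omega>) * Y n \<omega> \<partial>M)"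
    using assms by (intro nn_integral_suminf) measurable
  finally show ?thesis .
qed

lemma measurable_sum_arrivals [measurable]:
  "(\<lambda>\<omega>. \<Sum>i<arrivals t \<omega>. cluster_total f K A i \<omega>) \<in> borel_measurable M"
  by (rule measurable_compose_countable[where f = "\<lambda>n \<omega>. \<Sum>i<n. cluster_total f K A i \<omega>" and g = "arrivals t"])
     measurable

text \<open>
  Split according to the number of arrivals, which depends on the immigrants only. On each part
  conditional independence replaces the factor of a cluster by \<^const>\<open>cluster_kernel\<close> at its mark; put
  together again, the parts form a product over a Poisson number of marks.
\<close>

theorem Laplace_aggregate:
  assumes t: "0 \<le> t" and u: "0 \<le> u"
  shows "(\<integral>\<omega>. exp (- u * (\<Sum>i<arrivals t \<omega>. cluster_total f K A i \<omega>)) \<partial>M) =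
    exp (- (\<nu> * t * (1 - (\<integral>\<omega>. exp (- u * cluster_total f K A 0 \<omega>) \<partial>M))))"
proof -
  have W: "(indicator {\<omega>\<in>space M. arrivals t \<omega> = n} :: 'w \<Rightarrow> real) \<in> borel_measurable immigrants" for n
  proof -
    note immigrant_measurable [measurable]
    have "arrivals t \<in> immigrants \<rightarrow>\<^sub>M count_space UNIV"
      unfolding arrivals_def by measurable
    then have "{\<omega>\<in>space immigrants. arrivals t \<omega> = n} \<in> sets immigrants" by measurable
    then show ?thesis by simp
  qed
  have "(\<integral>\<^sup>+ \<omega>. ennreal (exp (- u * (\<Sum>i<arrivals t \<omega>. cluster_total f K A i \<omega>))) \<partial>M) =
      (\<integral>\<^sup>+ \<omega>. ennreal (\<Prod>i<arrivals t \<omega>. exp (- u * cluster_total f K A i \<omega>)) \<partial>M)"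
    by (simp add: exp_sum sum_distrib_left sum_negf[symmetric])
  also have "\<dots> = (\<Sum>n. \<integral>\<^sup>+ \<omega>. ennreal (indicator {\<omega>\<in>space M. arrivals t \<omega> = n} \<omega>) *
      ennreal (\<Prod>i<n. exp (- u * cluster_total f K A i \<omega>)) \<partial>M)"
    by (rule nn_integral_split_arrivals) measurable
  also have "\<dots> = (\<Sum>n. \<integral>\<^sup>+ \<omega>. ennreal (indicator {\<omega>\<in>space M. arrivals t \<omega> = n} \<omega>) *
      ennreal (\<Prod>i<n. cluster_kernel f u (A i 0 \<omega>)) \<partial>M)"
    by (intro suminf_cong cond_Laplace_clusters W u) (auto simp: indicator_def)
  also have "\<dots> = (\<integral>\<^sup>+ \<omega>. ennreal (\<Prod>i<arrivals t \<omega>. cluster_kernel f u (A i 0 \<omega>)) \<partial>M)"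
    by (rule nn_integral_split_arrivals[symmetric]) measurable
  also have "\<dots> = ennreal (exp (- (\<nu> * t * (1 - (\<integral>x. cluster_kernel f u x \<partial>Q)))))"
    by (rule poisson_product) (use t u cluster_kernel_bounds in auto)
  finally show ?thesis
    unfolding Laplace_cluster_total[OF u] by (subst integral_eq_nn_integral) auto
qed

text \<open>
  The contributions of the point \<open>(i, j)\<close> to \<open>S(t)\<close> and, below, to the residue at time \<open>t\<close>. They are
  functions on a fixed countable index set, so that both totals are seen to be measurable on the
  whole probability space and not only almost everywhere.
\<close>

definition settled_claim :: "real \<Rightarrow> 'w \<Rightarrow> nat \<times> nat \<Rightarrow> real" where
  "settled_claim t \<omega> = (\<lambda>(i, j). if j \<le> K i \<omega> \<and> \<Gamma> i \<omega> + T i j \<omega> \<le> t then f (A i j \<omega>) else 0)"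

definition pending_claim :: "real \<Rightarrow> 'w \<Rightarrow> nat \<times> nat \<Rightarrow> real" where
  "pending_claim t \<omega> = (\<lambda>(i, j). if 1 \<le> j \<and> j \<le> K i \<omega> \<and> \<Gamma> i \<omega> \<le> t \<and> t < \<Gamma> i \<omega> + T i j \<omega>
     then f (A i j \<omega>) else 0)"

lemma claims_nonneg: "0 \<le> settled_claim t \<omega> p" "0 \<le> pending_claim t \<omega> p"
  by (auto simp: settled_claim_def pending_claim_def f_nonneg split: prod.split)

lemma measurable_claims:
  "(\<lambda>\<omega>. settled_claim t \<omega> p) \<in> borel_measurable M" "(\<lambda>\<omega>. pending_claim t \<omega> p) \<in> borel_measurable M"
  by (cases p; simp add: settled_claim_def pending_claim_def)+

lemma total_claim_eq_nn_integral:
  assumes "\<omega> \<in> space M"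
  shows "total_claim f \<Gamma> K T A t \<omega> = enn2real (\<integral>\<^sup>+ p. ennreal (settled_claim t \<omega> p) \<partial>count_space UNIV)"
proof -
  let ?I = "{(i, j). j \<le> K i \<omega>}"
  let ?x = "\<lambda>(i, j). (\<Gamma> i \<omega> + T i j \<omega>, A i j \<omega>)"
  let ?B = "{0..t} \<times> (UNIV :: 'a set)"
  have x: "?x \<in> count_space ?I \<rightarrow>\<^sub>M time_mark_space"
    using T_nonneg[OF assms] Gamma_nonneg[OF assms] by (auto simp: space_time_mark_space)
  have [measurable]: "?B \<in> sets time_mark_space" by (rule Times_in_time_mark_space) auto
  have "total_claim f \<Gamma> K T A t \<omega> = (\<integral>p. indicator ?B p * f (snd p) \<partial>distr (count_space ?I) time_mark_space ?x)"
    unfolding total_claim_def cluster_process_def dirac_sum_def set_lebesgue_integral_def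
    by (simp add: case_prod_beta)
  also have "\<dots> = (\<integral>p. indicator ?B (?x p) * f (snd (?x p)) \<partial>count_space ?I)"
    by (rule integral_distr[OF x]) measurable
  also have "\<dots> = (\<integral>p. indicator ?I p *\<^sub>R (indicator ?B (?x p) * f (snd (?x p))) \<partial>count_space UNIV)"
    by (subst integral_restrict_space[symmetric]) (auto simp: restrict_count_space)
  also have "\<dots> = (\<integral>p. settled_claim t \<omega> p \<partial>count_space UNIV)"
    using T_nonneg[OF assms] Gamma_nonneg[OF assms]
    by (intro Bochner_Integration.integral_cong)
       (auto simp: settled_claim_def indicator_def split: prod.split)
  also have "\<dots> = enn2real (\<integral>\<^sup>+ p. ennreal (settled_claim t \<omega> p) \<partial>count_space UNIV)"
    by (rule integral_eq_nn_integral) (auto simp: claims_nonneg)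
  finally show ?thesis .
qed

lemma residue_eq_nn_integral:
  assumes "\<omega> \<in> space M"
  shows "residue_at f \<Gamma> K T A t \<omega> = enn2real (\<integral>\<^sup>+ p. ennreal (pending_claim t \<omega> p) \<partial>count_space UNIV)"
proof -
  have "residue_at f \<Gamma> K T A t \<omega> = infsum (pending_claim t \<omega>) UNIV"
    unfolding residue_at_def
    by (rule infsum_cong_neutral)
       (auto simp: pending_claim_def Gamma_nonneg[OF assms] split: if_splits)
  also have "\<dots> = (\<integral>p. pending_claim t \<omega> p \<partial>count_space UNIV)"
    by (rule infsum_eq_lebesgue_integral_count_space)
  also have "\<dots> = enn2real (\<integral>\<^sup>+ p. ennreal (pending_claim t \<omega> p) \<partial>count_space UNIV)"
    by (rule integral_eq_nn_integral) (auto simp: claims_nonneg)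
  finally show ?thesis .
qed

lemma measurable_total_claim [measurable]: "total_claim f \<Gamma> K T A t \<in> borel_measurable M"
proof -
  have "(\<lambda>\<omega>. \<integral>\<^sup>+ p. ennreal (settled_claim t \<omega> p) \<partial>count_space UNIV) \<in> borel_measurable M"
    by (intro measurable_nn_integral_count_space_prod measurable_compose[OF measurable_claims(1) measurable_ennreal])
  then have "(\<lambda>\<omega>. enn2real (\<integral>\<^sup>+ p. ennreal (settled_claim t \<omega> p) \<partial>count_space UNIV)) \<in> borel_measurable M"
    by (rule borel_measurable_enn2real)
  also have "?this \<longleftrightarrow> total_claim f \<Gamma> K T A t \<in> borel_measurable M"
    by (rule measurable_cong[symmetric]) (rule total_claim_eq_nn_integral)
  finally show ?thesis .
qed

lemma measurable_residue [measurable]: "residue_at f \<Gamma> K T A t \<in> borel_measurable M"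
proof -
  have "(\<lambda>\<omega>. \<integral>\<^sup>+ p. ennreal (pending_claim t \<omega> p) \<partial>count_space UNIV) \<in> borel_measurable M"
    by (intro measurable_nn_integral_count_space_prod measurable_compose[OF measurable_claims(2) measurable_ennreal])
  then have "(\<lambda>\<omega>. enn2real (\<integral>\<^sup>+ p. ennreal (pending_claim t \<omega> p) \<partial>count_space UNIV)) \<in> borel_measurable M"
    by (rule borel_measurable_enn2real)
  also have "?this \<longleftrightarrow> residue_at f \<Gamma> K T A t \<in> borel_measurable M"
    by (rule measurable_cong[symmetric]) (rule residue_eq_nn_integral)
  finally show ?thesis .
qed

text \<open>
  An immigrant point is never in the residue, as its delay is zero. So each point of a cluster that started
  by time \<open>t\<close> contributes to exactly one of the two sums, which are finite almost surely.
\<close>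

lemma total_claim_plus_residue:
  assumes t: "0 \<le> t"
  shows "AE \<omega> in M. total_claim f \<Gamma> K T A t \<omega> + residue_at f \<Gamma> K T A t \<omega> =
    (\<Sum>i<arrivals t \<omega>. cluster_total f K A i \<omega>)"
  using AE_space arrivals_eq[OF t]
proof eventually_elim
  case (elim \<omega>)
  note T0 = T_nonneg[OF elim(1)]
  have arr: "\<Gamma> i \<omega> \<le> t \<longleftrightarrow> i < arrivals t \<omega>" for i
    using elim(2) by (metis lessThan_iff mem_Collect_eq)
  let ?S = "SIGMA i:{..<arrivals t \<omega>}. {0..K i \<omega>}"
  have fS: "finite ?S" by auto
  have 1: "settled_claim t \<omega> p = 0" if "p \<notin> ?S" for p
    using that T0 unfolding settled_claim_def
    by (auto split: prod.splits simp flip: arr) (smt (verit))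
  have 2: "pending_claim t \<omega> p = 0" if "p \<notin> ?S" for p
    using that unfolding pending_claim_def by (auto split: prod.splits simp: arr)
  have "total_claim f \<Gamma> K T A t \<omega> = (\<Sum>p\<in>?S. settled_claim t \<omega> p)"
    unfolding total_claim_eq_nn_integral[OF elim(1)]
    by (subst nn_integral_count_space'[OF fS]) (auto simp: 1 claims_nonneg sum_nonneg simp del: mem_Sigma_iff)
  moreover have "residue_at f \<Gamma> K T A t \<omega> = (\<Sum>p\<in>?S. pending_claim t \<omega> p)"
    unfolding residue_eq_nn_integral[OF elim(1)]
    by (subst nn_integral_count_space'[OF fS]) (auto simp: 2 claims_nonneg sum_nonneg simp del: mem_Sigma_iff)
  moreover have "settled_claim t \<omega> p + pending_claim t \<omega> p = f (A (fst p) (snd p) \<omega>)" if pS: "p \<in> ?S" for p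
  proof -
    obtain i j where p: "p = (i, j)" "i < arrivals t \<omega>" "j \<le> K i \<omega>"
      by (rule SigmaE[OF pS]) auto
    have "j = 0 \<Longrightarrow> \<Gamma> i \<omega> + T i j \<omega> \<le> t" using p T_0[OF elim(1), of i] by (simp add: arr)
    then show ?thesis
      using p arr[of i] by (cases "j = 0") (auto simp: settled_claim_def pending_claim_def)
  qed
  then have "(\<Sum>p\<in>?S. settled_claim t \<omega> p + pending_claim t \<omega> p) = (\<Sum>p\<in>?S. f (A (fst p) (snd p) \<omega>))"
    by (rule sum.cong[OF refl])
  ultimately have "total_claim f \<Gamma> K T A t \<omega> + residue_at f \<Gamma> K T A t \<omega> = (\<Sum>p\<in>?S. f (A (fst p) (snd p) \<omega>))"
    by (simp only: sum.distrib)
  also have "\<dots> = (\<Sum>i<arrivals t \<omega>. cluster_total f K A i \<omega>)"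
    unfolding cluster_total_def by (subst sum.Sigma) (auto simp: case_prod_beta)
  finally show ?case .
qed

lemma claims_nonneg_total: "\<omega> \<in> space M \<Longrightarrow> 0 \<le> total_claim f \<Gamma> K T A t \<omega>"
  "\<omega> \<in> space M \<Longrightarrow> 0 \<le> residue_at f \<Gamma> K T A t \<omega>"
  by (simp_all add: total_claim_eq_nn_integral residue_eq_nn_integral)

end
end

section \<open>Stable limit of the total claim amount\<close>

theorem proposition4p2:
  fixes M :: "'w measure" and Q :: "'a::polish_space measure" and \<nu> :: real
    and \<K> :: "'a \<Rightarrow> (real \<times> 'a) measure measure"
    and \<Gamma> :: "nat \<Rightarrow> 'w \<Rightarrow> real" and K :: "nat \<Rightarrow> 'w \<Rightarrow> nat"
    and T :: "nat \<Rightarrow> nat \<Rightarrow> 'w \<Rightarrow> real" and A :: "nat \<Rightarrow> nat \<Rightarrow> 'w \<Rightarrow> 'a"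
    and f :: "'a \<Rightarrow> real" and \<alpha> :: real and a :: "nat \<Rightarrow> real"
    and P :: "'v measure" and D :: "'v \<Rightarrow> real"
  assumes model: "marked_poisson_cluster M Q \<nu> \<K> \<Gamma> K T A"
    and f: "f \<in> borel_measurable borel" "\<And>x. 0 \<le> f x"
    and \<alpha>: "0 < \<alpha>" "\<alpha> < 1"
    and rv: "\<And>i. prob_space.regularly_varying M (cluster_total f K A i) \<alpha>"
    and D: "prob_space P" "D \<in> borel_measurable P"
      "distr P borel D = distr M borel (cluster_total f K A 0)"
    and a: "filterlim a at_top sequentially"
      "(\<lambda>n. real n * \<P>(\<omega> in P. D \<omega> > a n)) \<longlonglongrightarrow> 1"
    and residue: "prob_space.small_o_prob M (residue_at f \<Gamma> K T A) (at_floor a)"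
  shows "\<exists>(P' :: real measure) G. prob_space P' \<and> prob_space.stable_rv P' G \<alpha> \<and>
    weak_conv_at_top
      (\<lambda>t. distr M borel (\<lambda>\<omega>. total_claim f \<Gamma> K T A t \<omega> / at_floor a (\<nu> * t)))
      (distr P' borel G)"
proof -
  interpret marked_poisson_cluster M Q \<nu> \<K> \<Gamma> K T A by (rule model)
  define \<mu> where "\<mu> = distr M borel (cluster_total f K A 0)"
  define C where "C = Gamma (1 - \<alpha>)"
  have C: "0 < C" using \<alpha> by (simp add: C_def Gamma_real_pos)
  note mD [measurable] = measurable_cluster_total[OF f, of 0]
  have \<mu>: "real_distribution \<mu>" unfolding \<mu>_def by (rule real_distribution_distr) measurable
  interpret \<mu>: real_distribution \<mu> by (rule \<mu>)
  have \<mu>0: "AE x in \<mu>. 0 \<le> x"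
    unfolding \<mu>_def by (subst AE_distr_iff) (auto simp: cluster_total_nonneg[OF f])
  have tail: "measure \<mu> {x<..} = prob {\<omega>\<in>space M. x < cluster_total f K A 0 \<omega>}" for x
    unfolding \<mu>_def by (subst measure_distr) (auto intro!: arg_cong[where f = prob])
  have anti: "antimono (\<lambda>x. measure \<mu> {x<..})"
    by (intro antimonoI \<mu>.finite_measure_mono) auto
  have pos: "\<forall>\<^sub>F x in at_top. 0 < measure \<mu> {x<..}"
    unfolding tail by (rule regularly_varying_tail(1)[OF rv])
  have rv': "((\<lambda>x. measure \<mu> {c * x<..} / measure \<mu> {x<..}) \<longlongrightarrow> c powr (- \<alpha>)) at_top" if "0 < c" for c
    unfolding tail by (rule regularly_varying_tail(2)[OF rv that])
  have na: "(\<lambda>n. real n * measure \<mu> {a n<..}) \<longlonglongrightarrow> 1"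
  proof -
    have "measure \<mu> {x<..} = \<P>(\<omega> in P. D \<omega> > x)" for x
      unfolding \<mu>_def D(3)[symmetric] using D(2)
      by (subst measure_distr) (auto intro!: arg_cong[where f = "measure P"])
    then show ?thesis using a(2) by simp
  qed
  obtain R where R: "0 < R" "\<forall>\<^sub>F t in at_top. at_floor a t \<le> R * at_floor a (\<nu> * t)"
    by (rule normalizing_ratio_bounded[OF anti pos rv' \<alpha>(1) rate_pos a(1) na])
  define b where "b t = at_floor a (\<nu> * t)" for t
  have n_top: "filterlim (\<lambda>t. nat \<lfloor>\<nu> * t\<rfloor>) sequentially at_top" using rate_pos by real_asymp
  have b_top: "filterlim b at_top at_top"
    unfolding b_def at_floor_def by (rule filterlim_compose[OF a(1) n_top])
  have b_pos: "\<forall>\<^sub>F t in at_top. 0 < b t" using b_top by (simp add: filterlim_at_top_dense)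
  have a_pos: "\<forall>\<^sub>F t in at_top. 0 < at_floor a t"
  proof -
    have "filterlim (\<lambda>t::real. nat \<lfloor>t\<rfloor>) sequentially at_top" by real_asymp
    from filterlim_compose[OF a(1) this] show ?thesis by (simp add: filterlim_at_top_dense at_floor_def)
  qed
  define S where "S t \<omega> = total_claim f \<Gamma> K T A t \<omega> / b t" for t \<omega>
  define Y where "Y t \<omega> = (\<Sum>i<arrivals t \<omega>. cluster_total f K A i \<omega>) / b t" for t \<omega>
  define Z where "Z t \<omega> = residue_at f \<Gamma> K T A t \<omega> / b t" for t \<omega>
  have meas: "S t \<in> borel_measurable M" "Y t \<in> borel_measurable M" "Z t \<in> borel_measurable M" for t
    unfolding S_def[abs_def] Y_def[abs_def] Z_def[abs_def]
    by (intro borel_measurable_divide borel_measurable_const measurable_total_claim[OF f]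
        measurable_sum_arrivals[OF f] measurable_residue[OF f])+
  have lim_Y: "((\<lambda>t. expectation (\<lambda>\<omega>. exp (- s * Y t \<omega>))) \<longlongrightarrow> exp (- (C * s powr \<alpha>))) at_top"
    if s: "0 < s" for s
  proof -
    let ?n = "\<lambda>t. nat \<lfloor>\<nu> * t\<rfloor>"
    let ?\<phi> = "\<lambda>t. 1 - (\<integral>x. exp (- (s / b t) * x) \<partial>\<mu>)"
    have lim_\<phi>: "((\<lambda>t. real (?n t) * ?\<phi> t) \<longlongrightarrow> C * s powr \<alpha>) at_top"
      using filterlim_compose[OF Laplace_scaling_limit[OF \<mu> \<mu>0 \<alpha> s pos rv' a(1) na] n_top]
      unfolding b_def at_floor_def C_def .
    have "((\<lambda>t. \<nu> * t / real (?n t)) \<longlongrightarrow> 1) at_top" using rate_pos by real_asymp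
    from tendsto_mult[OF this lim_\<phi>] have "((\<lambda>t. exp (- (\<nu> * t / real (?n t) * (real (?n t) * ?\<phi> t)))) \<longlongrightarrow> exp (- (C * s powr \<alpha>))) at_top"
      by (intro tendsto_exp tendsto_minus) simp
    moreover have "\<forall>\<^sub>F t in at_top. 0 < ?n t"
      by (rule eventually_compose_filterlim[OF eventually_gt_at_top n_top])
    then have "\<forall>\<^sub>F t in at_top. exp (- (\<nu> * t / real (?n t) * (real (?n t) * ?\<phi> t))) =
        expectation (\<lambda>\<omega>. exp (- s * Y t \<omega>))"
      using b_pos eventually_ge_at_top[of 0]
    proof eventually_elim
      case (elim t)
      have u: "0 \<le> s / b t" using s elim by simp
      have cancel: "x / r * (r * y) = x * y" if "r \<noteq> 0" for x y r :: real using that by simp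
      have n: "real (?n t) \<noteq> 0" using elim(1) by linarith
      have "expectation (\<lambda>\<omega>. exp (- s * Y t \<omega>)) =
          expectation (\<lambda>\<omega>. exp (- (s / b t) * (\<Sum>i<arrivals t \<omega>. cluster_total f K A i \<omega>)))"
        by (simp add: Y_def)
      also have "\<dots> = exp (- (\<nu> * t * (1 - expectation (\<lambda>\<omega>. exp (- (s / b t) * cluster_total f K A 0 \<omega>)))))"
        by (rule Laplace_aggregate[OF f elim(3) u])
      also have "expectation (\<lambda>\<omega>. exp (- (s / b t) * cluster_total f K A 0 \<omega>)) =
          (\<integral>x. exp (- (s / b t) * x) \<partial>\<mu>)"
        unfolding \<mu>_def by (subst integral_distr) auto
      also have "exp (- (\<nu> * t * ?\<phi> t)) = exp (- (\<nu> * t / real (?n t) * (real (?n t) * ?\<phi> t)))"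
        by (simp only: cancel[OF n])
      finally show ?case ..
    qed
    ultimately show ?thesis by (rule Lim_transform_eventually)
  qed
  \<comment> \<open>The hypothesis on the residue, transferred from the normalisation \<open>a\<^sub>t\<close> to \<open>a\<^bsub>\<nu> t\<^esub>\<close>.\<close>
  have lim_Z: "((\<lambda>t. prob {\<omega>\<in>space M. \<delta> < \<bar>Z t \<omega>\<bar>}) \<longlongrightarrow> 0) at_top" if \<delta>: "0 < \<delta>" for \<delta>
  proof (rule tendsto_sandwich[OF _ _ tendsto_const])
    have "0 < \<delta> / R" using \<delta> R by simp
    then show "((\<lambda>t. prob {\<omega>\<in>space M. \<delta> / R < \<bar>residue_at f \<Gamma> K T A t \<omega> / at_floor a t\<bar>}) \<longlongrightarrow> 0) at_top"
      using residue unfolding small_o_prob_def by blast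
    show "\<forall>\<^sub>F t in at_top. prob {\<omega>\<in>space M. \<delta> < \<bar>Z t \<omega>\<bar>} \<le>
        prob {\<omega>\<in>space M. \<delta> / R < \<bar>residue_at f \<Gamma> K T A t \<omega> / at_floor a t\<bar>}"
      using R(2) b_pos a_pos
    proof eventually_elim
      case (elim t)
      note [measurable] = measurable_residue[OF f, of t]
      have "\<delta> / R < \<bar>r / at_floor a t\<bar>" if "\<delta> < \<bar>r / b t\<bar>" for r
      proof -
        have "\<delta> * b t < \<bar>r\<bar>" using that elim by (simp add: abs_divide field_simps)
        moreover have "\<delta> * at_floor a t \<le> \<delta> * (R * b t)"
          using elim(1) \<delta> by (intro mult_left_mono) (auto simp: b_def)
        moreover have "R * (\<delta> * b t) < R * \<bar>r\<bar>" using calculation(1) R by simp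
        ultimately have "\<delta> * at_floor a t < R * \<bar>r\<bar>" by (simp add: mult_ac)
        then show ?thesis using elim R by (simp add: abs_divide field_simps)
      qed
      then show ?case by (intro finite_measure_mono) (auto simp: Z_def)
    qed
  qed simp
  have lim_S: "((\<lambda>t. expectation (\<lambda>\<omega>. exp (- s * S t \<omega>))) \<longlongrightarrow> exp (- (C * s powr \<alpha>))) at_top"
    if s: "0 < s" for s
  proof -
    have "((\<lambda>t. expectation (\<lambda>\<omega>. exp (- s * S t \<omega>)) - expectation (\<lambda>\<omega>. exp (- s * Y t \<omega>))) \<longlongrightarrow> 0) at_top"
    proof (rule tendstoI)
      fix e :: real assume e: "0 < e"
      define \<delta> where "\<delta> = e / (2 * s)"
      have \<delta>: "0 < \<delta>" "s * \<delta> = e / 2" using e s by (auto simp: \<delta>_def)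
      have "\<forall>\<^sub>F t in at_top. prob {\<omega>\<in>space M. \<delta> < \<bar>Z t \<omega>\<bar>} < e / 2"
        by (rule order_tendstoD[OF lim_Z[OF \<delta>(1)]]) (use e in simp)
      then show "\<forall>\<^sub>F t in at_top. dist (expectation (\<lambda>\<omega>. exp (- s * S t \<omega>)) - expectation (\<lambda>\<omega>. exp (- s * Y t \<omega>))) 0 < e"
        using b_pos eventually_ge_at_top[of 0]
      proof eventually_elim
        case (elim t)
        have "AE \<omega> in M. S t \<omega> + Z t \<omega> = Y t \<omega>"
          using total_claim_plus_residue[OF f elim(3)]
          by eventually_elim (simp add: S_def Z_def Y_def add_divide_distrib[symmetric])
        then have "\<bar>expectation (\<lambda>\<omega>. exp (- s * S t \<omega>)) - expectation (\<lambda>\<omega>. exp (- s * Y t \<omega>))\<bar> \<le>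
            s * \<delta> + prob {\<omega>\<in>space M. \<delta> < \<bar>Z t \<omega>\<bar>}"
          using elim(2) claims_nonneg_total[OF f]
          by (intro Laplace_perturbation[OF meas(1) _ meas(3) _ _ meas(2) s \<delta>(1)]) (auto simp: S_def Z_def)
        also have "\<dots> < e" using elim(1) \<delta> by simp
        finally show ?case by (simp only: dist_real_def diff_0_right)
      qed
    qed
    from tendsto_add[OF this lim_Y[OF s]] show ?thesis by simp
  qed
  define \<sigma> where "\<sigma> t = distr M borel (S t)" for t
  have \<sigma>: "real_distribution (\<sigma> t)" for t
    unfolding \<sigma>_def by (rule real_distribution_distr[OF meas(1)])
  have \<sigma>0: "\<forall>\<^sub>F t in at_top. AE x in \<sigma> t. 0 \<le> x"
    using b_pos
  proof eventually_elim
    case (elim t)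
    then show ?case unfolding \<sigma>_def
      by (subst AE_distr_iff[OF meas(1)]) (auto simp: S_def claims_nonneg_total[OF f])
  qed
  have \<sigma>L: "((\<lambda>t. \<integral>x. exp (- s * x) \<partial>\<sigma> t) \<longlongrightarrow> exp (- (C * s powr \<alpha>))) at_top" if "0 < s" for s
    using lim_S[OF that] unfolding \<sigma>_def by (subst integral_distr[OF meas(1)]) auto
  have L0: "((\<lambda>s. exp (- (C * s powr \<alpha>))) \<longlongrightarrow> 1) (at_right 0)"
    using \<alpha> C by real_asymp
  obtain G where G: "real_distribution G" "AE x in G. 0 \<le> x"
      "\<And>s. 0 < s \<Longrightarrow> (\<integral>x. exp (- s * x) \<partial>G) = exp (- (C * s powr \<alpha>))" "weak_conv_at_top \<sigma> G"
    by (rule weak_conv_at_top_of_Laplace[OF \<sigma> \<sigma>0 \<sigma>L L0]) auto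
  interpret G: real_distribution G by (rule G)
  have dG: "distr G borel (\<lambda>x. x) = G"
    by (rule distr_id2) simp
  show ?thesis
  proof (intro exI conjI)
    show "prob_space G" by (rule G.prob_space_axioms)
    show "prob_space.stable_rv G (\<lambda>x. x) \<alpha>"
      unfolding G.stable_rv_def dG using stable_law_of_Laplace[OF G(1-3) C \<alpha>] by simp
    show "weak_conv_at_top (\<lambda>t. distr M borel (\<lambda>\<omega>. total_claim f \<Gamma> K T A t \<omega> / at_floor a (\<nu> * t)))
      (distr G borel (\<lambda>x. x))"
      using G(4) unfolding dG \<sigma>_def S_def b_def .
  qed
qed

end
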